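(* (i) If $1<q<\infty$ and $0<p\le q$, then $\mathcal M(\mathcal D^p_{p-1}\cap\mathcal B,\ \mathcal D^q_{q-1}\cap\mathcal B)=\mathcal M(\mathcal B)=\mathcal B_{\log}\cap H^\infty$. (ii) If $0<q<p<\infty$, then $\mathcal M(\mathcal D^p_{p-1}\cap\mathcal B,\ \mathcal D^q_{q-1}\cap\mathcal B)=\{0\}$.
   Context: $\mathbb D$ is the open unit disc, $dA=\frac1\pi dx\,dy$. For $0<p<\infty$, $\mathcal D^p_{p-1}$ is the space of analytic $f$ in $\mathbb D$ with $\int_{\mathbb D}(1-|z|)^{p-1}|f'(z)|^p\,dA(z)<\infty$, normed by $\|f\|^p=|f(0)|^p+\int_{\mathbb D}(1-|z|)^{p-1}|f'|^p\,dA$. The Bloch space $\mathcal B$ consists of analytic $f$ with $\|f\|_{\mathcal B}=|f(0)|+\sup_{z\in\mathbb D}(1-|z|^2)|f'(z)|<\infty$. $\mathcal B_{\log}$ is the space of analytic $g$ with $\sup_{z\in\mathbb D}(1-|z|^2)|g'(z)|\log\frac{e}{1-|z|^2}<\infty$. $H^\infty$ is the space of bounded analytic functions on $\mathbb D$. For spaces $X,Y$ of analytic functions, $\mathcal M(X,Y)=\{g\text{ analytic in }\mathbb D: fg\in Y\text{ for all }f\in X\}$, $\mathcal M(X)=\mathcal M(X,X)$. The space $X\cap\mathcal D^p_{p-1}$ is normed by $\|f\|_X+\|f\|_{\mathcal D^p_{p-1}}$. *)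

theory Defs
  imports "HOL-Analysis.Analysis"
begin

abbreviation udisc :: "complex set" where "udisc \<equiv> ball 0 1"

text \<open>Analytic functions on the unit disc are functions complex to complex holomorphic on
  ball 0 1; membership in all spaces below only depends on values in the disc.\<close>

definition Dspace :: "real \<Rightarrow> (complex \<Rightarrow> complex) set" where
  "Dspace p = {f. f holomorphic_on udisc \<and>
     (\<integral>\<^sup>+ z \<in> udisc. ennreal ((1 / pi) * (1 - norm z) powr (p - 1) * norm (deriv f z) powr p) \<partial>lborel) < \<infinity>}"

definition Bloch :: "(complex \<Rightarrow> complex) set" where
  "Bloch = {f. f holomorphic_on udisc \<and>
     (\<exists>C. \<forall>z\<in>udisc. (1 - (norm z)\<^sup>2) * norm (deriv f z) \<le> C)}"

definition Bloch_log :: "(complex \<Rightarrow> complex) set" where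
  "Bloch_log = {g. g holomorphic_on udisc \<and>
     (\<exists>C. \<forall>z\<in>udisc. (1 - (norm z)\<^sup>2) * norm (deriv g z) * ln (exp 1 / (1 - (norm z)\<^sup>2)) \<le> C)}"

definition Hinf :: "(complex \<Rightarrow> complex) set" where
  "Hinf = {f. f holomorphic_on udisc \<and> (\<exists>C. \<forall>z\<in>udisc. norm (f z) \<le> C)}"

definition multipliers :: "(complex \<Rightarrow> complex) set \<Rightarrow> (complex \<Rightarrow> complex) set \<Rightarrow> (complex \<Rightarrow> complex) set" where
  "multipliers X Y = {g. g holomorphic_on udisc \<and> (\<forall>f\<in>X. (\<lambda>z. f z * g z) \<in> Y)}"

definition zero_space :: "(complex \<Rightarrow> complex) set" where
  "zero_space = {g. g holomorphic_on udisc \<and> (\<forall>z\<in>udisc. g z = 0)}"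

end

(*
Write L(r) = log(e/(1 - r^2)). A Bloch function is O(L), so B_log and H^infinity multiply B into B. That
they also multiply D^q into D^q for q > 1 reduces to the integrability of |f|^q / ((1 - r^2) L^q), a
Hardy inequality along radii: f(z) - f(z/2) is the integral of z f'(tz) over t in [1/2, 1], and after
Hoelder the scaling w = tz and Tonelli replace polar coordinates.

Conversely, a multiplier into B satisfies uniform bounds on the kernels 1, (1 - |a|^2)/(1 - conj(a) z) and
1 - log(1 - conj(a) z), because signed series of such kernels lie in every D^p and in B; evaluating these
bounds at z = a gives H^infinity and B_log.

If q < p and g is a nonzero multiplier, take f = sum (k+1)^(-1/q) z^(n_k) with n_k growing very fast,
depending on g. Then f lies in D^p and in B, and f g' has a finite D^q integral, while f' g does not:
on the shell 1/(4 n_k) <= 1 - |z| <= 1/(2 n_k) the k-th term dominates f', the mean of |g|^q there is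
bounded below by a nonzero Taylor coefficient of g, and the contributions sum like the harmonic series.
*)
theory Submission
  imports Defs "HOL-Complex_Analysis.Complex_Analysis"
begin

section \<open>Integration over the disc\<close>

text \<open>The test functions must lie in every \<open>Dspace p\<close>, also for
  \<open>p < 1\<close>. They are measured by one quadratic integral with weight
  \<open>(1 - norm z) powr (1/2)\<close>, half a power of \<open>1 - norm z\<close> stronger than in
  \<open>Dspace 2\<close>. Young's inequality spends this half power to reach every
  \<open>p < 2\<close>, and the Bloch bound gives the other \<open>p\<close>. For the kernels the
  integral is bounded uniformly because \<open>norm (1 - cnj a * z) powr (-3/2)\<close> has a
  singularity of order below 2 in the plane.

  As the test functions do not depend on \<open>p\<close> and \<open>q\<close>, multipliers are
  bounded also when \<open>q < p\<close>. There boundedness converts L^1 means of \<open>g\<close>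
  over shells, which a Taylor coefficient controls, into means of \<open>norm (g z) powr q\<close>.

  In the Hardy inequality \<open>q > 1\<close> leaves room for \<open>b = (q - 1) / 2\<close>: after
  the loss of \<open>Llog powr b\<close> in Hoelder's inequality there remains
  \<open>Llog powr (- b - 1)\<close>, integrable against \<open>1 / (1 - r^2)\<close>, and Tonelli
  returns \<open>Llog powr (- b)\<close>, which cancels the \<open>Llog powr b\<close> inside the
  Hoelder integral.\<close>

abbreviation disc_int :: "(complex \<Rightarrow> real) \<Rightarrow> ennreal" where
  "disc_int h \<equiv> \<integral>\<^sup>+z\<in>udisc. ennreal (h z) \<partial>lborel"

text \<open>Both \<open>f\<close> and \<open>F\<close> may be singular at the endpoints: the
  fundamental theorem is used on compact subintervals that exhaust \<open>{a<..<b}\<close>, so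
  bounded increments of an antiderivative suffice. Every radial integral below is bounded in this
  way.\<close>

lemma nn_integral_Ioo_le:
  fixes f F :: "real \<Rightarrow> real"
  assumes f: "f \<in> borel_measurable borel" and ab: "a < b"
    and der: "\<And>x. a < x \<Longrightarrow> x < b \<Longrightarrow> (F has_real_derivative f x) (at x)"
    and nonneg: "\<And>x. a < x \<Longrightarrow> x < b \<Longrightarrow> 0 \<le> f x"
    and le: "\<And>x y. a < x \<Longrightarrow> x \<le> y \<Longrightarrow> y < b \<Longrightarrow> F y - F x \<le> C"
  shows "(\<integral>\<^sup>+x\<in>{a<..<b}. ennreal (f x) \<partial>lborel) \<le> ennreal C"
proof -
  \<comment> \<open>The 3 keeps \<open>d n\<close> at most a third of the length, so every
    \<open>A n\<close> is a nondegenerate interval.\<close>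
  define d where "d n = (b - a) / (real n + 3)" for n :: nat
  have d0: "d n > 0" for n using ab by (simp add: d_def)
  have d1: "a + d n < b - d n" for n
  proof -
    have "d n \<le> (b - a) / 3" unfolding d_def using ab by (intro divide_left_mono) auto
    thus ?thesis using ab by (simp add: field_simps)
  qed
  have dec: "d n \<ge> d m" if "n \<le> m" for n m
    using ab that by (auto simp: d_def intro!: divide_left_mono)
  have dlim: "d \<longlonglongrightarrow> 0"
    unfolding d_def by real_asymp
  define A where "A n = {a + d n..b - d n}" for n
  have inc: "incseq A" unfolding incseq_def A_def using dec by fastforce
  have un: "(\<Union>n. A n) = {a<..<b}"
  proof (intro equalityI subsetI)
    fix x assume x: "x \<in> {a<..<b}"
    have "eventually (\<lambda>n. d n < min (x - a) (b - x)) sequentially"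
      using x by (intro order_tendstoD(2)[OF dlim]) auto
    then obtain n where "d n < min (x - a) (b - x)" by (auto simp: eventually_sequentially)
    thus "x \<in> (\<Union>n. A n)" by (auto simp: A_def intro!: exI[of _ n])
  next
    fix x assume "x \<in> (\<Union>n. A n)"
    then obtain n where "x \<in> A n" by auto
    thus "x \<in> {a<..<b}" using d0[of n] by (auto simp: A_def)
  qed
  have "(\<integral>\<^sup>+x\<in>{a<..<b}. ennreal (f x) \<partial>lborel) = (\<integral>\<^sup>+x. (SUP n. ennreal (f x) * indicator (A n) x) \<partial>lborel)"
    unfolding un[symmetric]
  proof (intro nn_integral_cong)
    fix x
    show "ennreal (f x) * indicator (\<Union>n. A n) x = (SUP n. ennreal (f x) * indicator (A n) x)"
      by (rule antisym)
        (auto simp: indicator_def intro!: SUP_least intro: SUP_upper2)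
  qed
  also have "... = (SUP n. \<integral>\<^sup>+x. ennreal (f x) * indicator (A n) x \<partial>lborel)"
  proof (intro nn_integral_monotone_convergence_SUP)
    show "incseq (\<lambda>n x. ennreal (f x) * indicator (A n) x)"
      using inc unfolding incseq_def le_fun_def by (auto intro!: mult_left_mono simp: indicator_def)
    show "(\<lambda>x. ennreal (f x) * indicator (A n) x) \<in> borel_measurable lborel" for n
      using f by (simp add: A_def)
  qed
  also have "... \<le> ennreal C"
  proof (rule SUP_least)
    fix n
    have "(\<integral>\<^sup>+x. ennreal (f x) * indicator (A n) x \<partial>lborel) = ennreal (F (b - d n) - F (a + d n))"
      unfolding A_def using d0[of n] d1[of n] f
      by (intro nn_integral_FTC_Icc) (auto intro!: der nonneg has_vector_derivative_at_within simp flip: has_real_derivative_iff_has_vector_derivative)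
    also have "... \<le> ennreal C" using d0[of n] d1[of n] by (intro ennreal_leI le) auto
    finally show "(\<integral>\<^sup>+x. ennreal (f x) * indicator (A n) x \<partial>lborel) \<le> ennreal C" .
  qed
  finally show ?thesis .
qed

lemma emeasure_disc_complex: "0 \<le> r \<Longrightarrow> emeasure lborel (ball (a::complex) r) = ennreal (pi * r^2)"
   "0 \<le> r \<Longrightarrow> emeasure lborel (cball (a::complex) r) = ennreal (pi * r^2)"
  by (simp_all add: emeasure_ball emeasure_cball unit_ball_vol_2)

lemma udisc_borel [measurable]: "udisc \<in> sets borel"
  by simp

text \<open>Polar coordinates for radial integrands: the image of the area measure under
  \<open>norm\<close> is identified with \<open>N\<close> by its values on half-lines, that is, by
  areas of annuli.\<close>

lemma nn_integral_radial:
  assumes k: "k \<in> borel_measurable borel"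
  shows "(\<integral>\<^sup>+z\<in>udisc. k (norm z) \<partial>lborel) = (\<integral>\<^sup>+r\<in>{0<..<1}. ennreal (2 * pi * r) * k r \<partial>lborel)"
proof -
  define M where "M = distr (density lborel (indicator udisc)) borel (norm :: complex \<Rightarrow> real)"
  define N where "N = density lborel (\<lambda>r::real. ennreal (2 * pi * r) * indicator {0<..<1} r)"
  have eM: "emeasure M {x<..} = emeasure lborel (udisc \<inter> {z. x < norm z})" for x
  proof -
    have m: "{z::complex. x < norm z} \<in> sets borel" by measurable
    have "emeasure M {x<..} = (\<integral>\<^sup>+z. indicator udisc z * indicator {z. x < norm z} z \<partial>lborel)"
    proof -
      have "emeasure M {x<..} = emeasure (density lborel (indicator udisc)) {z::complex. x < norm z}"
        unfolding M_def by (subst emeasure_distr) (auto simp: vimage_def)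
      also have "... = (\<integral>\<^sup>+z. indicator udisc z * indicator {z. x < norm z} z \<partial>lborel)"
        using m by (intro emeasure_density borel_measurable_indicator) auto
      finally show ?thesis .
    qed
    also have "... = emeasure lborel (udisc \<inter> {z. x < norm z})"
      by (simp add: indicator_inter_arith[symmetric])
    finally show ?thesis .
  qed
  have eN: "emeasure N {x<..} = ennreal (pi * (1 - (max 0 x)^2))" if "x < 1" for x
  proof -
    have "emeasure N {x<..} = (\<integral>\<^sup>+r. ennreal (2 * pi * r) * indicator {0<..<1} r * indicator {x<..} r \<partial>lborel)"
      unfolding N_def by (subst emeasure_density) auto
    also have "... = (\<integral>\<^sup>+r. ennreal (2 * pi * r) * indicator {max 0 x..1} r \<partial>lborel)"
    proof (rule nn_integral_cong_AE)
      show "AE r in lborel. ennreal (2 * pi * r) * indicator {0<..<1} r * indicator {x<..} r = ennreal (2 * pi * r) * indicator {max 0 x..1} r"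
        using AE_lborel_singleton[of 0] AE_lborel_singleton[of 1] AE_lborel_singleton[of x]
        by eventually_elim (auto simp: indicator_def)
    qed
    also have "... = ennreal (pi * 1^2 - pi * (max 0 x)^2)"
      using that by (intro nn_integral_FTC_Icc) (auto intro!: derivative_eq_intros simp flip: has_real_derivative_iff_has_vector_derivative)
    finally show ?thesis by (simp add: algebra_simps)
  qed
  have eN1: "emeasure N {x<..} = 0" if "x \<ge> 1" for x
  proof -
    have "emeasure N {x<..} = (\<integral>\<^sup>+r. ennreal (2 * pi * r) * indicator {0<..<1} r * indicator {x<..} r \<partial>lborel)"
      unfolding N_def by (subst emeasure_density) auto
    also have "... = (\<integral>\<^sup>+r. 0 \<partial>(lborel::real measure))"
      using that by (intro nn_integral_cong) (auto simp: indicator_def)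
    finally show ?thesis by simp
  qed
  have eM': "emeasure M {x<..} = ennreal (pi * (1 - (max 0 x)^2))" if "x < 1" for x
  proof (cases "x < 0")
    case True
    hence "udisc \<inter> {z. x < norm z} = udisc" by (auto intro: less_le_trans)
    thus ?thesis using True eM by (simp add: emeasure_disc_complex max_def)
  next
    case False
    have "emeasure lborel (udisc - cball 0 x) = emeasure lborel udisc - emeasure lborel (cball (0::complex) x)"
      using False that by (intro emeasure_Diff) (auto simp: emeasure_disc_complex)
    moreover have "udisc \<inter> {z. x < norm z} = udisc - cball 0 x" by auto
    ultimately show ?thesis using False that eM
      by (simp add: emeasure_disc_complex max_def ennreal_minus algebra_simps)
  qed
  have eM1: "emeasure M {x<..} = 0" if "x \<ge> 1" for x
  proof -
    have "udisc \<inter> {z. x < norm z} = {}" using that by auto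
    thus ?thesis using eM by simp
  qed
  have MN: "M = N"
  proof (rule measure_eqI_lessThan)
    show "emeasure M {x<..} < \<infinity>" for x using eM' eM1 by (cases "x < 1") auto
    show "emeasure M {x<..} = emeasure N {x<..}" for x using eM' eM1 eN eN1 by (cases "x < 1") auto
  qed (simp_all add: M_def N_def)
  have "(\<integral>\<^sup>+z\<in>udisc. k (norm z) \<partial>lborel) = (\<integral>\<^sup>+r. k r \<partial>M)"
  proof -
    have "(\<integral>\<^sup>+r. k r \<partial>M) = (\<integral>\<^sup>+z. k (norm z) \<partial>density lborel (indicator udisc))"
      unfolding M_def using k by (subst nn_integral_distr) auto
    also have "... = (\<integral>\<^sup>+z. indicator udisc z * k (norm z) \<partial>lborel)"
      using k by (intro nn_integral_density borel_measurable_indicator) auto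
    finally show ?thesis by (simp add: mult.commute)
  qed
  also have "... = (\<integral>\<^sup>+r. k r \<partial>N)" by (simp add: MN)
  also have "... = (\<integral>\<^sup>+r\<in>{0<..<1}. ennreal (2 * pi * r) * k r \<partial>lborel)"
    unfolding N_def using k by (subst nn_integral_density) (auto intro!: nn_integral_cong simp: ac_simps)
  finally show ?thesis .
qed

lemma nn_integral_lborel_scaleR:
  fixes h :: "'a::euclidean_space \<Rightarrow> ennreal"
  assumes h: "h \<in> borel_measurable borel" and c: "c > 0"
  shows "(\<integral>\<^sup>+z. h z \<partial>lborel) = ennreal (c ^ DIM('a)) * (\<integral>\<^sup>+z. h (c *\<^sub>R z) \<partial>lborel)"
  using h c by (subst lborel_affine[of c 0])
    (auto simp: nn_integral_density nn_integral_distr nn_integral_cmult)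

lemma nn_integral_lborel_translate:
  fixes h :: "'a::euclidean_space \<Rightarrow> ennreal"
  assumes h: "h \<in> borel_measurable borel"
  shows "(\<integral>\<^sup>+z. h (a + z) \<partial>lborel) = (\<integral>\<^sup>+z. h z \<partial>lborel)"
  using h by (subst (2) lborel_affine[of 1 a])
    (auto simp: nn_integral_density nn_integral_distr nn_integral_cmult)

section \<open>The spaces\<close>

definition Llog :: "real \<Rightarrow> real" where "Llog r = 1 - ln (1 - r^2)"

lemma one_minus_sq_pos: "0 \<le> r \<Longrightarrow> r < 1 \<Longrightarrow> 0 < 1 - (r::real)^2"
  by (simp add: power_less_one_iff abs_square_less_1)

lemma ln_exp_div_eq_Llog: "0 \<le> r \<Longrightarrow> r < 1 \<Longrightarrow> ln (exp 1 / (1 - r^2)) = Llog r"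
  using one_minus_sq_pos[of r] by (simp add: Llog_def ln_div)

lemma Llog_ge_1: "0 \<le> r \<Longrightarrow> r < 1 \<Longrightarrow> 1 \<le> Llog r"
  using one_minus_sq_pos[of r] by (simp add: Llog_def)

lemma Llog_mono: "0 \<le> r \<Longrightarrow> r \<le> s \<Longrightarrow> s < 1 \<Longrightarrow> Llog r \<le> Llog s"
  using one_minus_sq_pos[of s] power_mono[of r s 2] by (auto simp: Llog_def intro!: ln_mono)

lemma has_field_derivative_Llog:
  "0 \<le> r \<Longrightarrow> r < 1 \<Longrightarrow> (Llog has_real_derivative 2 * r / (1 - r^2)) (at r)"
  unfolding Llog_def using one_minus_sq_pos[of r]
  by (auto intro!: derivative_eq_intros simp: field_simps)

text \<open>The constant 1 in \<open>Llog\<close> absorbs \<open>ln (1 + r)\<close>, the difference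
  between the logarithms of \<open>1 - r^2\<close> and \<open>1 - r\<close>.\<close>

lemma minus_ln_le_Llog: "0 \<le> r \<Longrightarrow> r < 1 \<Longrightarrow> - ln (1 - r) \<le> Llog r"
proof -
  assume r: "0 \<le> r" "r < 1"
  have "1 - r^2 = (1 - r) * (1 + r)" by (simp add: power2_eq_square algebra_simps)
  hence "ln (1 - r^2) = ln (1 - r) + ln (1 + r)" using r by (simp add: ln_mult)
  moreover have "ln (1 + r) \<le> r" using r by (intro ln_add_one_self_le_self)
  ultimately show ?thesis using r by (simp add: Llog_def)
qed

section \<open>Bloch functions: constants, radial growth, products\<close>

lemma Bloch_holomorphic: "f \<in> Bloch \<Longrightarrow> f holomorphic_on udisc"
  by (simp add: Bloch_def)

abbreviation bnorm :: "complex \<Rightarrow> complex \<Rightarrow> real" where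
  "bnorm z x \<equiv> (1 - (norm z)^2) * norm x"

lemma BlochE:
  assumes "f \<in> Bloch"
  obtains C where "C \<ge> 0" "\<And>z. z \<in> udisc \<Longrightarrow> bnorm z (deriv f z) \<le> C"
proof -
  from assms obtain C where C: "\<forall>z\<in>udisc. bnorm z (deriv f z) \<le> C"
    by (auto simp: Bloch_def)
  show ?thesis using C by (intro that[of "max C 0"]) (auto simp: max.coboundedI1)
qed

lemma HinfE:
  assumes "f \<in> Hinf"
  obtains C where "C > 0" "\<And>z. z \<in> udisc \<Longrightarrow> norm (f z) \<le> C"
proof -
  from assms obtain C where C: "\<forall>z\<in>udisc. norm (f z) \<le> C" by (auto simp: Hinf_def)
  show ?thesis using C by (intro that[of "max C 1"]) (auto simp: max.coboundedI1)
qed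

lemma Bloch_logE:
  assumes "g \<in> Bloch_log"
  obtains C where "C \<ge> 0"
    "\<And>z. z \<in> udisc \<Longrightarrow> bnorm z (deriv g z) * Llog (norm z) \<le> C"
proof -
  from assms obtain C where C: "\<forall>z\<in>udisc. bnorm z (deriv g z) * ln (exp 1 / (1 - (norm z)^2)) \<le> C"
    by (auto simp: Bloch_log_def)
  show ?thesis
  proof (rule that[of "max C 0"])
    fix z :: complex assume z: "z \<in> udisc"
    show "bnorm z (deriv g z) * Llog (norm z) \<le> max C 0"
      using C[rule_format, OF z] z ln_exp_div_eq_Llog[of "norm z"] by auto
  qed auto
qed

text \<open>Mean value inequality along the radius: the derivative of f(t z) in t is dominated by
  that of \<open>- C * ln (1 - t * norm z)\<close>. With the weight \<open>1 - norm w\<close> in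
  place of \<open>1 - (norm w)^2\<close> the estimate also serves for
  \<open>kernel_family\<close>.\<close>

lemma norm_increment_le:
  assumes f: "f holomorphic_on udisc" and z: "z \<in> udisc"
    and C: "\<And>w. w \<in> udisc \<Longrightarrow> (1 - norm w) * norm (deriv f w) \<le> C"
  shows "norm (f z - f 0) \<le> C * (- ln (1 - norm z))"
proof -
  define r where "r = norm z"
  have r: "0 \<le> r" "r < 1" using z by (auto simp: r_def)
  have tr: "t * r < 1" if "0 \<le> t" "t \<le> 1" for t
    using that r mult_left_le_one_le[of r t] by simp
  have tz: "of_real t * z \<in> udisc" if "0 \<le> t" "t \<le> 1" for t
    using tr[OF that] that by (simp add: norm_mult r_def)
  have "norm (f (of_real 1 * z) - f (of_real 0 * z)) \<le> (- C * ln (1 - 1 * r)) - (- C * ln (1 - 0 * r))"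
  proof (rule differentiable_bound_general[where f = "\<lambda>t. f (of_real t * z)" and \<phi> = "\<lambda>t. - C * ln (1 - t * r)"
        and \<phi>' = "\<lambda>t. C * r / (1 - t * r)" and f' = "\<lambda>t. z * deriv f (of_real t * z)"])
    show "continuous_on {0..1} (\<lambda>t. f (of_real t * z))"
    proof (rule continuous_on_compose2[OF holomorphic_on_imp_continuous_on[OF f]])
      show "continuous_on {0..1} (\<lambda>t. complex_of_real t * z)" by (intro continuous_intros)
    qed (use tz in auto)
    show "continuous_on {0..1} (\<lambda>t. - C * ln (1 - t * r))"
      using tr by (intro continuous_intros) (auto simp: less_le)
  next
    fix t :: real assume t: "0 < t" "t < 1"
    have "(f has_field_derivative deriv f (of_real t * z)) (at (of_real t * z))"
      using f tz[of t] t by (intro holomorphic_derivI[of f udisc]) auto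
    hence "((\<lambda>w. f (w * z)) has_field_derivative deriv f (of_real t * z) * z) (at (of_real t))"
      by (intro DERIV_chain2[where f = f]) (auto intro!: derivative_eq_intros)
    from has_vector_derivative_real_field[OF this]
    show "((\<lambda>t. f (of_real t * z)) has_vector_derivative z * deriv f (of_real t * z)) (at t)"
      by (simp add: mult.commute)
    show "((\<lambda>t. - C * ln (1 - t * r)) has_vector_derivative C * r / (1 - t * r)) (at t)"
      using tr[of t] t unfolding has_real_derivative_iff_has_vector_derivative[symmetric]
      by (auto intro!: derivative_eq_intros simp: field_simps)
    have "(1 - t * r) * norm (deriv f (of_real t * z)) \<le> C"
      using C[OF tz[of t]] t by (simp add: norm_mult r_def)
    hence "r * ((1 - t * r) * norm (deriv f (of_real t * z))) \<le> r * C"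
      using r by (intro mult_left_mono)
    thus "norm (z * deriv f (of_real t * z)) \<le> C * r / (1 - t * r)"
      using tr[of t] t by (simp add: norm_mult r_def field_simps)
  qed auto
  thus ?thesis by (simp add: r_def)
qed

lemma Bloch_weaken:
  assumes "z \<in> udisc" "bnorm z (x :: complex) \<le> C"
  shows "(1 - norm z) * norm x \<le> C"
proof -
  have "(norm z)^2 \<le> norm z" using assms(1) by (simp add: power2_eq_square mult_left_le_one_le)
  hence "(1 - norm z) * norm x \<le> (1 - (norm z)^2) * norm x" by (intro mult_right_mono) auto
  thus ?thesis using assms(2) by simp
qed

lemma Bloch_growth:
  assumes f: "f \<in> Bloch"
  obtains C where "C > 0" "\<And>z. z \<in> udisc \<Longrightarrow> norm (f z) \<le> C * Llog (norm z)"
proof -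
  from BlochE[OF f] obtain C where C: "C \<ge> 0" "\<And>z. z \<in> udisc \<Longrightarrow> bnorm z (deriv f z) \<le> C" by metis
  show ?thesis
  proof (rule that[of "norm (f 0) + C + 1"])
    fix z :: complex assume z: "z \<in> udisc"
    have "norm (f z - f 0) \<le> C * (- ln (1 - norm z))"
      using z C by (intro norm_increment_le Bloch_holomorphic f) (auto intro!: Bloch_weaken)
    also have "... \<le> C * Llog (norm z)"
      using z C minus_ln_le_Llog[of "norm z"] by (intro mult_left_mono) auto
    finally have 1: "norm (f z - f 0) \<le> C * Llog (norm z)" .
    have "norm (f 0) + 1 \<le> (norm (f 0) + 1) * Llog (norm z)"
      using Llog_ge_1[of "norm z"] z mult_left_mono[of 1 "Llog (norm z)" "norm (f 0) + 1"] by simp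
    thus "norm (f z) \<le> (norm (f 0) + C + 1) * Llog (norm z)"
      using 1 norm_triangle_ineq[of "f 0" "f z - f 0"] by (simp add: algebra_simps)
  qed (use C in \<open>auto intro: add_nonneg_pos\<close>)
qed

lemma deriv_mult_disc:
  assumes "f holomorphic_on udisc" "g holomorphic_on udisc" "z \<in> udisc"
  shows "deriv (\<lambda>z. f z * g z) z = f z * deriv g z + deriv f z * g z"
  using assms by (intro deriv_mult holomorphic_on_imp_differentiable_at[of _ udisc]) auto

lemma Bloch_mult:
  assumes f: "f \<in> Bloch" and g: "g \<in> Bloch_log" "g \<in> Hinf"
  shows "(\<lambda>z. f z * g z) \<in> Bloch"
proof -
  have hol: "f holomorphic_on udisc" "g holomorphic_on udisc"
    using f g by (auto simp: Bloch_def Hinf_def)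
  from BlochE[OF f] obtain A where A: "A \<ge> 0" "\<And>z. z \<in> udisc \<Longrightarrow> bnorm z (deriv f z) \<le> A" by metis
  from Bloch_growth[OF f] obtain B where B: "B > 0" "\<And>z. z \<in> udisc \<Longrightarrow> norm (f z) \<le> B * Llog (norm z)" by metis
  from Bloch_logE[OF g(1)] obtain C where C: "C \<ge> 0"
    "\<And>z. z \<in> udisc \<Longrightarrow> bnorm z (deriv g z) * Llog (norm z) \<le> C" by metis
  from HinfE[OF g(2)] obtain M where M: "M > 0" "\<And>z. z \<in> udisc \<Longrightarrow> norm (g z) \<le> M" by metis
  have "bnorm z (deriv (\<lambda>z. f z * g z) z) \<le> B * C + A * M" if z: "z \<in> udisc" for z
  proof -
    have p: "1 - (norm z)^2 > 0" using z one_minus_sq_pos[of "norm z"] by auto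
    have "bnorm z (deriv (\<lambda>z. f z * g z) z)
        \<le> (1 - (norm z)^2) * (norm (f z) * norm (deriv g z) + norm (deriv f z) * norm (g z))"
      unfolding deriv_mult_disc[OF hol z] using p
      by (intro mult_left_mono) (auto intro: order_trans[OF norm_triangle_ineq] simp: norm_mult)
    also have "... \<le> (1 - (norm z)^2) * (B * Llog (norm z) * norm (deriv g z) + norm (deriv f z) * M)"
      using p B(2)[OF z] M(2)[OF z] by (intro mult_left_mono add_mono mult_right_mono) auto
    also have "... = B * (bnorm z (deriv g z) * Llog (norm z)) + (bnorm z (deriv f z)) * M"
      by (simp add: algebra_simps)
    also have "... \<le> B * C + A * M"
      using A(2)[OF z] C(2)[OF z] B M by (intro add_mono mult_left_mono mult_right_mono) auto
    finally show ?thesis .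
  qed
  moreover have "(\<lambda>z. f z * g z) holomorphic_on udisc" using hol by (intro holomorphic_intros)
  ultimately show ?thesis unfolding Bloch_def by blast
qed

section \<open>Weighted area integrals and membership in \<open>Dspace p\<close>\<close>

lemma bounded_on_half_disc:
  fixes h :: "complex \<Rightarrow> 'a::real_normed_vector"
  assumes "continuous_on udisc h"
  obtains B where "B \<ge> 0" "\<And>z. norm z \<le> 1/2 \<Longrightarrow> norm (h z) \<le> B"
proof -
  have "continuous_on (cball 0 (1/2)) h" by (rule continuous_on_subset[OF assms]) auto
  hence "bounded (h ` cball 0 (1/2))" by (intro compact_imp_bounded compact_continuous_image) auto
  then obtain B where "\<And>z. z \<in> cball 0 (1/2) \<Longrightarrow> norm (h z) \<le> B" unfolding bounded_iff by blast
  thus ?thesis by (intro that[of "max B 0"]) (auto simp: max.coboundedI1)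
qed

lemma continuous_on_deriv_disc: "f holomorphic_on udisc \<Longrightarrow> continuous_on udisc (deriv f)"
  by (intro holomorphic_on_imp_continuous_on holomorphic_deriv) auto

abbreviation wnorm :: "real \<Rightarrow> complex \<Rightarrow> complex \<Rightarrow> real" where
  "wnorm p z x \<equiv> (1 - norm z) powr (p - 1) * norm x powr p"

text \<open>Positivity of \<open>p\<close> gives continuity at the zeros of \<open>F\<close>; the
  exponent \<open>e\<close> is free because its base is positive on the disc.\<close>

lemma continuous_on_weighted:
  fixes F :: "complex \<Rightarrow> complex"
  assumes "continuous_on udisc F" "p > 0"
  shows "continuous_on udisc (\<lambda>z. (1 - norm z) powr e * norm (F z) powr p)"
  using assms by (intro continuous_intros continuous_on_powr') auto

lemma set_integrable_disc_dominated:
  fixes h k :: "complex \<Rightarrow> real"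
  assumes "set_integrable lborel udisc h" "continuous_on udisc k"
    and "\<And>z. z \<in> udisc \<Longrightarrow> 0 \<le> k z" "\<And>z. z \<in> udisc \<Longrightarrow> k z \<le> h z"
  shows "set_integrable lborel udisc k"
proof (rule set_integrable_bound[OF assms(1)])
  show "set_borel_measurable lborel udisc k"
    unfolding set_borel_measurable_def
    using borel_measurable_continuous_on_indicator[OF _ assms(2)] by simp
  show "AE z in lborel. z \<in> udisc \<longrightarrow> norm (k z) \<le> norm (h z)"
    using assms(3,4) by (intro AE_I2) fastforce
qed

lemma set_integrable_disc_iff:
  fixes h :: "complex \<Rightarrow> real"
  assumes "continuous_on udisc h" "\<And>z. z \<in> udisc \<Longrightarrow> 0 \<le> h z"
  shows "set_integrable lborel udisc h \<longleftrightarrow> disc_int h < \<infinity>"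
proof -
  have m: "(\<lambda>z. indicat_real udisc z *\<^sub>R h z) \<in> borel_measurable lborel"
    using borel_measurable_continuous_on_indicator[OF _ assms(1)] by simp
  have "disc_int h = (\<integral>\<^sup>+z. ennreal (norm (indicat_real udisc z *\<^sub>R h z)) \<partial>lborel)"
    using assms(2) by (intro nn_integral_cong) (auto simp: indicator_def)
  thus ?thesis unfolding set_integrable_def integrable_iff_bounded using m by simp
qed

lemma set_nn_integral_disc_measurable:
  fixes h :: "complex \<Rightarrow> real"
  assumes "continuous_on udisc h" "\<And>z. z \<in> udisc \<Longrightarrow> 0 \<le> h z"
  shows "(\<lambda>z. ennreal (h z) * indicator udisc z) \<in> borel_measurable borel"
proof -
  have "(\<lambda>z. ennreal (indicat_real udisc z *\<^sub>R h z)) \<in> borel_measurable borel"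
    using borel_measurable_continuous_on_indicator[OF _ assms(1)] by simp
  also have "(\<lambda>z. ennreal (indicat_real udisc z *\<^sub>R h z)) = (\<lambda>z. ennreal (h z) * indicator udisc z)"
    by (auto simp: indicator_def)
  finally show ?thesis .
qed

lemma Dspace_iff:
  assumes p: "p > 0"
  shows "f \<in> Dspace p \<longleftrightarrow> f holomorphic_on udisc \<and>
    set_integrable lborel udisc (\<lambda>z. wnorm p z (deriv f z))"
proof (cases "f holomorphic_on udisc")
  case True
  let ?h = "\<lambda>z. wnorm p z (deriv f z)"
  have c: "continuous_on udisc ?h"
    by (intro continuous_on_weighted continuous_on_deriv_disc True p)
  have m: "(\<lambda>z. ennreal (?h z) * indicator udisc z) \<in> borel_measurable lborel"
    using set_nn_integral_disc_measurable[OF c] by simp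
  have "disc_int (\<lambda>z. (1 / pi) * (1 - norm z) powr (p - 1) * norm (deriv f z) powr p)
      = (\<integral>\<^sup>+z. ennreal (1 / pi) * (ennreal (?h z) * indicator udisc z) \<partial>lborel)"
    by (intro nn_integral_cong) (auto simp: indicator_def ennreal_mult'[symmetric])
  also have "... = ennreal (1 / pi) * disc_int ?h"
    using m by (rule nn_integral_cmult)
  finally show ?thesis
    using True set_integrable_disc_iff[OF c] unfolding Dspace_def
    by (auto simp: ennreal_mult_less_top)
qed (auto simp: Dspace_def)

lemma Dspace_holomorphic: "f \<in> Dspace p \<Longrightarrow> f holomorphic_on udisc"
  by (simp add: Dspace_def)

lemma Dspace_dominated:
  assumes f: "f holomorphic_on udisc" and p: "p > 0" and h: "set_integrable lborel udisc h"
    and le: "\<And>z. z \<in> udisc \<Longrightarrow> wnorm p z (deriv f z) \<le> h z"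
  shows "f \<in> Dspace p"
  unfolding Dspace_iff[OF p]
  by (intro conjI f set_integrable_disc_dominated[OF h _ _ le]
    continuous_on_weighted continuous_on_deriv_disc p) auto

text \<open>The surplus factor \<open>((1 - norm z) * norm (deriv f z)) powr (q - p)\<close> is
  bounded for a Bloch function.\<close>

lemma Dspace_mono:
  assumes f: "f \<in> Dspace p" "f \<in> Bloch" and pq: "0 < p" "p \<le> q"
  shows "f \<in> Dspace q"
proof -
  from BlochE[OF f(2)] obtain C where C: "C \<ge> 0" "\<And>z. z \<in> udisc \<Longrightarrow> bnorm z (deriv f z) \<le> C" by metis
  have int: "set_integrable lborel udisc (\<lambda>z. wnorm p z (deriv f z))"
    using f pq Dspace_iff by auto
  have hol: "f holomorphic_on udisc" using f by (simp add: Bloch_def)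
  show ?thesis
  proof (rule Dspace_dominated[OF hol])
    show "set_integrable lborel udisc (\<lambda>z. C powr (q - p) * wnorm p z (deriv f z))"
      using int by (intro set_integrable_mult_right)
    fix z :: complex assume z: "z \<in> udisc"
    have "wnorm q z (deriv f z)
       = ((1 - norm z) * norm (deriv f z)) powr (q - p) * wnorm p z (deriv f z)"
    proof -
      have "(1 - norm z) powr (q - 1) = (1 - norm z) powr (q - p) * (1 - norm z) powr (p - 1)"
        by (simp flip: powr_add)
      moreover have "norm (deriv f z) powr q = norm (deriv f z) powr (q - p) * norm (deriv f z) powr p"
        by (simp flip: powr_add)
      ultimately show ?thesis using z by (simp add: powr_mult)
    qed
    also have "... \<le> C powr (q - p) * wnorm p z (deriv f z)"
      using z Bloch_weaken[OF z C(2)[OF z]] pq by (intro mult_right_mono powr_mono2) auto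
    finally show "wnorm q z (deriv f z) \<le> C powr (q - p) * wnorm p z (deriv f z)" .
  qed (use pq in simp)
qed

lemma set_integrable_disc_powr:
  assumes e: "e > -1"
  shows "set_integrable lborel udisc (\<lambda>z::complex. (1 - norm z) powr e)"
proof -
  have c: "continuous_on udisc (\<lambda>z::complex. (1 - norm z) powr e)"
    by (intro continuous_intros) auto
  have "disc_int (\<lambda>z. (1 - norm (z::complex)) powr e)
     = (\<integral>\<^sup>+r\<in>{0<..<1}. ennreal (2 * pi * r) * ennreal ((1 - r) powr e) \<partial>lborel)"
    by (intro nn_integral_radial[of "\<lambda>r. ennreal ((1 - r) powr e)"]) measurable
  also have "... \<le> (\<integral>\<^sup>+r\<in>{0<..<1}. ennreal (2 * pi * (1 - r) powr e) \<partial>lborel)"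
    by (intro nn_integral_mono)
       (auto simp: indicator_def ennreal_mult'[symmetric] intro!: ennreal_leI mult_left_le_one_le)
  also have "... \<le> ennreal (2 * pi / (e + 1))"
  proof (rule nn_integral_Ioo_le[where F = "\<lambda>r. - (2 * pi / (e + 1)) * (1 - r) powr (e + 1)"])
    fix x :: real assume x: "0 < x" "x < 1"
    have "((\<lambda>r. (1 - r) powr (e + 1)) has_real_derivative ((e + 1) * (1 - x) powr (e + 1 - 1)) * (-1)) (at x)"
      using x by (intro DERIV_chain2[OF has_real_derivative_powr]) (auto intro!: derivative_eq_intros)
    from DERIV_cmult[OF this, of "- (2 * pi / (e + 1))"]
    show "((\<lambda>r. - (2 * pi / (e + 1)) * (1 - r) powr (e + 1)) has_real_derivative 2 * pi * (1 - x) powr e) (at x)"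
      using e by (simp add: mult.assoc)
  next
    fix x y :: real assume x: "0 < x" "x \<le> y" "y < 1"
    have "(1 - x) powr (e + 1) \<le> 1" using x e by (intro powr_le1) auto
    hence "(1 - x) powr (e + 1) - (1 - y) powr (e + 1) \<le> 1"
      by (smt (verit) powr_ge_zero)
    hence "(2 * pi / (e + 1)) * ((1 - x) powr (e + 1) - (1 - y) powr (e + 1)) \<le> (2 * pi / (e + 1)) * 1"
      using e by (intro mult_left_mono) auto
    thus "- (2 * pi / (e + 1)) * (1 - y) powr (e + 1) - - (2 * pi / (e + 1)) * (1 - x) powr (e + 1) \<le> 2 * pi / (e + 1)"
      by (simp add: algebra_simps)
  qed auto
  also have "... < \<infinity>" by simp
  finally show ?thesis using set_integrable_disc_iff[OF c] by simp
qed

section \<open>Tools for the uniform boundedness argument\<close>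

text \<open>Because \<open>2 * b = (s + b) - (s - b)\<close>, at least one of the two signs gives a
  sum of modulus at least \<open>norm b\<close>. The choice at \<open>j\<close> depends only on the
  earlier signs, so it can be made recursively.\<close>

lemma exists_signs:
  fixes b :: "nat \<Rightarrow> nat \<Rightarrow> complex"
  shows "\<exists>sg. \<forall>j. sg j \<in> {1, -1} \<and> norm (b j j) \<le> norm ((\<Sum>i<j. sg i * b j i) + sg j * b j j)"
proof -
  define P where "P sg j r \<longleftrightarrow> r \<in> {1, -1} \<and> norm (b j j) \<le> norm ((\<Sum>i<j. sg i * b j i) + r * b j j)"
    for sg j and r :: complex
  have "\<exists>sg. \<forall>j. P sg j (sg j)"
  proof (rule dependent_wf_choice[OF wf_less])
    fix f g :: "nat \<Rightarrow> complex" and x r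
    assume eq: "\<And>z. (z, x) \<in> {(x, y). x < y} \<Longrightarrow> f z = g z"
    have "(\<Sum>i<x. f i * b x i) = (\<Sum>i<x. g i * b x i)" using eq by (intro sum.cong) auto
    thus "P f x r = P g x r" by (simp add: P_def)
  next
    fix j and sg :: "nat \<Rightarrow> complex"
    define s where "s = (\<Sum>i<j. sg i * b j i)"
    have "2 * norm (b j j) = norm ((s + b j j) - (s - b j j))" by (simp add: norm_mult)
    also have "... \<le> norm (s + b j j) + norm (s - b j j)" by (rule norm_triangle_ineq4)
    finally have "norm (b j j) \<le> norm (s + b j j) \<or> norm (b j j) \<le> norm (s - b j j)" by linarith
    thus "\<exists>r. P sg j r" unfolding P_def s_def[symmetric] by force
  qed
  thus ?thesis unfolding P_def .
qed

text \<open>Gliding hump: each \<open>F j\<close> is chosen nearly extremal for the functional \<open>l (z j)\<close>, so the tail of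
  the signed series cannot cancel its \<open>j\<close>-th term, and the signs keep the earlier terms from doing so.\<close>
lemma uniform_boundedness_signs:
  fixes l :: "'z \<Rightarrow> 'f \<Rightarrow> complex"
  assumes bdd: "\<And>z. z \<in> Z \<Longrightarrow> \<exists>K. \<forall>F\<in>\<F>. norm (l z F) \<le> K"
    and sums: "\<And>F sg. (\<And>j. F j \<in> \<F>) \<Longrightarrow> (\<And>j::nat. sg j \<in> {1, -1}) \<Longrightarrow>
      \<exists>C. \<forall>z\<in>Z. norm (\<Sum>j. sg j * (1/4) ^ j * l z (F j)) \<le> C"
  shows "\<exists>M. \<forall>z\<in>Z. \<forall>F\<in>\<F>. norm (l z F) \<le> M"
proof (rule ccontr)
  assume "\<not> ?thesis"
  \<comment> \<open>The growth 8^j outweighs the coefficients (1/4)^j and leaves 2^j, which no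
    constant bounds.\<close>
  hence "\<forall>j::nat. \<exists>z G. z \<in> Z \<and> G \<in> \<F> \<and> norm (l z G) > 8 ^ j" by (meson linorder_not_less)
  then obtain z G where zG: "\<And>j. z j \<in> Z" "\<And>j. G j \<in> \<F>" "\<And>j::nat. norm (l (z j) (G j)) > 8 ^ j"
    by metis
  \<comment> \<open>The supremum need not be attained. The factor 3/2 is small enough: the tail
    after index \<open>j\<close> is at most (1/4)^(j+1) * (4/3) * (3/2) = (1/4)^j / 2 times the
    extremal value, half of the \<open>j\<close>-th term.\<close>
  have "\<exists>F\<in>\<F>. \<forall>F'\<in>\<F>. norm (l (z j) F') \<le> 3 / 2 * norm (l (z j) F)" for j
  proof -
    define S where "S = Sup ((\<lambda>F. norm (l (z j) F)) ` \<F>)"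
    have bd: "bdd_above ((\<lambda>F. norm (l (z j) F)) ` \<F>)"
      using bdd[OF zG(1)[of j]] by (auto simp: bdd_above_def)
    have up: "norm (l (z j) F) \<le> S" if "F \<in> \<F>" for F
      unfolding S_def using that bd by (intro cSup_upper) auto
    have "S > 0" using up[OF zG(2)[of j]] zG(3)[of j] by (smt (verit) zero_less_power)
    hence "2 / 3 * S < S" by simp
    then obtain F where "F \<in> \<F>" "2 / 3 * S < norm (l (z j) F)"
      unfolding S_def using less_cSupD[of "(\<lambda>F. norm (l (z j) F)) ` \<F>"] zG(2)[of j] by fastforce
    thus ?thesis by (intro bexI[of _ F] ballI) (use up in fastforce)+
  qed
  hence "\<forall>j. \<exists>F. F \<in> \<F> \<and> (\<forall>F'\<in>\<F>. norm (l (z j) F') \<le> 3 / 2 * norm (l (z j) F))" by blast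
  from choice[OF this] obtain F where F': "\<forall>j. F j \<in> \<F> \<and> (\<forall>F'\<in>\<F>. norm (l (z j) F') \<le> 3 / 2 * norm (l (z j) (F j)))" ..
  have F: "F j \<in> \<F>" "G \<in> \<F> \<Longrightarrow> norm (l (z j) G) \<le> 3 / 2 * norm (l (z j) (F j))" for j G
    using F' by auto
  \<comment> \<open>Row \<open>j\<close> lists all terms at the point \<open>z j\<close>, so each
    new sign is adapted to its own point.\<close>
  from exists_signs[of "\<lambda>j i. (1/4) ^ i * l (z j) (F i)"]
  obtain sg where sg': "\<forall>j. sg j \<in> {1, -1} \<and>
      norm ((1/4) ^ j * l (z j) (F j)) \<le> norm ((\<Sum>i<j. sg i * ((1/4) ^ i * l (z j) (F i))) + sg j * ((1/4) ^ j * l (z j) (F j)))" ..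
  have sg: "sg j \<in> {1, -1}"
     "norm ((1/4) ^ j * l (z j) (F j)) \<le> norm ((\<Sum>i<j. sg i * ((1/4) ^ i * l (z j) (F i))) + sg j * ((1/4) ^ j * l (z j) (F j)))" for j
    using sg' by blast+
  have nsg: "norm (sg j) = 1" for j using sg(1)[of j] by auto
  obtain C where C: "\<And>w. w \<in> Z \<Longrightarrow> norm (\<Sum>j. sg j * (1/4) ^ j * l w (F j)) \<le> C"
    using sums[of F sg, OF F(1) sg(1)] by blast
  have "2 ^ j \<le> 3 * C" for j
  proof -
    define c where "c = norm (l (z j) (F j))"
    define t where "t i = sg i * (1/4) ^ i * l (z j) (F i)" for i
    have tb: "norm (t i) \<le> (1/4) ^ i * (3 / 2 * c)" for i
      using F(2)[OF F(1), of j i] by (simp add: t_def norm_mult nsg norm_power norm_divide c_def)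
    have s4: "summable (\<lambda>i. (1/4::real) ^ i * (3 / 2 * c))"
      by (intro summable_mult2 summable_geometric) auto
    have st: "summable (\<lambda>i. norm (t i))"
      using tb by (intro summable_comparison_test'[OF s4, of 0]) auto
    have "suminf t = (\<Sum>i. t (i + Suc j)) + (\<Sum>i<Suc j. t i)"
      using summable_norm_cancel[OF st] by (rule suminf_split_initial_segment)
    hence "norm (\<Sum>i<Suc j. t i) \<le> norm (suminf t) + norm (\<Sum>i. t (i + Suc j))"
      by (metis add_diff_cancel_left' norm_triangle_ineq4)
    also have "norm (\<Sum>i. t (i + Suc j)) \<le> (\<Sum>i. norm (t (i + Suc j)))"
      using st by (intro summable_norm) (subst summable_iff_shift)
    also have "... \<le> (\<Sum>i. (1/4) ^ i * ((1/4) ^ Suc j * (3 / 2 * c)))"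
    proof (intro suminf_le)
      show "norm (t (i + Suc j)) \<le> (1/4) ^ i * ((1/4) ^ Suc j * (3 / 2 * c))" for i
        using tb[of "i + Suc j"] by (simp add: power_add mult_ac)
      show "summable (\<lambda>i. norm (t (i + Suc j)))" using st by (subst summable_iff_shift)
    qed (intro summable_mult2 summable_geometric, auto)
    also have "... = (1/4) ^ j * c / 2"
      by (subst suminf_mult2[symmetric]) (auto simp: suminf_geometric)
    also have "norm (suminf t) \<le> C" unfolding t_def by (intro C zG)
    finally have 1: "norm (\<Sum>i<Suc j. t i) \<le> C + (1/4) ^ j * c / 2" by simp
    have "(1/4) ^ j * c \<le> norm (\<Sum>i<Suc j. t i)"
      using sg(2)[of j] by (simp add: t_def c_def norm_mult norm_power norm_divide mult.assoc)
    with 1 have 2: "(1/4) ^ j * c \<le> 2 * C" by simp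
    have "8 ^ j \<le> 3 / 2 * c" using F(2)[OF zG(2), of j j] zG(3)[of j] by (simp add: c_def)
    hence "(1/4) ^ j * 8 ^ j \<le> (1/4) ^ j * (3 / 2 * c)" by (intro mult_left_mono) auto
    moreover have "(1/4::real) ^ j * 8 ^ j = 2 ^ j" by (simp flip: power_mult_distrib)
    ultimately show ?thesis using 2 by simp
  qed
  moreover obtain j :: nat where "3 * C < 2 ^ j" using real_arch_pow[of 2 "3 * C"] by auto
  ultimately show False by (meson linorder_not_less)
qed

text \<open>A substitute for Jensen's inequality that also covers exponents below 1: bound \<open>y k\<close> by
  its supremum, and the \<open>p\<close>-th power of the supremum by the sum.\<close>
lemma powr_suminf_le:
  fixes w y :: "nat \<Rightarrow> real"
  assumes w: "\<And>k. 0 \<le> w k" "summable w" "suminf w \<le> W" "W > 0" and y: "\<And>k. 0 \<le> y k"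
    and s: "summable (\<lambda>k. w k * y k)" and p: "p > 0"
  shows "ennreal ((\<Sum>k. w k * y k) powr p) \<le> ennreal (W powr p) * (\<Sum>k. ennreal (y k powr p))"
proof (cases "(\<Sum>k. ennreal (y k powr p)) = top")
  case True
  thus ?thesis using w by (simp add: ennreal_mult_top)
next
  case False
  define S where "S = enn2real (\<Sum>k. ennreal (y k powr p))"
  have S: "S \<ge> 0" "(\<Sum>k. ennreal (y k powr p)) = ennreal S"
    using False by (simp_all add: S_def less_top)
  have yS: "y k \<le> S powr (1 / p)" for k
  proof -
    have "(\<Sum>i\<in>{k}. ennreal (y i powr p)) \<le> (\<Sum>k. ennreal (y k powr p))"
      by (intro sum_le_suminf) auto
    hence "y k powr p \<le> S" using S by simp
    hence "(y k powr p) powr (1 / p) \<le> S powr (1 / p)" using p by (intro powr_mono2) auto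
    thus ?thesis using p y[of k] by (simp add: powr_powr)
  qed
  have "(\<Sum>k. w k * y k) \<le> (\<Sum>k. w k * S powr (1 / p))"
    using w yS s by (intro suminf_le mult_left_mono summable_mult2) auto
  also have "... = suminf w * S powr (1 / p)" using w by (simp add: suminf_mult2[symmetric])
  also have "... \<le> W * S powr (1 / p)" using w by (intro mult_right_mono) auto
  finally have "(\<Sum>k. w k * y k) powr p \<le> (W * S powr (1 / p)) powr p"
    using w y s p by (intro powr_mono2 suminf_nonneg) auto
  also have "... = W powr p * S" using w S p by (simp add: powr_mult powr_powr)
  finally show ?thesis using S by (simp add: ennreal_mult'[symmetric] ennreal_leI)
qed

text \<open>Weierstrass's theorem with termwise differentiation. The majorant may depend on the
  radius \<open>\<rho>\<close>, since the kernels below are not uniformly bounded on the whole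
  disc.\<close>

lemma holomorphic_series_disc:
  fixes F :: "nat \<Rightarrow> complex \<Rightarrow> complex"
  assumes hol: "\<And>n. F n holomorphic_on udisc"
    and bd: "\<And>\<rho>. 0 \<le> \<rho> \<Longrightarrow> \<rho> < 1 \<Longrightarrow> \<exists>h. summable h \<and> (\<forall>n z. norm z \<le> \<rho> \<longrightarrow> norm (F n z) \<le> h n)"
  shows "(\<lambda>z. \<Sum>n. F n z) holomorphic_on udisc"
    and "z \<in> udisc \<Longrightarrow> (\<lambda>n. F n z) sums (\<Sum>n. F n z)"
    and "z \<in> udisc \<Longrightarrow> (\<lambda>n. deriv (F n) z) sums deriv (\<lambda>z. \<Sum>n. F n z) z"
proof -
  have "\<exists>g g'. \<forall>x\<in>udisc. ((\<lambda>n. F n x) sums g x) \<and> ((\<lambda>n. deriv (F n) x) sums g' x) \<and>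
       (g has_field_derivative g' x) (at x)"
  proof (rule series_and_derivative_comparison_complex[of udisc F "\<lambda>n. deriv (F n)"])
    show "\<And>n x. x \<in> udisc \<Longrightarrow> (F n has_field_derivative deriv (F n) x) (at x)"
      using hol by (intro holomorphic_derivI[of _ udisc]) auto
    fix x :: complex assume x: "x \<in> udisc"
    \<comment> \<open>Halfway between \<open>norm x\<close> and 1: a ball about \<open>x\<close>
      still lies in the disc of radius \<open>\<rho>\<close>, where a majorant is available.\<close>
    define \<rho> where "\<rho> = (1 + norm x) / 2"
    have \<rho>: "0 \<le> \<rho>" "\<rho> < 1" "norm x < \<rho>" using x by (auto simp: \<rho>_def)
    from bd[OF \<rho>(1,2)] obtain h where h: "summable h" "\<And>n z. norm z \<le> \<rho> \<Longrightarrow> norm (F n z) \<le> h n" by auto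
    have hpos: "h n \<ge> 0" for n using h(2)[of 0 n] \<rho> by (smt (verit) norm_ge_zero norm_zero)
    show "\<exists>d (h :: nat \<Rightarrow> complex). 0 < d \<and> summable h \<and> range h \<subseteq> \<real>\<^sub>\<ge>\<^sub>0 \<and>
         (\<forall>\<^sub>F n in sequentially. \<forall>y\<in>ball x d \<inter> udisc. norm (F n y) \<le> norm (h n))"
    proof (intro exI conjI)
      show "0 < \<rho> - norm x" using \<rho> by simp
      show "summable (\<lambda>n. complex_of_real (h n))" using h by (intro summable_of_real)
      show "range (\<lambda>n. complex_of_real (h n)) \<subseteq> \<real>\<^sub>\<ge>\<^sub>0" using hpos by auto
      have "norm y \<le> \<rho>" if "y \<in> ball x (\<rho> - norm x)" for y
        using that norm_triangle_ineq2[of y x] by (auto simp: dist_norm norm_minus_commute)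
      thus "\<forall>\<^sub>F n in sequentially. \<forall>y\<in>ball x (\<rho> - norm x) \<inter> udisc. norm (F n y) \<le> norm (complex_of_real (h n))"
        using h hpos by (intro always_eventually) auto
    qed
  qed auto
  then obtain g g' where g: "\<forall>x\<in>udisc. ((\<lambda>n. F n x) sums g x) \<and> ((\<lambda>n. deriv (F n) x) sums g' x) \<and>
       (g has_field_derivative g' x) (at x)" by blast
  have eq: "(\<Sum>n. F n z) = g z" if "z \<in> udisc" for z using g that by (auto dest: sums_unique[symmetric])
  have der: "((\<lambda>z. \<Sum>n. F n z) has_field_derivative g' z) (at z)" if "z \<in> udisc" for z
    using g that eq by (subst DERIV_cong_ev[OF refl _ refl, of _ g])
      (auto intro!: eventually_nhds_in_open[THEN eventually_mono, of udisc])
  show "(\<lambda>z. \<Sum>n. F n z) holomorphic_on udisc"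
    unfolding holomorphic_on_open[OF open_ball] using der by blast
  show "(\<lambda>n. F n z) sums (\<Sum>n. F n z)" if "z \<in> udisc" using g that eq by auto
  show "(\<lambda>n. deriv (F n) z) sums deriv (\<lambda>z. \<Sum>n. F n z) z" if "z \<in> udisc"
    using g that DERIV_imp_deriv[OF der[OF that]] by auto
qed

text \<open>In polar coordinates the density becomes a multiple of \<open>r powr (-1/2)\<close>,
  integrable at 0. The exponent -3/2 is the one that the estimate in
  \<open>kernel_family_nn_integral\<close> produces.\<close>

lemma nn_integral_norm_powr_disc:
  "disc_int (\<lambda>z. norm (z::complex) powr (-3/2)) \<le> ennreal (4 * pi)" (is "?I \<le> _")
proof -
  have "?I
     = (\<integral>\<^sup>+r\<in>{0<..<1}. ennreal (2 * pi * r) * ennreal (r powr (-3/2)) \<partial>lborel)"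
    by (intro nn_integral_radial[of "\<lambda>r. ennreal (r powr (-3/2))"]) measurable
  also have "... = (\<integral>\<^sup>+r\<in>{0<..<1}. ennreal (2 * pi * r powr (-1/2)) \<partial>lborel)"
  proof (intro nn_integral_cong)
    fix r :: real
    have "r * r powr (-3/2) = r powr (-1/2)" if "r > 0"
      using that powr_add[of r 1 "-3/2"] by simp
    thus "ennreal (2 * pi * r) * ennreal (r powr (-3/2)) * indicator {0<..<1} r = ennreal (2 * pi * r powr (-1/2)) * indicator {0<..<1} r"
      by (auto simp: indicator_def ennreal_mult'[symmetric] mult.assoc)
  qed
  also have "... \<le> ennreal (4 * pi)"
  proof (rule nn_integral_Ioo_le[where F = "\<lambda>r. 4 * pi * sqrt r"])
    fix x :: real assume x: "0 < x" "x < 1"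
    show "((\<lambda>r. 4 * pi * sqrt r) has_real_derivative 2 * pi * x powr (-1/2)) (at x)"
      using x by (auto intro!: derivative_eq_intros simp: powr_minus powr_half_sqrt field_simps)
  next
    fix x y :: real assume x: "0 < x" "x \<le> y" "y < 1"
    hence "sqrt y - sqrt x \<le> 1 - 0" by (intro diff_mono) auto
    hence "4 * pi * (sqrt y - sqrt x) \<le> 4 * pi * 1" by (intro mult_left_mono) auto
    thus "4 * pi * sqrt y - 4 * pi * sqrt x \<le> 4 * pi" by (simp add: algebra_simps)
  qed auto
  finally show ?thesis .
qed

lemma norm_one_minus_cnj_mult_ge:
  assumes "a \<in> udisc" "z \<in> udisc"
  shows "1 - norm z \<le> norm (1 - cnj a * z)" "1 - norm z > 0" "1 - cnj a * z \<noteq> 0"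
proof -
  have "norm (cnj a * z) \<le> norm z" using assms by (simp add: norm_mult mult_left_le_one_le)
  thus "1 - norm z \<le> norm (1 - cnj a * z)"
    using norm_triangle_ineq2[of 1 "cnj a * z"] by simp
  thus "1 - norm z > 0" "1 - cnj a * z \<noteq> 0" using assms by auto
qed

text \<open>The bound must not depend on \<open>a\<close>. For \<open>norm a \<le> 1/2\<close> the
  base is at least 1/2. Otherwise it equals \<open>norm a * norm (z - b)\<close> with the pole
  \<open>b = 1 / cnj a\<close>; points at distance at least 1 from \<open>b\<close> contribute a
  bounded amount, and translating \<open>b\<close> to 0 reduces the others to
  \<open>nn_integral_norm_powr_disc\<close>. The 3 bounds \<open>2 powr (3/2)\<close>, and 15 is 3 *
  (1 + 4).\<close>

lemma nn_integral_kernel_le: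
  assumes a: "a \<in> udisc"
  shows "disc_int (\<lambda>z. norm (1 - cnj a * z) powr (-3/2)) \<le> ennreal (15 * pi)" (is "?I \<le> _")
proof -
  have c8: "2 powr (3/2) \<le> (3::real)"
  proof -
    have "(2::real) powr (3/2) = sqrt 8"
      using powr_powr[of "2::real" 3 "1/2"] by (simp add: powr_half_sqrt)
    also have "... \<le> sqrt 9" by (intro real_sqrt_le_mono) auto
    finally show ?thesis by simp
  qed
  define k where "k w = ennreal (norm (w::complex) powr (-3/2)) * indicator udisc w" for w
  have [measurable]: "k \<in> borel_measurable borel" unfolding k_def by measurable
  have pt: "\<exists>b. \<forall>z\<in>udisc. ennreal (norm (1 - cnj a * z) powr (-3/2)) \<le> 3 * (1 + k (-b + z))"
  proof (cases "norm a \<le> 1 / 2")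
    case True
    have "ennreal (norm (1 - cnj a * z) powr (-3/2)) \<le> 3 * (1 + k (- 0 + z))" if z: "z \<in> udisc" for z
    proof -
      have "norm (cnj a * z) \<le> 1/2 * 1" unfolding norm_mult using True z by (intro mult_mono) auto
      hence "norm (1 - cnj a * z) \<ge> 1 / 2" using norm_triangle_ineq2[of 1 "cnj a * z"] by simp
      hence "norm (1 - cnj a * z) powr (-3/2) \<le> (1/2) powr (-3/2)" by (intro powr_mono2') auto
      also have "... = 2 powr (3/2)" by (simp add: powr_minus powr_divide)
      finally have "norm (1 - cnj a * z) powr (-3/2) \<le> 3" using c8 by simp
      hence "ennreal (norm (1 - cnj a * z) powr (-3/2)) \<le> 3"
        using ennreal_leI by fastforce
      also have "3 \<le> 3 * (1 + k (- 0 + z))"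
        by (simp add: distrib_left)
      finally show ?thesis .
    qed
    thus ?thesis by blast
  next
    case False
    define b where "b = 1 / cnj a"
    have a0: "a \<noteq> 0" using False by auto
    have "ennreal (norm (1 - cnj a * z) powr (-3/2)) \<le> 3 * (1 + k (- b + z))" if z: "z \<in> udisc" for z
    proof -
      have "1 - cnj a * z = - cnj a * (z - b)" using a0 by (simp add: b_def field_simps)
      hence n: "norm (1 - cnj a * z) = norm a * norm (z - b)" by (simp add: norm_mult)
      have zb: "z \<noteq> b" using norm_one_minus_cnj_mult_ge(3)[OF a z] a0 by (auto simp: b_def)
      have "norm (1 - cnj a * z) powr (-3/2) \<le> (1 / 2 * norm (z - b)) powr (-3/2)"
        unfolding n using False zb by (intro powr_mono2' mult_right_mono) auto
      also have "... = 2 powr (3/2) * norm (z - b) powr (-3/2)" by (simp add: powr_mult powr_minus_divide powr_divide)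
      also have "... \<le> 3 * norm (z - b) powr (-3/2)" using c8 by (intro mult_right_mono) auto
      finally have le: "norm (1 - cnj a * z) powr (-3/2) \<le> 3 * norm (z - b) powr (-3/2)" .
      have "ennreal (norm (1 - cnj a * z) powr (-3/2)) \<le> 3 * ennreal (norm (z - b) powr (-3/2))"
        using ennreal_leI[OF le] by (simp add: ennreal_mult')
      also have "ennreal (norm (z - b) powr (-3/2)) \<le> 1 + k (- b + z)"
      proof (cases "norm (z - b) < 1")
        case True
        thus ?thesis by (simp add: k_def indicator_def)
      next
        case False
        hence "norm (z - b) powr (-3/2) \<le> 1 powr (-3/2)" by (intro powr_mono2') auto
        hence "ennreal (norm (z - b) powr (-3/2)) \<le> 1" using ennreal_leI by fastforce
        also have "... \<le> 1 + k (- b + z)" by simp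
        finally show ?thesis .
      qed
      finally show ?thesis by (simp add: mult_left_mono)
    qed
    thus ?thesis by blast
  qed
  then obtain b where b: "\<And>z. z \<in> udisc \<Longrightarrow> ennreal (norm (1 - cnj a * z) powr (-3/2)) \<le> 3 * (1 + k (-b + z))"
    by blast
  have "?I
    \<le> (\<integral>\<^sup>+z. 3 * (indicator udisc z + k (-b + z)) \<partial>lborel)"
    using b by (intro nn_integral_mono) (auto simp: indicator_def)
  also have "... = 3 * (emeasure lborel udisc + (\<integral>\<^sup>+z. k (-b + z) \<partial>lborel))"
    by (subst nn_integral_cmult, measurable, subst nn_integral_add) auto
  also have "(\<integral>\<^sup>+z. k (-b + z) \<partial>lborel) = (\<integral>\<^sup>+z. k z \<partial>lborel)"
    by (intro nn_integral_lborel_translate) auto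
  also have "... \<le> ennreal (4 * pi)" unfolding k_def by (rule nn_integral_norm_powr_disc)
  also have "emeasure lborel udisc = ennreal pi" by (simp add: emeasure_disc_complex)
  also have "3 * (ennreal pi + ennreal (4 * pi)) = ennreal (15 * pi)"
    by (simp add: ennreal_plus[symmetric] ennreal_mult'[symmetric] ennreal_numeral[symmetric] del: ennreal_plus ennreal_numeral)
  finally show ?thesis by (simp add: add_mono mult_left_mono)
qed

section \<open>Testing multipliers on kernel functions\<close>

text \<open>Split at the value of \<open>x\<close> where the left side equals the quadratic term:
  above it the quadratic term wins, below it a pure power of \<open>s\<close> remains, with exponent
  above -1 for every \<open>p > 0\<close>. With \<open>s\<close> in place of
  \<open>s powr (1/2)\<close> the same split would leave \<open>s powr (-1)\<close>, which for
  \<open>s = 1 - norm z\<close> is not integrable over the disc.\<close>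

lemma powr_young:
  fixes s x p :: real
  assumes s: "0 < s" and x: "0 \<le> x" and p: "0 < p" "p < 2"
  shows "s powr (p - 1) * x powr p \<le> s powr (1/2) * x powr 2 + s powr ((3/2 * p - 2) / (2 - p))"
proof (cases "x = 0")
  case False
  hence x: "x > 0" using x by simp
  \<comment> \<open>Solves \<open>s powr (p - 1) * x powr p = s powr (1/2) * x powr 2\<close> for
    \<open>x\<close>.\<close>
  define \<tau> where "\<tau> = s powr ((p - 3/2) / (2 - p))"
  show ?thesis
  proof (cases "\<tau> \<le> x")
    case True
    hence "\<tau> powr (2 - p) \<le> x powr (2 - p)" using p by (intro powr_mono2) (auto simp: \<tau>_def)
    hence le: "s powr (p - 3/2) \<le> x powr (2 - p)" using p by (simp add: \<tau>_def powr_powr)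
    have "s powr (p - 1) = s powr (1/2) * s powr (p - 3/2)" by (simp flip: powr_add)
    hence "s powr (p - 1) * x powr p = s powr (1/2) * (s powr (p - 3/2) * x powr p)" by simp
    also have "... \<le> s powr (1/2) * (x powr (2 - p) * x powr p)"
      using le by (intro mult_left_mono mult_right_mono) auto
    also have "x powr (2 - p) * x powr p = x powr 2" by (simp flip: powr_add)
    finally show ?thesis by (smt (verit) powr_ge_zero)
  next
    case False
    hence "x powr p \<le> \<tau> powr p" using p x by (intro powr_mono2) auto
    also have "\<tau> powr p = s powr ((p - 3/2) / (2 - p) * p)" by (simp add: \<tau>_def powr_powr)
    finally have "s powr (p - 1) * x powr p \<le> s powr (p - 1) * s powr ((p - 3/2) / (2 - p) * p)"
      by (intro mult_left_mono) auto
    also have "... = s powr (p - 1 + (p - 3/2) / (2 - p) * p)" by (simp flip: powr_add)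
    also have "p - 1 + (p - 3/2) / (2 - p) * p = (3/2 * p - 2) / (2 - p)"
      using p by (simp add: field_simps)
    finally show ?thesis by (smt (verit) powr_ge_zero zero_le_mult_iff)
  qed
qed (use p in simp)

text \<open>The exponent 1/2 lies strictly between 0 and the 1 of \<open>Dspace 2\<close>: small
  enough to control all \<open>p < 2\<close> through \<open>powr_young\<close>, large enough for the
  kernels, as 1/2 - 2 > -2.\<close>

abbreviation hnorm :: "complex \<Rightarrow> complex \<Rightarrow> real" where
  "hnorm z x \<equiv> (1 - norm z) powr (1/2) * norm x powr 2"

lemma Dspace_of_hnorm:
  assumes f: "f \<in> Bloch" and int: "set_integrable lborel udisc (\<lambda>z. hnorm z (deriv f z))"
    and p: "p > 0"
  shows "f \<in> Dspace p"
proof -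
  have hol: "f holomorphic_on udisc" using f by (rule Bloch_holomorphic)
  have "f \<in> Dspace 2"
  proof (rule Dspace_dominated[OF hol _ int])
    fix z :: complex assume z: "z \<in> udisc"
    have "(1 - norm z) powr (2 - 1) \<le> (1 - norm z) powr (1/2)" using z by (intro powr_mono') auto
    thus "wnorm 2 z (deriv f z) \<le> hnorm z (deriv f z)"
      by (intro mult_right_mono) auto
  qed simp
  show ?thesis
  proof (cases "p < 2")
    case False
    thus ?thesis using Dspace_mono[OF \<open>f \<in> Dspace 2\<close> f, of p] by simp
  next
    case True
    have e: "(3/2 * p - 2) / (2 - p) > -1" using True p by (simp add: field_simps)
    show ?thesis
    proof (rule Dspace_dominated[OF hol p])
      show "set_integrable lborel udisc (\<lambda>z. hnorm z (deriv f z) + (1 - norm z) powr ((3/2 * p - 2) / (2 - p)))"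
        using int set_integrable_disc_powr[OF e] by (rule set_integral_add)
    qed (use powr_young p True in \<open>auto\<close>)
  qed
qed

text \<open>The family contains \<open>1\<close>, \<open>(1 - \<bar>a\<bar>^2) / (1 - cnj a * z)\<close> and \<open>1 - Ln (1 - cnj a * z)\<close>, and
  its members belong to all the spaces \<open>Dspace p\<close> at once.\<close>
definition kernel_family :: "(complex \<Rightarrow> complex) set" where
  "kernel_family = {F. F holomorphic_on udisc \<and> norm (F 0) \<le> 2 \<and>
     (\<exists>a\<in>udisc. \<forall>z\<in>udisc. norm (deriv F z) \<le> 2 / norm (1 - cnj a * z))}"

lemma kernel_family_deriv_le:
  assumes "F \<in> kernel_family" "z \<in> udisc"
  shows "norm (deriv F z) \<le> 2 / (1 - norm z)"
proof -
  from assms obtain a where a: "a \<in> udisc" "norm (deriv F z) \<le> 2 / norm (1 - cnj a * z)"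
    by (auto simp: kernel_family_def)
  have "2 / norm (1 - cnj a * z) \<le> 2 / (1 - norm z)"
    using norm_one_minus_cnj_mult_ge[OF a(1) assms(2)] by (intro divide_left_mono mult_pos_pos) auto
  thus ?thesis using a by simp
qed

lemma kernel_family_norm_le:
  assumes F: "F \<in> kernel_family" and z: "norm z \<le> r" "r < 1"
  shows "norm (F z) \<le> 2 - 2 * ln (1 - r)"
proof -
  have zd: "z \<in> udisc" using z by auto
  have "norm (F z - F 0) \<le> 2 * (- ln (1 - norm z))"
  proof (rule norm_increment_le)
    fix w :: complex assume w: "w \<in> udisc"
    show "(1 - norm w) * norm (deriv F w) \<le> 2"
      using kernel_family_deriv_le[OF F w] w by (simp add: field_simps)
  qed (use F zd in \<open>auto simp: kernel_family_def\<close>)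
  also have "... \<le> 2 * (- ln (1 - r))" using z by auto
  finally have "norm (F z - F 0) \<le> 2 * (- ln (1 - r))" .
  moreover have "norm (F 0) \<le> 2" using F by (simp add: kernel_family_def)
  ultimately show ?thesis using norm_triangle_ineq[of "F 0" "F z - F 0"] by simp
qed

text \<open>Estimating the weight by \<open>1 - norm z \<le> norm (1 - cnj a * z)\<close> leaves the
  exponent 1/2 - 2 = -3/2, whose integral is bounded independently of \<open>a\<close>.\<close>

lemma kernel_family_nn_integral:
  assumes F: "F \<in> kernel_family"
  shows "disc_int (\<lambda>z. hnorm z (deriv F z)) \<le> ennreal (60 * pi)"
proof -
  from F obtain a where a: "a \<in> udisc" "\<And>z. z \<in> udisc \<Longrightarrow> norm (deriv F z) \<le> 2 / norm (1 - cnj a * z)"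
    by (auto simp: kernel_family_def)
  have pt: "hnorm z (deriv F z) \<le> 4 * norm (1 - cnj a * z) powr (-3/2)"
    if z: "z \<in> udisc" for z
  proof -
    note n = norm_one_minus_cnj_mult_ge[OF a(1) z]
    have "hnorm z (deriv F z)
      \<le> norm (1 - cnj a * z) powr (1/2) * (2 / norm (1 - cnj a * z)) powr 2"
      using n a(2)[OF z] by (intro mult_mono powr_mono2) auto
    also have "(2 / norm (1 - cnj a * z)) powr 2 = 4 * norm (1 - cnj a * z) powr (-2)"
      using n by (simp add: powr_divide powr_minus_divide)
    also have "norm (1 - cnj a * z) powr (1/2) * (4 * norm (1 - cnj a * z) powr (-2)) = 4 * norm (1 - cnj a * z) powr (-3/2)"
      by (simp flip: powr_add)
    finally show ?thesis .
  qed
  have "disc_int (\<lambda>z. hnorm z (deriv F z))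
    \<le> (\<integral>\<^sup>+z. 4 * (ennreal (norm (1 - cnj a * z) powr (-3/2)) * indicator udisc z) \<partial>lborel)"
  proof (rule nn_integral_mono)
    fix z :: complex
    show "ennreal (hnorm z (deriv F z)) * indicator udisc z
      \<le> 4 * (ennreal (norm (1 - cnj a * z) powr (-3/2)) * indicator udisc z)"
      using ennreal_leI[OF pt[of z]] by (auto simp: indicator_def ennreal_mult')
  qed
  also have "... = 4 * disc_int (\<lambda>z. norm (1 - cnj a * z) powr (-3/2))"
    by (intro nn_integral_cmult borel_measurable_times_ennreal borel_measurable_indicator) auto
  also have "... \<le> 4 * ennreal (15 * pi)" by (intro mult_left_mono nn_integral_kernel_le a) auto
  also have "... = ennreal (60 * pi)"
    by (simp add: ennreal_mult'[symmetric] ennreal_numeral[symmetric] del: ennreal_numeral)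
  finally show ?thesis .
qed

text \<open>Membership in every \<open>Dspace p\<close> comes from \<open>Dspace_of_hnorm\<close>:
  only the quadratic integral of the series has to be estimated, and \<open>powr_suminf_le\<close>
  reduces it to the uniformly bounded integrals of the single kernels.\<close>

lemma kernel_series:
  assumes F: "\<And>j. F j \<in> kernel_family" and sg: "\<And>j::nat. norm (sg j) = 1"
  defines "f \<equiv> \<lambda>z. \<Sum>j. sg j * (1/4) ^ j * F j z"
  shows "f \<in> Bloch" "p > 0 \<Longrightarrow> f \<in> Dspace p"
    and "z \<in> udisc \<Longrightarrow> (\<lambda>j. sg j * (1/4) ^ j * F j z) sums f z"
    and "z \<in> udisc \<Longrightarrow> (\<lambda>j. sg j * (1/4) ^ j * deriv (F j) z) sums deriv f z"
proof -
  have holF: "F j holomorphic_on udisc" for j using F[of j] by (simp add: kernel_family_def)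
  note ser = holomorphic_series_disc[of "\<lambda>j z. sg j * (1/4) ^ j * F j z", folded f_def]
  have h1: "(\<lambda>z. sg j * (1/4) ^ j * F j z) holomorphic_on udisc" for j
    by (intro holomorphic_intros holF)
  have h2: "\<exists>h. summable h \<and> (\<forall>n z. norm z \<le> r \<longrightarrow> norm (sg n * (1/4) ^ n * F n z) \<le> h n)"
    if r: "0 \<le> r" "r < 1" for r
  proof (intro exI conjI allI impI)
    show "summable (\<lambda>n. (1/4::real) ^ n * (2 - 2 * ln (1 - r)))"
      by (intro summable_mult2 summable_geometric) auto
    show "norm (sg n * (1/4) ^ n * F n z) \<le> (1/4) ^ n * (2 - 2 * ln (1 - r))" if "norm z \<le> r" for n z
      using kernel_family_norm_le[OF F that r(2), of n] by (simp add: norm_mult norm_power norm_divide sg)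
  qed
  have hol: "f holomorphic_on udisc" using h1 h2 by (rule ser(1))
  show "(\<lambda>j. sg j * (1/4) ^ j * F j z) sums f z" if "z \<in> udisc"
    using ser(2)[OF h1 h2 that] by (simp add: f_def)
  have der: "(\<lambda>j. sg j * (1/4) ^ j * deriv (F j) z) sums deriv f z" if z: "z \<in> udisc" for z
  proof -
    have "deriv (\<lambda>z. sg j * (1/4) ^ j * F j z) z = sg j * (1/4) ^ j * deriv (F j) z" for j
      using holF[of j] z by (intro deriv_cmult holomorphic_on_imp_differentiable_at[of _ udisc]) auto
    thus ?thesis using ser(3)[OF h1 h2 z] by simp
  qed
  show "(\<lambda>j. sg j * (1/4) ^ j * deriv (F j) z) sums deriv f z" if "z \<in> udisc" using der[OF that] .
  have sm: "summable (\<lambda>j. (1/4) ^ j * norm (deriv (F j) z))" if z: "z \<in> udisc" for z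
  proof (rule summable_comparison_test')
    show "summable (\<lambda>j. (1/4::real) ^ j * (2 / (1 - norm z)))"
      by (intro summable_mult2 summable_geometric) auto
    show "norm ((1/4) ^ j * norm (deriv (F j) z)) \<le> (1/4) ^ j * (2 / (1 - norm z))" if "j \<ge> 0" for j
      using mult_left_mono[OF kernel_family_deriv_le[OF F z, of j], of "(1/4) ^ j"] by simp
  qed
  have dle: "norm (deriv f z) \<le> (\<Sum>j. (1/4) ^ j * norm (deriv (F j) z))" if z: "z \<in> udisc" for z
  proof -
    have "norm (\<Sum>j. sg j * (1/4) ^ j * deriv (F j) z) \<le> (\<Sum>j. norm (sg j * (1/4) ^ j * deriv (F j) z))"
      using sm[OF z] by (intro summable_norm) (simp add: norm_mult norm_power norm_divide sg)
    thus ?thesis using sums_unique[OF der[OF z]] by (simp add: norm_mult norm_power norm_divide sg)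
  qed
  show B: "f \<in> Bloch"
  proof -
    have "bnorm z (deriv f z) \<le> 6" if z: "z \<in> udisc" for z
    proof -
      have "norm (deriv f z) \<le> (\<Sum>j. (1/4) ^ j * (2 / (1 - norm z)))"
        using kernel_family_deriv_le[OF F z] sm[OF z]
        by (intro order_trans[OF dle[OF z]] suminf_le mult_left_mono summable_mult2 summable_geometric) auto
      also have "... = 8 / 3 / (1 - norm z)"
        by (subst suminf_mult2[symmetric]) (auto simp: suminf_geometric field_simps)
      finally have "(1 - norm z) * norm (deriv f z) \<le> 8 / 3" using z by (simp add: field_simps)
      hence "(1 + norm z) * ((1 - norm z) * norm (deriv f z)) \<le> 2 * (8 / 3)"
        using z by (intro mult_mono) auto
      thus ?thesis by (simp add: algebra_simps power2_eq_square)
    qed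
    thus ?thesis using hol unfolding Bloch_def by blast
  qed
  define h where "h j z = hnorm z (deriv (F j) z)" for j z
  have ch: "continuous_on udisc (h j)" for j
    unfolding h_def by (intro continuous_on_weighted continuous_on_deriv_disc holF) auto
  have hm: "(\<lambda>z. ennreal (h j z) * indicator udisc z) \<in> borel_measurable lborel" for j
    using set_nn_integral_disc_measurable[OF ch, of j] by (simp add: h_def)
  have pt: "ennreal (hnorm z (deriv f z)) \<le> 4 * (\<Sum>j. ennreal ((1/4) ^ j) * ennreal (h j z))"
    if z: "z \<in> udisc" for z
  proof -
    \<comment> \<open>Each coefficient is split as (1/2)^j * (1/2)^j: the first factor is the weight
      in \<open>powr_suminf_le\<close>, the square of the second makes the sum of the integrals
      converge.\<close>
    have e: "(1/2) ^ j * ((1/2) ^ j * x) = (1/4) ^ j * x" for j and x :: real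
      by (simp flip: power_mult_distrib add: mult.assoc[symmetric])
    have "ennreal (norm (deriv f z) powr 2) \<le> ennreal ((\<Sum>j. (1/2) ^ j * ((1/2) ^ j * norm (deriv (F j) z))) powr 2)"
      unfolding e by (intro ennreal_leI powr_mono2 dle z) auto
    also have "... \<le> ennreal (2 powr 2) * (\<Sum>j. ennreal (((1/2) ^ j * norm (deriv (F j) z)) powr 2))"
      using sm[OF z] by (intro powr_suminf_le) (auto simp: suminf_geometric e)
    finally have "ennreal ((1 - norm z) powr (1/2)) * ennreal (norm (deriv f z) powr 2) \<le>
      ennreal ((1 - norm z) powr (1/2)) * (ennreal (2 powr 2) * (\<Sum>j. ennreal (((1/2) ^ j * norm (deriv (F j) z)) powr 2)))"
      by (intro mult_left_mono) auto
    also have "... = 4 * (\<Sum>j. ennreal ((1 - norm z) powr (1/2)) * ennreal (((1/2) ^ j * norm (deriv (F j) z)) powr 2))"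
      by (simp add: ac_simps)
    also have "(\<lambda>j. ennreal ((1 - norm z) powr (1/2)) * ennreal (((1/2) ^ j * norm (deriv (F j) z)) powr 2))
       = (\<lambda>j. ennreal ((1/4) ^ j) * ennreal (h j z))"
    proof
      fix j
      have "((1/2) ^ j * norm (deriv (F j) z)) powr 2 = (1/4) ^ j * norm (deriv (F j) z) powr 2"
        using e[of j "norm (deriv (F j) z) * norm (deriv (F j) z)"] by (simp add: power2_eq_square mult_ac)
      thus "ennreal ((1 - norm z) powr (1/2)) * ennreal (((1/2) ^ j * norm (deriv (F j) z)) powr 2) = ennreal ((1/4) ^ j) * ennreal (h j z)"
        by (simp add: h_def ennreal_mult'[symmetric] mult_ac)
    qed
    finally show ?thesis by (simp add: ennreal_mult')
  qed
  have "disc_int (\<lambda>z. hnorm z (deriv f z))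
     \<le> (\<integral>\<^sup>+z. 4 * (\<Sum>j. ennreal ((1/4) ^ j) * (ennreal (h j z) * indicator udisc z)) \<partial>lborel)"
    using pt by (intro nn_integral_mono) (auto simp: indicator_def)
  also have "... = 4 * (\<Sum>j. ennreal ((1/4) ^ j) * disc_int (h j))"
    using hm by (simp add: nn_integral_cmult nn_integral_suminf)
  also have "... \<le> 4 * (\<Sum>j. ennreal ((1/4) ^ j) * ennreal (60 * pi))"
    using kernel_family_nn_integral[OF F] by (intro mult_left_mono suminf_le) (auto simp: h_def intro!: mult_left_mono)
  also have "(\<Sum>j. ennreal ((1/4) ^ j) * ennreal (60 * pi)) = ennreal (\<Sum>j. (1/4) ^ j * (60 * pi))"
    by (subst suminf_ennreal2[symmetric]) (auto simp: ennreal_mult' intro!: summable_mult2 summable_geometric)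
  also have "4 * ... < \<infinity>" by (simp add: ennreal_mult_less_top)
  finally have "set_integrable lborel udisc (\<lambda>z. hnorm z (deriv f z))"
    using set_integrable_disc_iff[OF continuous_on_weighted[OF continuous_on_deriv_disc[OF hol], of 2 "1/2"]] by simp
  thus "f \<in> Dspace p" if "p > 0" using Dspace_of_hnorm[OF B _ that] by simp
qed

text \<open>Takes the place of the closed graph theorem. The functional \<open>l z F\<close> is
  \<open>1 - (norm z)^2\<close> times the derivative of \<open>F * g\<close> at \<open>z\<close>.
  For fixed \<open>z\<close> it is bounded on the family, and on a signed series it adds up to its
  value at the sum \<open>f\<close>, which the multiplier property controls.\<close>

lemma kernel_family_multiplier_bound:
  assumes g: "g holomorphic_on udisc"
    and mult: "\<And>f. f \<in> Bloch \<Longrightarrow> (\<And>p. p > 0 \<Longrightarrow> f \<in> Dspace p) \<Longrightarrow> (\<lambda>z. f z * g z) \<in> Bloch"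
  obtains M where "\<And>z F. z \<in> udisc \<Longrightarrow> F \<in> kernel_family \<Longrightarrow>
    bnorm z (F z * deriv g z + deriv F z * g z) \<le> M"
proof -
  define l where "l z F = of_real (1 - (norm z)^2) * (F z * deriv g z + deriv F z * g z)" for z F
  have pos: "0 \<le> 1 - (norm z)^2" "1 - (norm z)^2 \<le> 1" if "z \<in> udisc" for z :: complex
    using one_minus_sq_pos[of "norm z"] that by auto
  have nl: "norm (l z F) = bnorm z (F z * deriv g z + deriv F z * g z)" if "z \<in> udisc" for z F
    using pos[OF that] unfolding l_def norm_mult norm_of_real by simp
  have "\<exists>M. \<forall>z\<in>udisc. \<forall>F\<in>kernel_family. norm (l z F) \<le> M"
  proof (rule uniform_boundedness_signs)
    fix z :: complex assume z: "z \<in> udisc"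
    show "\<exists>K. \<forall>F\<in>kernel_family. norm (l z F) \<le> K"
    proof (intro exI ballI)
      fix F assume F: "F \<in> kernel_family"
      have "norm (l z F) \<le> 1 * norm (F z * deriv g z + deriv F z * g z)"
        unfolding nl[OF z] using pos[OF z] by (intro mult_right_mono) auto
      also have "... \<le> norm (F z) * norm (deriv g z) + norm (deriv F z) * norm (g z)"
        by (auto intro: order_trans[OF norm_triangle_ineq] simp: norm_mult)
      also have "... \<le> (2 - 2 * ln (1 - norm z)) * norm (deriv g z) + 2 / (1 - norm z) * norm (g z)"
        using kernel_family_norm_le[OF F order_refl, of z] kernel_family_deriv_le[OF F z] z
        by (intro add_mono mult_right_mono) auto
      finally show "norm (l z F) \<le> (2 - 2 * ln (1 - norm z)) * norm (deriv g z) + 2 / (1 - norm z) * norm (g z)" .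
    qed
  next
    fix F :: "nat \<Rightarrow> complex \<Rightarrow> complex" and sg :: "nat \<Rightarrow> complex"
    assume F: "\<And>j. F j \<in> kernel_family" and sg': "\<And>j. sg j \<in> {1, -1}"
    have sg: "norm (sg j) = 1" for j using sg'[of j] by auto
    define f where "f z = (\<Sum>j. sg j * (1/4) ^ j * F j z)" for z
    note ks = kernel_series[of F sg, OF F sg, folded f_def]
    have fB: "f \<in> Bloch" "\<And>p. p > 0 \<Longrightarrow> f \<in> Dspace p" using ks(1,2) unfolding f_def by blast+
    from BlochE[OF mult[OF fB]] obtain C where C:
      "\<And>z. z \<in> udisc \<Longrightarrow> bnorm z (deriv (\<lambda>z. f z * g z) z) \<le> C" by metis
    show "\<exists>C. \<forall>z\<in>udisc. norm (\<Sum>j. sg j * (1/4) ^ j * l z (F j)) \<le> C"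
    proof (intro exI ballI)
      fix z :: complex assume z: "z \<in> udisc"
      have s1: "(\<lambda>j. sg j * (1/4) ^ j * F j z) sums f z"
        and s2: "(\<lambda>j. sg j * (1/4) ^ j * deriv (F j) z) sums deriv f z"
        using ks(3,4)[OF z] unfolding f_def by blast+
      have "(\<lambda>j. of_real (1 - (norm z)^2) * ((sg j * (1/4) ^ j * F j z) * deriv g z + (sg j * (1/4) ^ j * deriv (F j) z) * g z))
          sums (of_real (1 - (norm z)^2) * (f z * deriv g z + deriv f z * g z))"
        by (intro sums_mult sums_add sums_mult2 s1 s2)
      also have "(\<lambda>j. of_real (1 - (norm z)^2) * ((sg j * (1/4) ^ j * F j z) * deriv g z + (sg j * (1/4) ^ j * deriv (F j) z) * g z))
        = (\<lambda>j. sg j * (1/4) ^ j * l z (F j))" by (auto simp: l_def algebra_simps)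
      finally have "(\<Sum>j. sg j * (1/4) ^ j * l z (F j)) = l z f"
        unfolding l_def by (rule sums_unique[symmetric])
      thus "norm (\<Sum>j. sg j * (1/4) ^ j * l z (F j)) \<le> C"
        using C[OF z] deriv_mult_disc[OF Bloch_holomorphic[OF fB(1)] g z] nl[OF z] by simp
    qed
  qed
  thus ?thesis using nl that by metis
qed

text \<open>The three kernels are used in turn. The constant 1 bounds \<open>deriv g\<close>. The
  rational kernel has \<open>F a = 1\<close> and a derivative at \<open>a\<close> of size
  \<open>norm a / (1 - (norm a)^2)\<close>, so subtracting the bound on \<open>deriv g\<close>
  isolates \<open>g a\<close>. The logarithmic kernel has \<open>F a = Llog (norm a)\<close>, and
  subtracting the bound on \<open>g\<close> isolates \<open>deriv g a\<close> times the
  logarithm.\<close>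

lemma multiplier_Bloch_log_Hinf:
  assumes g: "g holomorphic_on udisc"
    and mult: "\<And>f. f \<in> Bloch \<Longrightarrow> (\<And>p. p > 0 \<Longrightarrow> f \<in> Dspace p) \<Longrightarrow> (\<lambda>z. f z * g z) \<in> Bloch"
  shows "g \<in> Bloch_log \<inter> Hinf"
proof -
  from kernel_family_multiplier_bound[OF g mult] obtain M where M:
    "\<And>z F. z \<in> udisc \<Longrightarrow> F \<in> kernel_family \<Longrightarrow> bnorm z (F z * deriv g z + deriv F z * g z) \<le> M"
    by metis
  have pos: "1 - (norm z)^2 > 0" if "z \<in> udisc" for z :: complex
    using one_minus_sq_pos[of "norm z"] that by auto
  have ka: "1 - cnj a * a = of_real (1 - (norm a)^2)" for a
    by (simp add: complex_norm_square mult.commute del: of_real_power)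
  have F0: "(\<lambda>z. 1) \<in> kernel_family"
    by (auto simp: kernel_family_def intro!: exI[of _ 0])
  have gB: "bnorm z (deriv g z) \<le> M" if "z \<in> udisc" for z
    using M[OF that F0] by simp
  \<comment> \<open>The derivative of the kernel at \<open>a\<close> carries the factor
    \<open>cnj a\<close>; points near 0 are left to compactness below.\<close>
  have "norm (g a) \<le> 4 * M" if a: "a \<in> udisc" "norm a \<ge> 1/2" for a
  proof -
    define F where "F z = of_real (1 - (norm a)^2) / (1 - cnj a * z)" for z
    have der: "(F has_field_derivative of_real (1 - (norm a)^2) * cnj a / (1 - cnj a * z)^2) (at z)" if "z \<in> udisc" for z
      unfolding F_def using norm_one_minus_cnj_mult_ge(3)[OF a(1) that]
      by (auto intro!: derivative_eq_intros simp: power2_eq_square)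
    have F: "F \<in> kernel_family" unfolding kernel_family_def
    proof (intro CollectI conjI bexI[of _ a] ballI)
      show "F holomorphic_on udisc" unfolding F_def using norm_one_minus_cnj_mult_ge(3)[OF a(1)]
        by (intro holomorphic_intros) auto
      have "norm (F 0) = 1 - (norm a)^2"
        unfolding F_def using pos[OF a(1)] by (simp add: norm_divide del: of_real_diff of_real_power)
      thus "norm (F 0) \<le> 2" by (smt (verit) zero_le_power2)
      fix z :: complex assume z: "z \<in> udisc"
      define n where "n = norm (1 - cnj a * z)"
      have n: "n > 0" "1 - norm a \<le> n"
      proof -
        have "norm (cnj a * z) \<le> norm a" using z by (simp add: norm_mult mult_right_le_one_le)
        thus "1 - norm a \<le> n" unfolding n_def using norm_triangle_ineq2[of 1 "cnj a * z"] by simp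
        thus "n > 0" using a by auto
      qed
      have "norm (deriv F z) = (1 - (norm a)^2) * norm a / n^2"
        unfolding DERIV_imp_deriv[OF der[OF z]] n_def using pos[OF a(1)]
        by (simp add: norm_divide norm_mult norm_power del: of_real_diff of_real_power)
      \<comment> \<open>One power of \<open>n\<close> is cancelled by
        \<open>1 - (norm a)^2 \<le> 2 * n\<close>; this is why the derivative bound in
        \<open>kernel_family\<close> has a 2.\<close>
      also have "... \<le> (2 * n) * 1 / n^2"
      proof (intro divide_right_mono mult_mono)
        have "(1 + norm a) * (1 - norm a) \<le> 2 * n" using n a by (intro mult_mono) auto
        thus "1 - (norm a)^2 \<le> 2 * n" by (simp add: power2_eq_square algebra_simps)
      qed (use n a in auto)
      also have "... = 2 / n" using n by (simp add: power2_eq_square)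
      finally show "norm (deriv F z) \<le> 2 / norm (1 - cnj a * z)" by (simp add: n_def)
    qed (use a in auto)
    have p0: "(of_real (1 - (norm a)^2) :: complex) \<noteq> 0" using pos[OF a(1)] unfolding of_real_eq_0_iff by simp
    have Fa: "F a = 1" unfolding F_def ka using p0 by simp
    have dFa: "deriv F a = cnj a / of_real (1 - (norm a)^2)"
      unfolding DERIV_imp_deriv[OF der[OF a(1)]] ka using p0 by (simp add: power2_eq_square)
    define P where "P = 1 - (norm a)^2"
    have P: "P > 0" using pos[OF a(1)] by (simp add: P_def)
    have "norm a * norm (g a) = P * norm (deriv F a * g a)"
      unfolding dFa P_def[symmetric] norm_mult norm_divide norm_of_real using P by simp
    also have "... \<le> P * (norm (F a * deriv g a + deriv F a * g a) + norm (deriv g a))"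
      using P norm_triangle_ineq4[of "deriv g a + deriv F a * g a" "deriv g a"]
      by (intro mult_left_mono) (auto simp: Fa)
    also have "... \<le> M + M"
      unfolding distrib_left P_def by (intro add_mono M gB F a)
    finally have "norm a * norm (g a) \<le> 2 * M" by simp
    moreover have "1/2 * norm (g a) \<le> norm a * norm (g a)" using a by (intro mult_right_mono) auto
    ultimately show ?thesis by simp
  qed
  moreover obtain K where "\<And>z. norm z \<le> 1/2 \<Longrightarrow> norm (g z) \<le> K"
    by (rule bounded_on_half_disc[OF holomorphic_on_imp_continuous_on[OF g]]) blast
  ultimately have N: "norm (g z) \<le> max (4 * M) K" if "z \<in> udisc" for z
    using that by (cases "norm z \<ge> 1/2") (auto simp: max.coboundedI1 max.coboundedI2)
  hence H: "g \<in> Hinf" using g unfolding Hinf_def by blast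
  have "(1 - (norm a)^2) * norm (deriv g a) * Llog (norm a) \<le> M + max (4 * M) K" if a: "a \<in> udisc" for a
  proof -
    \<comment> \<open>The real part of \<open>1 - cnj a * z\<close> is positive, so the principal
      branch is holomorphic, and the summand 1 makes the value at \<open>a\<close> exactly
      \<open>Llog (norm a)\<close>.\<close>
    define F where "F z = 1 - Ln (1 - cnj a * z)" for z
    have dom: "1 - cnj a * z \<notin> \<real>\<^sub>\<le>\<^sub>0" if z: "z \<in> udisc" for z
    proof -
      have "norm (cnj a * z) < 1"
        using norm_one_minus_cnj_mult_ge(2)[OF a a] a z
        by (simp add: norm_mult) (metis mult_strict_mono' mult_1 norm_ge_zero)
      hence "Re (1 - cnj a * z) > 0" using complex_Re_le_cmod[of "cnj a * z"] by simp
      thus ?thesis by (auto simp: complex_nonpos_Reals_iff)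
    qed
    have der: "(F has_field_derivative cnj a / (1 - cnj a * z)) (at z)" if "z \<in> udisc" for z
      unfolding F_def using norm_one_minus_cnj_mult_ge(3)[OF a that] dom[OF that]
      by (auto intro!: derivative_eq_intros simp: field_simps)
    have F: "F \<in> kernel_family" unfolding kernel_family_def
    proof (intro CollectI conjI bexI[of _ a] ballI)
      show "F holomorphic_on udisc" unfolding holomorphic_on_open[OF open_ball] using der by blast
      show "norm (F 0) \<le> 2" by (simp add: F_def)
      fix z :: complex assume z: "z \<in> udisc"
      show "norm (deriv F z) \<le> 2 / norm (1 - cnj a * z)"
        unfolding DERIV_imp_deriv[OF der[OF z]] norm_divide using a by (intro divide_right_mono) auto
    qed (use a in auto)
    define P where "P = 1 - (norm a)^2"
    have P: "P > 0" using pos[OF a(1)] by (simp add: P_def)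
    have Fa: "F a = of_real (Llog (norm a))"
      unfolding F_def ka P_def[symmetric] Llog_def using P by (simp add: Ln_of_real)
    have dFa: "deriv F a = cnj a / of_real P"
      unfolding DERIV_imp_deriv[OF der[OF a(1)]] ka P_def by simp
    have L: "Llog (norm a) \<ge> 1" using a by (intro Llog_ge_1) auto
    have "P * norm (deriv g a) * Llog (norm a) = P * norm (F a * deriv g a)"
      using L unfolding Fa norm_mult norm_of_real by simp
    also have "... \<le> P * (norm (F a * deriv g a + deriv F a * g a) + norm (deriv F a * g a))"
      using P norm_triangle_ineq4[of "F a * deriv g a + deriv F a * g a" "deriv F a * g a"]
      by (intro mult_left_mono) auto
    also have "... = P * norm (F a * deriv g a + deriv F a * g a) + norm a * norm (g a)"
      unfolding dFa distrib_left norm_mult norm_divide norm_of_real using P by simp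
    also have "... \<le> M + 1 * max (4 * M) K"
      unfolding P_def using a by (intro add_mono M F mult_mono N) auto
    finally show ?thesis by (simp add: P_def)
  qed
  hence "\<forall>z\<in>udisc. bnorm z (deriv g z) * ln (exp 1 / (1 - (norm z)^2)) \<le> M + max (4 * M) K"
    using ln_exp_div_eq_Llog by simp
  hence "g \<in> Bloch_log" using g unfolding Bloch_log_def by blast
  thus ?thesis using H by simp
qed

section \<open>A Hardy inequality with logarithmic weight\<close>

lemma Llog_measurable [measurable]: "Llog \<in> borel_measurable borel"
  unfolding Llog_def by measurable

lemma has_field_derivative_Llog_powr:
  assumes "0 \<le> r" "r < 1"
  shows "((\<lambda>r. Llog r powr b) has_real_derivative b * Llog r powr (b - 1) * (2 * r / (1 - r^2))) (at r)"
  using Llog_ge_1[OF assms] by (intro DERIV_chain2[OF has_real_derivative_powr] has_field_derivative_Llog assms) auto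

text \<open>Up to the factor \<open>- 2 * b * r\<close> this is the derivative of
  \<open>Llog r powr (- b)\<close>, hence integrable up to the circle for
  \<open>b > 0\<close>.\<close>

abbreviation log_kernel :: "real \<Rightarrow> real \<Rightarrow> real" where
  "log_kernel b r \<equiv> 1 / ((1 - r^2) * Llog r powr (b + 1))"

text \<open>The function \<open>4 * s^2 / t ^ 3 * log_kernel b (s/t)\<close> is the exact derivative
  in \<open>t\<close> of \<open>2 / b * Llog (s/t) powr (- b)\<close>, which is largest at
  \<open>t = 1\<close>. The cutoff \<open>1/2 \<le> s/t\<close> means \<open>t \<le> 2 * s\<close>
  and makes the additional factor at least 1.\<close>

lemma hardy_kernel_le:
  assumes b: "b > 0" and s: "0 \<le> s" "s < 1"
  shows "(\<integral>\<^sup>+t\<in>{1/2..1}. ennreal (log_kernel b (s/t)) * indicator {1/2..<1} (s/t) \<partial>lborel)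
     \<le> ennreal (2 / b * Llog s powr (-b))" (is "?I \<le> _")
proof -
  define f where "f t = 4 * s^2 / t ^ 3 * (log_kernel b (s/t))" for t
  have [measurable]: "f \<in> borel_measurable borel" unfolding f_def by measurable
  have st: "0 \<le> s / t" "s / t < 1" if "s < t" for t using that s by auto
  have "?I
    \<le> (\<integral>\<^sup>+t\<in>{s<..<1}. ennreal (f t) \<partial>lborel)"
  proof (rule nn_integral_mono_AE)
    show "AE t in lborel. ennreal (log_kernel b (s/t)) * indicator {1/2..<1} (s/t) * indicator {1/2..1} t
       \<le> ennreal (f t) * indicator {s<..<1} t"
      using AE_lborel_singleton[of 1]
    proof eventually_elim
      case (elim t)
      show ?case
      proof (cases "1/2 \<le> t \<and> t \<le> 1 \<and> 1/2 \<le> s/t \<and> s/t < 1")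
        case True
        hence t: "t > 0" "t < 1" "s < t" "t \<le> 2 * s" using elim by (auto simp: field_simps)
        have "t ^ 3 \<le> t^2" using t by (intro power_decreasing) auto
        also have "t^2 \<le> (2 * s)^2" using t by (intro power_mono) auto
        finally have "1 \<le> 4 * s^2 / t ^ 3" using t by (simp add: field_simps)
        moreover have "0 \<le> log_kernel b (s/t)"
          using one_minus_sq_pos[OF st[OF t(3)]] by simp
        ultimately have "1 * (log_kernel b (s/t)) \<le> f t"
          unfolding f_def by (rule mult_right_mono)
        hence "ennreal (log_kernel b (s/t)) \<le> ennreal (f t)" by (intro ennreal_leI) simp
        moreover have "s / t \<in> {1/2..<1}" "t \<in> {1/2..1}" "t \<in> {s<..<1}" using True t by auto
        ultimately show ?thesis by (simp only: indicator_simps mult_1_right)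
      qed (auto simp: indicator_def)
    qed
  qed
  also have "... \<le> ennreal (2 / b * Llog s powr (-b))"
  proof (rule nn_integral_Ioo_le[where F = "\<lambda>t. 2 / b * Llog (s/t) powr (-b)"])
    fix t assume t: "s < t" "t < 1"
    have "((\<lambda>t. s / t) has_real_derivative - s / t^2) (at t)"
      using t s by (auto intro!: derivative_eq_intros simp: power2_eq_square)
    from DERIV_cmult[OF DERIV_chain2[where f = "\<lambda>r. Llog r powr (-b)", OF has_field_derivative_Llog_powr[OF st[OF t(1)]] this], of "2 / b"]
    have "((\<lambda>t. 2 / b * Llog (s/t) powr (-b)) has_real_derivative
        2 / b * (- b * Llog (s/t) powr (-b - 1) * (2 * (s/t) / (1 - (s/t)^2)) * (- s / t^2))) (at t)" .
    also have "2 / b * (- b * Llog (s/t) powr (-b - 1) * (2 * (s/t) / (1 - (s/t)^2)) * (- s / t^2)) = f t"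
    proof -
      have "Llog (s/t) powr (-b - 1) = 1 / Llog (s/t) powr (b + 1)"
        by (simp add: powr_minus_divide[symmetric])
      thus ?thesis unfolding f_def using b t s
        by (simp add: power2_eq_square power3_eq_cube)
    qed
    finally show "((\<lambda>t. 2 / b * Llog (s/t) powr (-b)) has_real_derivative f t) (at t)" .
    show "0 \<le> f t" unfolding f_def using one_minus_sq_pos[OF st[OF t(1)]] t s by simp
  next
    fix x y assume xy: "s < x" "x \<le> y" "y < 1"
    have "s \<le> s / y" using xy s by (simp add: field_simps mult_left_le)
    hence "Llog s \<le> Llog (s / y)" using xy s by (intro Llog_mono) auto
    hence "Llog (s / y) powr (-b) \<le> Llog s powr (-b)"
      using Llog_ge_1[OF s] b by (intro powr_mono2') auto
    hence "2 / b * Llog (s / y) powr (-b) \<le> 2 / b * Llog s powr (-b)"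
      using b by (intro mult_left_mono) auto
    moreover have "0 \<le> 2 / b * Llog (s / x) powr (-b)" using b by simp
    ultimately show "2 / b * Llog (s / y) powr (-b) - 2 / b * Llog (s / x) powr (-b) \<le> 2 / b * Llog s powr (-b)"
      by linarith
  qed (use s in auto)
  finally show ?thesis .
qed

text \<open>After the exchange of integrals, \<open>t\<close> varies with the endpoint
  \<open>w = t * z\<close> fixed. Only \<open>norm w / t\<close> then enters the kernel, and
  \<open>hardy_kernel_le\<close> applies.\<close>

lemma hardy_tonelli:
  fixes G :: "complex \<Rightarrow> ennreal"
  assumes b: "b > 0" and G [measurable]: "G \<in> borel_measurable borel" and G0: "\<And>w. w \<notin> udisc \<Longrightarrow> G w = 0"
  defines "K \<equiv> \<lambda>r. ennreal (log_kernel b r) * indicator {1/2..<1} r"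
  shows "(\<integral>\<^sup>+z. K (norm z) * (\<integral>\<^sup>+t\<in>{1/2..1}. G (of_real t * z) \<partial>lborel) \<partial>lborel)
    \<le> 4 * (\<integral>\<^sup>+w. G w * ennreal (2 / b * Llog (norm w) powr (-b)) \<partial>lborel)" (is "?I \<le> _")
proof -
  have [measurable]: "K \<in> borel_measurable borel" unfolding K_def by measurable
  have "?I
    = (\<integral>\<^sup>+z. (\<integral>\<^sup>+t. K (norm z) * G (of_real t * z) * indicator {1/2..1} t \<partial>lborel) \<partial>lborel)"
    by (simp add: nn_integral_cmult[symmetric] mult.assoc)
  also have "... = (\<integral>\<^sup>+t. (\<integral>\<^sup>+z. K (norm z) * G (of_real t * z) * indicator {1/2..1} t \<partial>lborel) \<partial>lborel)"
    by (rule lborel_pair.Fubini') measurable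
  also have "... \<le> (\<integral>\<^sup>+t. (\<integral>\<^sup>+w. 4 * (K (norm w / t) * G w * indicator {1/2..1} t) \<partial>lborel) \<partial>lborel)"
  proof (rule nn_integral_mono)
    fix t :: real
    show "(\<integral>\<^sup>+z. K (norm z) * G (of_real t * z) * indicator {1/2..1} t \<partial>lborel)
      \<le> (\<integral>\<^sup>+w. 4 * (K (norm w / t) * G w * indicator {1/2..1} t) \<partial>(lborel :: complex measure))"
    proof (cases "t \<in> {1/2..1}")
      case True
      hence t: "t > 0" by auto
      have "(\<integral>\<^sup>+w. K (norm w / t) * G w \<partial>lborel) = ennreal (t ^ 2) * (\<integral>\<^sup>+z. K (norm (t *\<^sub>R z) / t) * G (t *\<^sub>R z) \<partial>lborel)"
        using t by (subst nn_integral_lborel_scaleR[of _ t]) simp_all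
      also have "(\<integral>\<^sup>+z. K (norm (t *\<^sub>R z) / t) * G (t *\<^sub>R z) \<partial>lborel) = (\<integral>\<^sup>+z. K (norm z) * G (of_real t * z) \<partial>lborel)"
        using t by (simp add: scaleR_conv_of_real norm_mult)
      finally have e: "(\<integral>\<^sup>+w. K (norm w / t) * G w \<partial>lborel) = ennreal (t ^ 2) * (\<integral>\<^sup>+z. K (norm z) * G (of_real t * z) \<partial>lborel)" .
      \<comment> \<open>The Jacobian \<open>t^2\<close> of the scaling is at least 1/4, whence the
        factor 4.\<close>
      have "(1/2)^2 \<le> t^2" using True by (intro power_mono) auto
      hence "1 \<le> 4 * t^2" by (simp add: power2_eq_square)
      hence "1 \<le> 4 * ennreal (t^2)"
        using ennreal_leI[of 1 "4 * t^2"] by (simp add: ennreal_mult')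
      hence "1 * (\<integral>\<^sup>+z. K (norm z) * G (of_real t * z) \<partial>lborel) \<le> 4 * ennreal (t^2) * (\<integral>\<^sup>+z. K (norm z) * G (of_real t * z) \<partial>lborel)"
        by (intro mult_right_mono) auto
      also have "... = 4 * (\<integral>\<^sup>+w. K (norm w / t) * G w \<partial>lborel)" unfolding e by (simp add: mult.assoc)
      also have "... = (\<integral>\<^sup>+w. 4 * (K (norm w / t) * G w) \<partial>lborel)" by (subst nn_integral_cmult) measurable
      finally show ?thesis using True by simp
    qed simp
  qed
  also have "... = (\<integral>\<^sup>+w. (\<integral>\<^sup>+t. 4 * (K (norm w / t) * G w * indicator {1/2..1} t) \<partial>lborel) \<partial>lborel)"
    by (rule lborel_pair.Fubini'[symmetric]) measurable
  also have "... = (\<integral>\<^sup>+w. 4 * (G w * (\<integral>\<^sup>+t\<in>{1/2..1}. K (norm w / t) \<partial>lborel)) \<partial>lborel)"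
    by (simp add: nn_integral_cmult[symmetric] ac_simps)
  also have "... \<le> (\<integral>\<^sup>+w. 4 * (G w * ennreal (2 / b * Llog (norm w) powr (-b))) \<partial>lborel)"
  proof (rule nn_integral_mono)
    fix w :: complex
    show "4 * (G w * (\<integral>\<^sup>+t\<in>{1/2..1}. K (norm w / t) \<partial>lborel)) \<le> 4 * (G w * ennreal (2 / b * Llog (norm w) powr (-b)))"
      using G0[of w] hardy_kernel_le[OF b, of "norm w"]
      by (cases "w \<in> udisc") (auto simp: K_def intro!: mult_left_mono)
  qed
  also have "... = 4 * (\<integral>\<^sup>+w. G w * ennreal (2 / b * Llog (norm w) powr (-b)) \<partial>lborel)"
    by (subst nn_integral_cmult) measurable
  finally show ?thesis .
qed

text \<open>This is \<open>v powr (1 - q) * norm (deriv f w) powr q\<close> for the Hoelder weight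
  \<open>v = 1 / ((1 - s^2) * sqrt (Llog s))\<close> at \<open>s = norm w\<close>.\<close>

definition hardy_density :: "real \<Rightarrow> (complex \<Rightarrow> complex) \<Rightarrow> complex \<Rightarrow> real" where
  "hardy_density q f w =
    (1 - (norm w)^2) powr (q - 1) * Llog (norm w) powr ((q - 1) / 2) * norm (deriv f w) powr q"

lemma hardy_density_nonneg: "0 \<le> hardy_density q f w"
  by (simp add: hardy_density_def)

lemma continuous_on_hardy_density:
  assumes f: "f holomorphic_on udisc" and q: "q > 1"
  shows "continuous_on udisc (hardy_density q f)"
proof -
  have W: "Llog (norm w) \<noteq> 0" "1 - (norm w)^2 \<noteq> 0" "1 - (norm w)^2 > 0" if "w \<in> udisc" for w :: complex
    using Llog_ge_1[of "norm w"] one_minus_sq_pos[of "norm w"] that by auto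
  have c1: "continuous_on udisc (\<lambda>w::complex. 1 - (norm w)^2)"
    by (intro continuous_intros)
  have c2: "continuous_on udisc (\<lambda>w::complex. Llog (norm w))"
    unfolding Llog_def using W(2) by (intro continuous_intros) auto
  have c3: "continuous_on udisc (\<lambda>w. norm (deriv f w) powr q)"
    using q by (intro continuous_on_powr' continuous_on_norm continuous_on_deriv_disc f continuous_on_const) auto
  show ?thesis unfolding hardy_density_def
    using W by (intro continuous_on_mult c3 continuous_on_powr c1 c2 continuous_on_const) auto
qed

text \<open>Hoelder's inequality for \<open>f z - f (z/2)\<close> along the radius, with weight
  \<open>1 / ((1 - s^2) * sqrt (Llog s))\<close>.\<close>
lemma hardy_pointwise:
  assumes f: "f holomorphic_on udisc" and q: "q > 1" and z: "1/2 \<le> norm z" "norm z < 1"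
    and A: "A \<ge> 0" "\<And>w. norm w \<le> 1/2 \<Longrightarrow> norm (f w) \<le> A"
  defines "G \<equiv> hardy_density q f"
  defines "J \<equiv> integral {1/2..1} (\<lambda>t. G (of_real t * z))"
  shows "norm (f z) powr q \<le> (A + 9) powr q * (Llog (norm z) powr ((q - 1) / 2) * (1 + J))" "J \<ge> 0"
    "continuous_on {1/2..1} (\<lambda>t. G (of_real t * z))"
proof -
  define r where "r = norm z"
  have r: "1/2 \<le> r" "r < 1" using z by (auto simp: r_def)
  define L where "L = Llog r"
  have L: "L \<ge> 1" using r by (auto simp: L_def intro!: Llog_ge_1)
  have tr: "0 \<le> t * r" "t * r < 1" if "1/2 \<le> t" "t \<le> 1" for t
  proof -
    have "t * r \<le> 1 * r" using that r by (intro mult_right_mono) auto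
    also have "... < 1" using r by simp
    finally show "t * r < 1" .
    show "0 \<le> t * r" using that r by simp
  qed
  have tz: "of_real t * z \<in> udisc" "norm (of_real t * z) = t * r" if "1/2 \<le> t" "t \<le> 1" for t
    using tr[OF that] that by (simp_all add: norm_mult r_def)
  have contG: "continuous_on udisc G" unfolding G_def using f q by (rule continuous_on_hardy_density)
  have contGt: "continuous_on {1/2..1} (\<lambda>t. G (of_real t * z))"
    by (rule continuous_on_compose2[OF contG]) (use tz in \<open>auto intro!: continuous_intros\<close>)
  show "continuous_on {1/2..1} (\<lambda>t. G (of_real t * z))" by (rule contGt)
  have int: "(\<lambda>t. G (of_real t * z)) integrable_on {1/2..1}"
    using contGt by (rule integrable_continuous_real)
  show J0: "J \<ge> 0" unfolding J_def using int by (intro integral_nonneg) (auto simp: G_def hardy_density_nonneg)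
  \<comment> \<open>Hoelder's inequality is used in the additive form
    \<open>x / w \<le> l + l powr (1 - q) * (x / w) powr q\<close>, integrated against
    \<open>w\<close>. This \<open>l\<close> makes the two resulting bounds equal;
    \<open>J + 1\<close> instead of \<open>J\<close> keeps it positive.\<close>
  define l where "l = ((J + 1) / L powr (1/2)) powr (1 / q)"
  have l: "l > 0" using J0 L by (auto simp: l_def)
  define \<Phi> where "\<Phi> t = integral {1/2..t} (\<lambda>t. G (of_real t * z))" for t
  have l': "l = (J + 1) powr (1/q) / L powr (1 / (2 * q))"
    using J0 L by (simp add: l_def powr_divide powr_powr)
  let ?D = "\<lambda>t. 1/2 * Llog (t * r) powr (1/2 - 1) * (2 * (t * r) / (1 - (t * r)^2)) * r"
  have "norm (f (of_real 1 * z) - f (of_real (1/2) * z)) \<le>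
    (8 * l * Llog (1 * r) powr (1/2) + l powr (1 - q) * \<Phi> 1) - (8 * l * Llog (1/2 * r) powr (1/2) + l powr (1 - q) * \<Phi> (1/2))"
  proof (rule differentiable_bound_general[where f = "\<lambda>t. f (of_real t * z)" and f' = "\<lambda>t. z * deriv f (of_real t * z)"
     and \<phi> = "\<lambda>t. 8 * l * Llog (t * r) powr (1/2) + l powr (1 - q) * \<Phi> t"
     and \<phi>' = "\<lambda>t. 8 * l * ?D t + l powr (1 - q) * G (of_real t * z)"])
    show "continuous_on {1/2..1} (\<lambda>t. f (of_real t * z))"
      by (rule continuous_on_compose2[OF holomorphic_on_imp_continuous_on[OF f]])
         (use tz in \<open>auto intro!: continuous_intros\<close>)
    have dL: "((\<lambda>t. Llog (t * r) powr (1/2)) has_real_derivative ?D t) (at t)"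
      if "1/2 \<le> t" "t \<le> 1" for t
      using tr[OF that]
      by (intro DERIV_chain2[where f = "\<lambda>r. Llog r powr (1/2)"] has_field_derivative_Llog_powr)
        (auto intro!: derivative_eq_intros)
    have d\<Phi>: "(\<Phi> has_vector_derivative G (of_real t * z)) (at t within {1/2..1})" if "t \<in> {1/2..1}" for t
      unfolding \<Phi>_def using contGt that by (rule integral_has_vector_derivative)
    have "continuous_on {1/2..1} \<Phi>"
      using d\<Phi> has_vector_derivative_continuous continuous_on_eq_continuous_within by blast
    moreover have "continuous_on {1/2..1} (\<lambda>t. Llog (t * r) powr (1/2))"
      using dL by (intro DERIV_continuous_on[where D = "\<lambda>t. ?D t"])
        (auto intro: has_field_derivative_at_within)
    ultimately show "continuous_on {1/2..1} (\<lambda>t. 8 * l * Llog (t * r) powr (1/2) + l powr (1 - q) * \<Phi> t)"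
      by (intro continuous_on_add continuous_on_mult continuous_on_const)
    fix t :: real assume t: "1/2 < t" "t < 1"
    have "(f has_field_derivative deriv f (of_real t * z)) (at (of_real t * z))"
      using f tz[of t] t by (intro holomorphic_derivI[of f udisc]) auto
    hence "((\<lambda>w. f (w * z)) has_field_derivative deriv f (of_real t * z) * z) (at (of_real t))"
      by (intro DERIV_chain2[where f = f]) (auto intro!: derivative_eq_intros)
    from has_vector_derivative_real_field[OF this]
    show "((\<lambda>t. f (of_real t * z)) has_vector_derivative z * deriv f (of_real t * z)) (at t)"
      by (simp add: mult.commute)
    have at: "at t within {1/2..1} = at t" using t by (intro at_within_Icc_at) auto
    show "((\<lambda>t. 8 * l * Llog (t * r) powr (1/2) + l powr (1 - q) * \<Phi> t) has_vector_derivative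
      8 * l * ?D t + l powr (1 - q) * G (of_real t * z)) (at t)"
      using DERIV_add[OF DERIV_cmult[OF dL[of t], of "8 * l"] DERIV_cmult[of \<Phi> "G (of_real t * z)" t UNIV "l powr (1 - q)"]]
        d\<Phi>[of t] t unfolding at has_real_derivative_iff_has_vector_derivative by simp
    define s where "s = t * r"
    have s: "1/4 \<le> s" "s < 1"
      using mult_mono[of "1/2" t "1/2" r] tr(2)[of t] t r by (auto simp: s_def)
    define w where "w = 1 / ((1 - s^2) * Llog s powr (1/2))"
    have p: "1 - s^2 > 0" "Llog s \<ge> 1" using s one_minus_sq_pos[of s] Llog_ge_1[of s] by auto
    have w: "w > 0" unfolding w_def using p by simp
    define x where "x = norm (deriv f (of_real t * z))"
    have wG: "w * (x / w) powr q = G (of_real t * z)"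
    proof -
      have "w * (x / w) powr q = w powr (1 - q) * x powr q"
        using w by (simp add: powr_divide powr_diff x_def)
      also have "w powr (1 - q) = (1 - s^2) powr (q - 1) * Llog s powr ((q - 1) / 2)"
      proof -
        have "w powr (1 - q) = ((1 - s^2) * Llog s powr (1/2)) powr (q - 1)"
          unfolding w_def using p by (simp add: powr_divide powr_minus_divide[symmetric])
        also have "... = (1 - s^2) powr (q - 1) * Llog s powr ((q - 1) / 2)"
          using p by (simp add: powr_mult powr_powr)
        finally show ?thesis .
      qed
      finally show ?thesis using tz(2)[of t] t by (simp add: G_def hardy_density_def x_def s_def)
    qed
    have y: "x / w \<le> l + l powr (1 - q) * (x / w) powr q"
    proof (cases "x / w \<le> l")
      case True thus ?thesis by (smt (verit) mult_nonneg_nonneg powr_ge_zero)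
    next
      case False
      hence xw: "x / w > l" "x / w > 0" using l by auto
      have "x / w = (x / w) powr (1 - q) * (x / w) powr q" using xw w by (simp add: x_def flip: powr_add)
      also have "... \<le> l powr (1 - q) * (x / w) powr q"
        using xw l q by (intro mult_right_mono powr_mono2') auto
      finally show ?thesis using l by simp
    qed
    have "norm (z * deriv f (of_real t * z)) \<le> x"
      using r by (simp add: norm_mult x_def r_def mult_left_le_one_le)
    also have "x = w * (x / w)" using w by simp
    also have "... \<le> w * (l + l powr (1 - q) * (x / w) powr q)" using y w by (intro mult_left_mono) auto
    also have "... = l * w + l powr (1 - q) * G (of_real t * z)" unfolding wG[symmetric] by (simp add: algebra_simps)
    \<comment> \<open>The primitive \<open>Llog (t * r) powr (1/2)\<close> has derivative
      \<open>s * r * w\<close>, and \<open>s * r\<close> is at least 1/4 * 1/2; hence the 8.\<close>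
    also have "l * w \<le> 8 * l * ?D t"
    proof -
      have "?D t = (s * r) * w"
        unfolding w_def s_def[symmetric] by (simp add: powr_minus_divide)
      moreover have "1 / 8 \<le> s * r" using mult_mono[of "1/4" s "1/2" r] s r by simp
      hence "w \<le> 8 * ((s * r) * w)" using w mult_right_mono[of "1/8" "s * r" w] by simp
      ultimately show ?thesis using l by simp
    qed
    finally show "norm (z * deriv f (of_real t * z)) \<le> 8 * l * ?D t + l powr (1 - q) * G (of_real t * z)"
      by simp
  qed auto
  also have "... \<le> 8 * (l * L powr (1/2)) + l powr (1 - q) * J"
    using l by (simp add: \<Phi>_def J_def L_def)
  also have "... \<le> 8 * (l * L powr (1/2)) + l powr (1 - q) * (J + 1)"
    by (intro add_left_mono mult_left_mono) auto
  also have "l * L powr (1/2) = (J + 1) powr (1/q) * L powr ((q - 1) / (2 * q))"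
  proof -
    have "L powr (1/2) = L powr (1 / (2 * q)) * L powr ((q - 1) / (2 * q))"
      using q by (simp flip: powr_add add: field_simps)
    thus ?thesis unfolding l' using L by simp
  qed
  also have "l powr (1 - q) * (J + 1) = (J + 1) powr (1/q) * L powr ((q - 1) / (2 * q))"
  proof -
    have "l powr (1 - q) = (J + 1) powr (1 / q * (1 - q)) * L powr (- (1 / (2 * q) * (1 - q)))"
      unfolding l' using J0 L by (simp add: powr_divide powr_powr powr_minus_divide)
    also have "- (1 / (2 * q) * (1 - q)) = (q - 1) / (2 * q)" using q by (simp add: field_simps)
    also have "1 / q * (1 - q) = (1 - q) / q" by simp
    finally have "l powr (1 - q) * (J + 1) = ((J + 1) powr ((1 - q) / q) * (J + 1) powr 1) * L powr ((q - 1) / (2 * q))"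
      using J0 by simp
    also have "(J + 1) powr ((1 - q) / q) * (J + 1) powr 1 = (J + 1) powr ((1 - q) / q + 1)"
      by (simp only: powr_add)
    also have "(1 - q) / q + 1 = 1 / q" using q by (simp add: field_simps)
    finally show ?thesis .
  qed
  \<comment> \<open>8 from the first summand and 1 from the second, which the choice of
    \<open>l\<close> has made proportional.\<close>
  finally have 1: "norm (f z - f (of_real (1/2) * z)) \<le> 9 * ((J + 1) powr (1/q) * L powr ((q - 1) / (2 * q)))"
    by simp
  define Q where "Q = (J + 1) powr (1/q) * L powr ((q - 1) / (2 * q))"
  have "Q \<ge> 1 * 1" unfolding Q_def using J0 L q by (intro mult_mono ge_one_powr_ge_zero) auto
  hence Q: "Q \<ge> 1" by simp
  have "norm (f (of_real (1/2) * z)) \<le> A" using z by (intro A) (simp add: norm_mult)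
  also have "... \<le> A * Q" using A Q by (simp add: mult_le_cancel_left1)
  finally have "norm (f z) \<le> (A + 9) * Q"
    using 1 norm_triangle_ineq[of "f (of_real (1/2) * z)" "f z - f (of_real (1/2) * z)"]
    by (simp add: Q_def algebra_simps)
  hence "norm (f z) powr q \<le> ((A + 9) * Q) powr q" using q by (intro powr_mono2) auto
  also have "... = (A + 9) powr q * (L powr ((q - 1) / 2) * (1 + J))"
    using A Q J0 L q by (simp add: powr_mult Q_def powr_powr add.commute)
  finally show "norm (f z) powr q \<le> (A + 9) powr q * (Llog (norm z) powr ((q - 1) / 2) * (1 + J))"
    by (simp add: L_def r_def)
qed

lemma powr_add_le_two_powr:
  fixes a b q :: real
  assumes "0 \<le> a" "0 \<le> b" "0 < q"
  shows "(a + b) powr q \<le> 2 powr q * (a powr q + b powr q)"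
proof -
  have "(a + b) powr q \<le> (2 * max a b) powr q" using assms by (intro powr_mono2) auto
  also have "... = 2 powr q * max a b powr q" using assms by (simp add: powr_mult)
  also have "max a b powr q \<le> a powr q + b powr q" by (simp add: max_def)
  finally show ?thesis by (simp add: mult_left_mono)
qed

lemma nn_integral_Icc_continuous:
  fixes \<phi> :: "real \<Rightarrow> real"
  assumes c: "continuous_on {a..b} \<phi>" and nonneg: "\<And>t. t \<in> {a..b} \<Longrightarrow> 0 \<le> \<phi> t"
  shows "(\<integral>\<^sup>+t\<in>{a..b}. ennreal (\<phi> t) \<partial>lborel) = ennreal (integral {a..b} \<phi>)"
proof -
  have "(\<integral>\<^sup>+t. ennreal (indicator {a..b} t *\<^sub>R \<phi> t) \<partial>lborel) = ennreal (integral {a..b} \<phi>)"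
  proof (rule nn_integral_has_integral_lborel)
    show "(\<lambda>t. indicator {a..b} t *\<^sub>R \<phi> t) \<in> borel_measurable borel"
      using c by (intro borel_measurable_continuous_on_indicator) auto
    have "(\<phi> has_integral integral {a..b} \<phi>) {a..b}"
      using integrable_continuous_real[OF c] by (rule integrable_integral)
    hence "((\<lambda>t. if t \<in> {a..b} then \<phi> t else 0) has_integral integral {a..b} \<phi>) UNIV"
      by (subst has_integral_restrict_UNIV)
    moreover have "(\<lambda>t. if t \<in> {a..b} then \<phi> t else 0) = (\<lambda>t. indicator {a..b} t *\<^sub>R \<phi> t)"
      by (auto simp: indicator_def)
    ultimately show "((\<lambda>t. indicator {a..b} t *\<^sub>R \<phi> t) has_integral integral {a..b} \<phi>) UNIV" by simp
  qed (use nonneg in \<open>auto simp: indicator_def\<close>)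
  also have "(\<lambda>t. ennreal (indicator {a..b} t *\<^sub>R \<phi> t)) = (\<lambda>t. ennreal (\<phi> t) * indicator {a..b} t)"
    by (auto simp: indicator_def)
  finally show ?thesis .
qed

lemma nn_integral_log_weight:
  assumes b: "b > 0"
  shows "disc_int (\<lambda>z. log_kernel b (norm (z::complex))) \<le> ennreal (pi / b)" (is "?I \<le> _")
proof -
  have "?I
     = (\<integral>\<^sup>+r\<in>{0<..<1}. ennreal (2 * pi * r) * ennreal (log_kernel b r) \<partial>lborel)"
    by (intro nn_integral_radial[of "\<lambda>r. ennreal (log_kernel b r)"]) measurable
  also have "... = (\<integral>\<^sup>+r\<in>{0<..<1}. ennreal (2 * pi * r * (log_kernel b r)) \<partial>lborel)"
    by (intro nn_integral_cong) (auto simp: indicator_def ennreal_mult'[symmetric])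
  also have "... \<le> ennreal (pi / b)"
  proof (rule nn_integral_Ioo_le[where F = "\<lambda>r. - pi / b * Llog r powr (-b)"])
    fix x :: real assume x: "0 < x" "x < 1"
    have "Llog x powr (-b - 1) = 1 / Llog x powr (b + 1)" by (simp add: powr_minus_divide[symmetric])
    hence "- pi / b * (- b * Llog x powr (-b - 1) * (2 * x / (1 - x^2))) = 2 * pi * x * (log_kernel b x)"
      using b by (simp add: mult_ac)
    thus "((\<lambda>r. - pi / b * Llog r powr (-b)) has_real_derivative 2 * pi * x * (log_kernel b x)) (at x)"
      using DERIV_cmult[OF has_field_derivative_Llog_powr[of x "-b"], of "- pi / b"] x by simp
    show "0 \<le> 2 * pi * x * (log_kernel b x)"
      using x one_minus_sq_pos[of x] by simp
  next
    fix x y :: real assume x: "0 < x" "x \<le> y" "y < 1"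
    have "Llog x powr (-b) \<le> 1 powr (-b)" using Llog_ge_1[of x] x b by (intro powr_mono2') auto
    hence "pi / b * Llog x powr (-b) \<le> pi / b * 1" using b by (intro mult_left_mono) auto
    moreover have "0 \<le> pi / b * Llog y powr (-b)" using b by simp
    ultimately show "- pi / b * Llog y powr (-b) - - pi / b * Llog x powr (-b) \<le> pi / b"
      by simp
  qed auto
  finally show ?thesis .
qed

text \<open>As \<open>q = 2 * b + 1\<close>, division turns the bound of
  \<open>hardy_pointwise\<close> into a multiple of \<open>log_kernel b\<close> times
  \<open>1 + J\<close>. The 1 is integrable by \<open>nn_integral_log_weight\<close>, and the radial
  average \<open>J\<close> is left to \<open>hardy_tonelli\<close>.\<close>

lemma hardy_log:
  assumes f: "f \<in> Dspace q" and q: "q > 1"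
  shows "(\<integral>\<^sup>+z. ennreal (norm (f z) powr q / ((1 - (norm z)^2) * Llog (norm z) powr q)) * indicator {1/2..<1} (norm z) \<partial>lborel) < \<infinity>" (is "?A < _")
proof -
  have hol: "f holomorphic_on udisc" using f by (rule Dspace_holomorphic)
  define b where "b = (q - 1) / 2"
  have b: "b > 0" using q by (simp add: b_def)
  obtain A where A: "A \<ge> 0" "\<And>w. norm w \<le> 1/2 \<Longrightarrow> norm (f w) \<le> A"
    by (rule bounded_on_half_disc[OF holomorphic_on_imp_continuous_on[OF hol]]) blast
  define c where "c = (A + 9) powr q"
  define G where "G w = ennreal (hardy_density q f w) * indicator udisc w" for w
  have G [measurable]: "G \<in> borel_measurable borel" unfolding G_def
    by (intro set_nn_integral_disc_measurable continuous_on_hardy_density hol q hardy_density_nonneg)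
  let ?I = "\<lambda>z. \<integral>\<^sup>+t\<in>{1/2..1}. G (of_real t * z) \<partial>lborel"
  define K where "K r = ennreal (log_kernel b r) * indicator {1/2..<1} r" for r
  have [measurable]: "K \<in> borel_measurable borel" unfolding K_def by measurable
  have pt: "ennreal (norm (f z) powr q / ((1 - (norm z)^2) * Llog (norm z) powr q)) * indicator {1/2..<1} (norm z)
     \<le> ennreal c * (K (norm z) + K (norm z) * ?I z)" for z
  proof (cases "1/2 \<le> norm z \<and> norm z < 1")
    case True
    define J where "J = integral {1/2..1} (\<lambda>t. hardy_density q f (of_real t * z))"
    note hp = hardy_pointwise[OF hol q conjunct1[OF True] conjunct2[OF True] A, folded J_def]
    have tz: "of_real t * z \<in> udisc" if "t \<in> {1/2..1}" for t
    proof -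
      have "t * norm z \<le> 1 * norm z" using that by (intro mult_right_mono) auto
      also have "... < 1" using True by simp
      finally show ?thesis using that by (simp add: norm_mult)
    qed
    have "?I z = (\<integral>\<^sup>+t\<in>{1/2..1}. ennreal (hardy_density q f (of_real t * z)) \<partial>lborel)"
      using tz by (intro nn_integral_cong) (auto simp: G_def indicator_def)
    also have "... = ennreal J"
      unfolding J_def using hp(3) by (intro nn_integral_Icc_continuous hardy_density_nonneg)
    finally have GJ: "?I z = ennreal J" .
    define L where "L = Llog (norm z)"
    define P where "P = 1 - (norm z)^2"
    have L: "L \<ge> 1" using True by (auto simp: L_def intro!: Llog_ge_1)
    have P: "P > 0" using one_minus_sq_pos[of "norm z"] True by (auto simp: P_def)
    have "norm (f z) powr q / (P * L powr q) \<le> c * (L powr b * (1 + J)) / (P * L powr q)"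
      using hp(1) P by (intro divide_right_mono) (auto simp: c_def L_def b_def)
    also have "... = c * (1 / (P * L powr (b + 1)) + 1 / (P * L powr (b + 1)) * J)"
    proof -
      have "L powr q = L powr b * L powr (b + 1)"
        by (simp add: b_def flip: powr_add)
      thus ?thesis using L P by (simp add: field_simps)
    qed
    finally have "ennreal (norm (f z) powr q / (P * L powr q)) \<le> ennreal (c * (1 / (P * L powr (b + 1)) + 1 / (P * L powr (b + 1)) * J))"
      by (rule ennreal_leI)
    also have "... = ennreal c * (ennreal (1 / (P * L powr (b + 1))) + ennreal (1 / (P * L powr (b + 1))) * ennreal J)"
      using P L hp(2) by (simp add: c_def ennreal_mult'[symmetric] ennreal_plus[symmetric] del: ennreal_plus)
    finally show ?thesis using True unfolding GJ K_def L_def P_def by simp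
  qed auto
  have "?A
     \<le> (\<integral>\<^sup>+z. ennreal c * (K (norm z) + K (norm z) * ?I z) \<partial>lborel)"
    by (intro nn_integral_mono pt)
  also have "... = ennreal c * ((\<integral>\<^sup>+z. K (norm (z::complex)) \<partial>lborel) + (\<integral>\<^sup>+z. K (norm z) * ?I z \<partial>lborel))"
    by (simp add: nn_integral_cmult nn_integral_add)
  also have "... < \<infinity>"
  proof -
    have "(\<integral>\<^sup>+z. K (norm (z::complex)) \<partial>lborel) \<le> disc_int (\<lambda>z. log_kernel b (norm (z::complex)))"
      by (intro nn_integral_mono) (auto simp: K_def indicator_def)
    also have "... < \<infinity>" using nn_integral_log_weight[OF b] by (simp add: order_le_less_trans)
    finally have 1: "(\<integral>\<^sup>+z. K (norm (z::complex)) \<partial>lborel) < \<infinity>" .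
    have "(\<integral>\<^sup>+z. K (norm z) * ?I z \<partial>lborel)
      \<le> 4 * (\<integral>\<^sup>+w. G w * ennreal (2 / b * Llog (norm w) powr (-b)) \<partial>lborel)"
    proof -
      have "G w = 0" if "w \<notin> udisc" for w using that by (simp add: G_def)
      thus ?thesis unfolding K_def using b G by (intro hardy_tonelli)
    qed
    also have "(\<integral>\<^sup>+w. G w * ennreal (2 / b * Llog (norm w) powr (-b)) \<partial>lborel)
      \<le> disc_int (\<lambda>w. 2 / b * 2 powr (q - 1) * wnorm q w (deriv f w))"
    proof (rule nn_integral_mono)
      fix w :: complex
      show "G w * ennreal (2 / b * Llog (norm w) powr (-b))
        \<le> ennreal (2 / b * 2 powr (q - 1) * wnorm q w (deriv f w)) * indicator udisc w"
      proof (cases "w \<in> udisc")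
        case True
        have L: "Llog (norm w) \<ge> 1" using True by (intro Llog_ge_1) auto
        have "1 - (norm w)^2 = (1 + norm w) * (1 - norm w)" by (simp add: power2_eq_square algebra_simps)
        also have "... \<le> 2 * (1 - norm w)" using True by (intro mult_right_mono) auto
        finally have "(1 - (norm w)^2) powr (q - 1) \<le> (2 * (1 - norm w)) powr (q - 1)"
          using q True one_minus_sq_pos[of "norm w"] by (intro powr_mono2) auto
        also have "... = 2 powr (q - 1) * (1 - norm w) powr (q - 1)" by (rule powr_mult)
        finally have le: "(1 - (norm w)^2) powr (q - 1) \<le> 2 powr (q - 1) * (1 - norm w) powr (q - 1)" .
        \<comment> \<open>The logarithms cancel here, and the density of \<open>Dspace q\<close> is
          what remains.\<close>
        have "hardy_density q f w * (2 / b * Llog (norm w) powr (-b))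
          = 2 / b * ((1 - (norm w)^2) powr (q - 1) * norm (deriv f w) powr q)"
          unfolding hardy_density_def b_def[symmetric] using L by (simp add: powr_minus_divide)
        also have "... \<le> 2 / b * ((2 powr (q - 1) * (1 - norm w) powr (q - 1)) * norm (deriv f w) powr q)"
          using le b by (intro mult_left_mono mult_right_mono) auto
        finally show ?thesis using True unfolding G_def
          by (simp add: ennreal_mult'[symmetric] hardy_density_nonneg ennreal_leI mult.assoc)
      qed (simp add: G_def)
    qed
    also have "4 * disc_int (\<lambda>w. 2 / b * 2 powr (q - 1) * wnorm q w (deriv f w)) < \<infinity>"
    proof -
      have "set_integrable lborel udisc (\<lambda>w. 2 / b * 2 powr (q - 1) * wnorm q w (deriv f w))"
        using f Dspace_iff[of q f] q by (intro set_integrable_mult_right) auto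
      moreover have "continuous_on udisc (\<lambda>w. 2 / b * 2 powr (q - 1) * wnorm q w (deriv f w))"
        using q b by (intro continuous_on_mult[OF continuous_on_const] continuous_on_weighted continuous_on_deriv_disc hol) auto
      ultimately show ?thesis using b by (subst (asm) set_integrable_disc_iff) (auto simp: ennreal_mult_less_top)
    qed
    finally show ?thesis using 1 by (simp add: ennreal_mult_less_top mult_left_mono)
  qed
  finally show ?thesis .
qed

text \<open>In the product rule the term with \<open>deriv f\<close> only needs \<open>g\<close>
  bounded. For \<open>f * deriv g\<close> the \<open>Bloch_log\<close> bound produces the integrand
  of \<open>hardy_log\<close> away from the origin; on the half disc continuity suffices.\<close>

lemma Dspace_mult:
  assumes f: "f \<in> Dspace q" and g: "g \<in> Bloch_log" "g \<in> Hinf" and q: "q > 1"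
  shows "(\<lambda>z. f z * g z) \<in> Dspace q"
proof -
  have hol: "f holomorphic_on udisc" "g holomorphic_on udisc"
    using f g by (auto simp: Dspace_def Hinf_def)
  from Bloch_logE[OF g(1)] obtain C where C: "C \<ge> 0"
    "\<And>z. z \<in> udisc \<Longrightarrow> bnorm z (deriv g z) * Llog (norm z) \<le> C" by metis
  from HinfE[OF g(2)] obtain M where M: "M > 0" "\<And>z. z \<in> udisc \<Longrightarrow> norm (g z) \<le> M" by metis
  define h where "h z = wnorm q z (f z * deriv g z)" for z
  have ch: "continuous_on udisc h" unfolding h_def using q
    by (intro continuous_on_weighted continuous_on_mult continuous_on_deriv_disc holomorphic_on_imp_continuous_on hol) auto
  have h0: "0 \<le> h z" for z by (simp add: h_def)
  obtain B where B: "B \<ge> 0" "\<And>z. norm z \<le> 1/2 \<Longrightarrow> norm (h z) \<le> B"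
    by (rule bounded_on_half_disc[OF ch]) blast
  define k where "k z = ennreal (norm (f z) powr q / ((1 - (norm z)^2) * Llog (norm z) powr q)) * indicator {1/2..<1} (norm z)" for z
  have pt: "ennreal (h z) * indicator udisc z \<le> ennreal B * indicator udisc z + ennreal (C powr q) * k z" for z
  proof (cases "norm z < 1/2 \<or> norm z \<ge> 1")
    case True
    show ?thesis
    proof (cases "norm z < 1/2")
      case True
      hence "ennreal (h z) \<le> ennreal B" using B(2)[of z] by (intro ennreal_leI) auto
      thus ?thesis by (auto simp: indicator_def add_increasing2)
    qed (use True in auto)
  next
    case False
    hence z: "1/2 \<le> norm z" "norm z < 1" by auto
    define P where "P = 1 - (norm z)^2"
    define L where "L = Llog (norm z)"
    have P: "P > 0" "1 - norm z \<le> P"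
      using one_minus_sq_pos[of "norm z"] z mult_left_le_one_le[of "norm z" "norm z"] by (auto simp: P_def power2_eq_square)
    have L: "L \<ge> 1" using z unfolding L_def by (intro Llog_ge_1) auto
    have "h z \<le> P powr (q - 1) * (norm (f z) * (C / (P * L))) powr q"
    proof -
      have "norm (deriv g z) \<le> C / (P * L)" using C(2)[of z] z P L by (simp add: P_def[symmetric] L_def[symmetric] field_simps)
      thus ?thesis unfolding h_def norm_mult using P z q
        by (intro mult_mono powr_mono2 mult_left_mono) auto
    qed
    \<comment> \<open>The powers of \<open>P\<close> combine to (q - 1) - q = -1, as in
      \<open>hardy_log\<close>.\<close>
    also have "... = C powr q * (norm (f z) powr q / (P * L powr q))"
      using P L C q by (simp add: powr_mult powr_divide powr_diff)
    finally have "ennreal (h z) \<le> ennreal (C powr q * (norm (f z) powr q / (P * L powr q)))" by (rule ennreal_leI)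
    also have "... = ennreal (C powr q) * k z"
      using z P L unfolding k_def P_def[symmetric] L_def[symmetric] by (simp add: ennreal_mult'[symmetric])
    finally show ?thesis using z by (auto simp: add_increasing)
  qed
  have ind: "set_integrable lborel udisc h"
  proof -
    have km: "k \<in> borel_measurable lborel"
    proof -
      have "continuous_on udisc (\<lambda>z. norm (f z) powr q)"
        using q hol by (intro continuous_on_powr' continuous_on_norm continuous_on_const holomorphic_on_imp_continuous_on) auto
      from set_nn_integral_disc_measurable[OF this]
      have [measurable]: "(\<lambda>z. ennreal (norm (f z) powr q) * indicator udisc z) \<in> borel_measurable borel" by simp
      have "k = (\<lambda>z. (ennreal (norm (f z) powr q) * indicator udisc z) * (ennreal (1 / ((1 - (norm z)^2) * Llog (norm z) powr q)) * indicator {1/2..<1} (norm z)))"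
        by (auto simp: k_def indicator_def ennreal_mult'[symmetric])
      also have "... \<in> borel_measurable lborel" by measurable
      finally show ?thesis .
    qed
    have "disc_int h \<le> (\<integral>\<^sup>+z. ennreal B * indicator udisc z + ennreal (C powr q) * k z \<partial>lborel)"
      by (intro nn_integral_mono pt)
    also have "... = ennreal B * emeasure lborel udisc + ennreal (C powr q) * (\<integral>\<^sup>+z. k z \<partial>lborel)"
      using km by (subst nn_integral_add) (auto simp: nn_integral_cmult nn_integral_cmult_indicator)
    also have "... < \<infinity>" using hardy_log[OF f q] unfolding k_def[symmetric]
      by (simp add: ennreal_mult_less_top emeasure_disc_complex)
    finally show ?thesis using set_integrable_disc_iff[OF ch h0] by simp
  qed
  show ?thesis
  proof (rule Dspace_dominated)
    show "(\<lambda>z. f z * g z) holomorphic_on udisc" by (intro holomorphic_intros hol)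
    show "set_integrable lborel udisc (\<lambda>z. 2 powr q * (h z + M powr q * wnorm q z (deriv f z)))"
      using ind f Dspace_iff[of q f] q by (intro set_integrable_mult_right set_integral_add) auto
    fix z :: complex assume z: "z \<in> udisc"
    have "norm (deriv (\<lambda>z. f z * g z) z) powr q \<le> (norm (f z * deriv g z) + norm (deriv f z) * M) powr q"
      unfolding deriv_mult_disc[OF hol z] using q M(2)[OF z]
      by (intro powr_mono2 order_trans[OF norm_triangle_ineq] add_mono) (auto simp: norm_mult mult_left_mono)
    also have "... \<le> 2 powr q * (norm (f z * deriv g z) powr q + (norm (deriv f z) * M) powr q)"
      using q M by (intro powr_add_le_two_powr) auto
    finally have "wnorm q z (deriv (\<lambda>z. f z * g z) z) \<le>
      (1 - norm z) powr (q - 1) * (2 powr q * (norm (f z * deriv g z) powr q + (norm (deriv f z) * M) powr q))"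
      by (intro mult_left_mono) auto
    also have "... = 2 powr q * (h z + M powr q * wnorm q z (deriv f z))"
      using M by (simp add: h_def powr_mult algebra_simps)
    finally show "wnorm q z (deriv (\<lambda>z. f z * g z) z)
      \<le> 2 powr q * (h z + M powr q * wnorm q z (deriv f z))" .
  qed (use q in simp)
qed

section \<open>The multiplier spaces for \<open>p \<le> q\<close>\<close>

lemma multipliers_eq:
  assumes q: "1 < q" and p: "0 < p" "p \<le> q"
  shows "multipliers (Dspace p \<inter> Bloch) (Dspace q \<inter> Bloch) = Bloch_log \<inter> Hinf"
proof (intro equalityI subsetI)
  fix g assume "g \<in> multipliers (Dspace p \<inter> Bloch) (Dspace q \<inter> Bloch)"
  thus "g \<in> Bloch_log \<inter> Hinf" using p
    by (intro multiplier_Bloch_log_Hinf) (auto simp: multipliers_def)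
next
  fix g assume g: "g \<in> Bloch_log \<inter> Hinf"
  \<comment> \<open>Here \<open>p \<le> q\<close> enters: by \<open>Dspace_mono\<close> the domain
    is contained in \<open>Dspace q\<close>.\<close>
  thus "g \<in> multipliers (Dspace p \<inter> Bloch) (Dspace q \<inter> Bloch)"
    using Bloch_mult Dspace_mult[OF Dspace_mono[OF _ _ p] _ _ q] Hinf_def by (auto simp: multipliers_def)
qed

lemma multipliers_Bloch_eq: "multipliers Bloch Bloch = Bloch_log \<inter> Hinf"
proof (intro equalityI subsetI)
  fix g assume "g \<in> multipliers Bloch Bloch"
  thus "g \<in> Bloch_log \<inter> Hinf"
    by (intro multiplier_Bloch_log_Hinf) (auto simp: multipliers_def)
next
  fix g assume g: "g \<in> Bloch_log \<inter> Hinf"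
  thus "g \<in> multipliers Bloch Bloch"
    using Bloch_mult Hinf_def by (auto simp: multipliers_def)
qed

section \<open>Rotation invariance and averages over shells\<close>

lemma borel_measurable_Complex [measurable (raw)]:
  assumes [measurable]: "f \<in> borel_measurable M" "g \<in> borel_measurable M"
  shows "(\<lambda>x. Complex (f x) (g x)) \<in> borel_measurable M"
  unfolding Complex_eq by measurable

text \<open>Exposes the coordinates, so that a rotation can be reduced to one-dimensional
  substitutions.\<close>

lemma lborel_complex_eq: "(lborel :: complex measure) = distr (lborel \<Otimes>\<^sub>M lborel) borel (\<lambda>p. Complex (fst p) (snd p))"
proof (rule lborel_eqI)
  fix l u :: complex
  assume le: "\<And>b. b \<in> Basis \<Longrightarrow> l \<bullet> b \<le> u \<bullet> b"
  have lu: "Re l \<le> Re u" "Im l \<le> Im u"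
    using le[of 1] le[of \<i>] by (auto simp: Basis_complex_def)
  have "emeasure (distr (lborel \<Otimes>\<^sub>M lborel) borel (\<lambda>p. Complex (fst p) (snd p))) (box l u)
    = emeasure (lborel \<Otimes>\<^sub>M lborel) ({Re l<..<Re u} \<times> {Im l<..<Im u})"
    by (subst emeasure_distr) (auto simp: box_def Basis_complex_def space_pair_measure intro!: arg_cong[where f = "emeasure _"])
  also have "... = ennreal (Re u - Re l) * ennreal (Im u - Im l)"
    using lu by (subst lborel.emeasure_pair_measure_Times) auto
  also have "... = ennreal (\<Prod>b\<in>Basis. (u - l) \<bullet> b)"
    using lu by (simp add: Basis_complex_def ennreal_mult')
  finally show "emeasure (distr (lborel \<Otimes>\<^sub>M lborel) borel (\<lambda>p. Complex (fst p) (snd p))) (box l u) = (\<Prod>b\<in>Basis. (u - l) \<bullet> b)" .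
qed simp

lemma nn_integral_complex:
  fixes h :: "complex \<Rightarrow> ennreal"
  assumes [measurable]: "h \<in> borel_measurable borel"
  shows "(\<integral>\<^sup>+z. h z \<partial>lborel) = (\<integral>\<^sup>+x. \<integral>\<^sup>+y. h (Complex x y) \<partial>lborel \<partial>lborel)"
proof -
  have "(\<integral>\<^sup>+z. h z \<partial>lborel) = (\<integral>\<^sup>+p. h (Complex (fst p) (snd p)) \<partial>(lborel \<Otimes>\<^sub>M lborel))"
    by (subst lborel_complex_eq, subst nn_integral_distr) measurable
  also have "... = (\<integral>\<^sup>+x. \<integral>\<^sup>+y. h (Complex (fst (x, y)) (snd (x, y))) \<partial>lborel \<partial>lborel)"
    by (subst lborel.nn_integral_fst[symmetric]) measurable
  finally show ?thesis by simp
qed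

text \<open>A rotation with positive real part is a composition of shears and scalings of the coordinate axes.\<close>
lemma nn_integral_rotation:
  fixes h :: "complex \<Rightarrow> ennreal"
  assumes h: "h \<in> borel_measurable borel" and c: "norm c = 1" "Re c > 0"
  shows "(\<integral>\<^sup>+z. h (c * z) \<partial>lborel) = (\<integral>\<^sup>+z. h z \<partial>lborel)"
proof -
  define a b where "a = Re c" and "b = Im c"
  have a: "a > 0" using c by (simp add: a_def)
  have ab: "a * a + b * b = 1" using c(1) cmod_power2[of c] by (simp add: a_def b_def power2_eq_square)
  note [measurable] = h
  have "(\<integral>\<^sup>+z. h z \<partial>lborel) = (\<integral>\<^sup>+u. \<integral>\<^sup>+v. h (Complex u v) \<partial>lborel \<partial>lborel)"
    using h by (rule nn_integral_complex)
  \<comment> \<open>First \<open>v = b / a * u + y / a\<close> at fixed \<open>u\<close>, then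
    \<open>u = a * x - b * y\<close> at fixed \<open>y\<close>. The Jacobians 1/a and a cancel, and
    \<open>a * a + b * b = 1\<close> turns the second coordinate into
    \<open>b * x + a * y\<close>.\<close>
  also have "... = (\<integral>\<^sup>+u. ennreal (1 / a) * (\<integral>\<^sup>+y. h (Complex u (b / a * u + 1 / a * y)) \<partial>lborel) \<partial>lborel)"
  proof (rule nn_integral_cong)
    fix u :: real
    show "(\<integral>\<^sup>+v. h (Complex u v) \<partial>lborel) = ennreal (1 / a) * (\<integral>\<^sup>+y. h (Complex u (b / a * u + 1 / a * y)) \<partial>lborel)"
      using a by (subst nn_integral_real_affine[where c = "1 / a" and t = "b / a * u"]) auto
  qed
  also have "... = ennreal (1 / a) * (\<integral>\<^sup>+u. \<integral>\<^sup>+y. h (Complex u (b / a * u + 1 / a * y)) \<partial>lborel \<partial>lborel)"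
    by (rule nn_integral_cmult) measurable
  also have "(\<integral>\<^sup>+u. \<integral>\<^sup>+y. h (Complex u (b / a * u + 1 / a * y)) \<partial>lborel \<partial>lborel)
     = (\<integral>\<^sup>+y. \<integral>\<^sup>+u. h (Complex u (b / a * u + 1 / a * y)) \<partial>lborel \<partial>lborel)"
    by (rule lborel_pair.Fubini') measurable
  also have "... = (\<integral>\<^sup>+y. ennreal a * (\<integral>\<^sup>+x. h (Complex (a * x - b * y) (b * x + a * y)) \<partial>lborel) \<partial>lborel)"
  proof (rule nn_integral_cong)
    fix y :: real
    have e: "b / a * (- b * y + a * x) + 1 / a * y = b * x + a * y" for x
    proof -
      have "b / a * (- b * y + a * x) + 1 / a * y = b * x + (1 - b * b) / a * y"
        using a by (simp add: field_simps)
      also have "1 - b * b = a * a" using ab by simp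
      finally show ?thesis using a by simp
    qed
    have "(\<integral>\<^sup>+u. h (Complex u (b / a * u + 1 / a * y)) \<partial>lborel)
      = ennreal \<bar>a\<bar> * (\<integral>\<^sup>+x. h (Complex (- b * y + a * x) (b / a * (- b * y + a * x) + 1 / a * y)) \<partial>lborel)"
      using a by (intro nn_integral_real_affine) auto
    thus "(\<integral>\<^sup>+u. h (Complex u (b / a * u + 1 / a * y)) \<partial>lborel)
      = ennreal a * (\<integral>\<^sup>+x. h (Complex (a * x - b * y) (b * x + a * y)) \<partial>lborel)"
      unfolding e using a by simp
  qed
  also have "... = ennreal a * (\<integral>\<^sup>+y. \<integral>\<^sup>+x. h (Complex (a * x - b * y) (b * x + a * y)) \<partial>lborel \<partial>lborel)"
    by (rule nn_integral_cmult) measurable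
  also have "(\<integral>\<^sup>+y. \<integral>\<^sup>+x. h (Complex (a * x - b * y) (b * x + a * y)) \<partial>lborel \<partial>lborel)
      = (\<integral>\<^sup>+x. \<integral>\<^sup>+y. h (Complex (a * x - b * y) (b * x + a * y)) \<partial>lborel \<partial>lborel)"
    by (rule lborel_pair.Fubini') measurable
  also have "... = (\<integral>\<^sup>+x. \<integral>\<^sup>+y. h (c * Complex x y) \<partial>lborel \<partial>lborel)"
    by (intro nn_integral_cong arg_cong[where f = h]) (simp add: complex_eq_iff a_def b_def algebra_simps)
  also have "... = (\<integral>\<^sup>+z. h (c * z) \<partial>lborel)"
    using h by (intro nn_integral_complex[symmetric]) measurable
  also have "ennreal (1 / a) * (ennreal a * (\<integral>\<^sup>+z. h (c * z) \<partial>lborel)) = (\<integral>\<^sup>+z. h (c * z) \<partial>lborel)"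
    using a by (simp add: mult.assoc[symmetric] ennreal_mult'[symmetric])
  finally show ?thesis by simp
qed

lemma lborel_distr_rotation:
  assumes c: "norm c = 1" "Re c > 0"
  shows "distr lborel borel (\<lambda>z. c * z) = (lborel :: complex measure)"
proof (rule measure_eqI)
  fix A assume "A \<in> sets (distr lborel borel (\<lambda>z. c * z))"
  hence A [measurable]: "A \<in> sets borel" by simp
  have "emeasure (distr lborel borel (\<lambda>z. c * z)) A = (\<integral>\<^sup>+z. indicator A z \<partial>distr lborel borel (\<lambda>z. c * z))"
    using A by simp
  also have "... = (\<integral>\<^sup>+z. indicator A (c * z) \<partial>lborel)" using A by (intro nn_integral_distr) auto
  also have "... = (\<integral>\<^sup>+z. indicator A z \<partial>lborel)" using A c by (intro nn_integral_rotation) auto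
  finally show "emeasure (distr lborel borel (\<lambda>z. c * z)) A = emeasure lborel A" using A by simp
qed simp

definition shell :: "real \<Rightarrow> real \<Rightarrow> complex set" where
  "shell s t = {z. s \<le> norm z \<and> norm z \<le> t}"

lemma compact_shell: "compact (shell s t)"
proof -
  have "shell s t = cball 0 t - ball 0 s" by (auto simp: shell_def)
  thus ?thesis by (simp add: compact_diff)
qed

lemma shell_borel [measurable]: "shell s t \<in> sets borel"
  using compact_shell[of s t] by (simp add: borel_compact)

lemma emeasure_shell:
  assumes "0 \<le> s" "s \<le> t"
  shows "emeasure lborel (shell s t) = ennreal (pi * (t^2 - s^2))"
proof -
  have "shell s t = cball 0 t - ball 0 s" by (auto simp: shell_def)
  moreover have "emeasure lborel (cball 0 t - ball (0::complex) s) = emeasure lborel (cball (0::complex) t) - emeasure lborel (ball (0::complex) s)"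
    using assms by (intro emeasure_Diff) (auto simp: emeasure_disc_complex)
  ultimately show ?thesis using assms by (simp add: emeasure_disc_complex ennreal_minus algebra_simps)
qed

text \<open>A rotation preserves the shell and multiplies the integrand by a constant different from
  1, so the integral equals a multiple of itself and vanishes.\<close>

lemma shell_moment_zero:
  assumes "k \<noteq> m"
  shows "(LINT z:shell s t|lborel. z ^ k * cnj z ^ m) = 0"
proof -
  \<comment> \<open>This angle makes the constant \<open>cis 1\<close> whatever \<open>k\<close> and
    \<open>m\<close> are. Its modulus is at most 1, below pi / 2, so \<open>Re c > 0\<close> as
    \<open>nn_integral_rotation\<close> demands.\<close>
  define \<theta> where "\<theta> = 1 / (real k - real m)"
  have km: "real k - real m \<noteq> 0" using assms by simp
  have th: "\<bar>\<theta>\<bar> \<le> 1"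
  proof -
    have "\<bar>int k - int m\<bar> \<ge> 1" using assms by linarith
    hence "\<bar>real k - real m\<bar> \<ge> 1" by linarith
    thus ?thesis by (simp add: \<theta>_def divide_simps)
  qed
  define c where "c = cis \<theta>"
  have c: "norm c = 1" "Re c > 0"
    using th pi_gt3 by (auto simp: c_def abs_le_iff intro!: cos_gt_zero_pi)
  define F where "F z = indicator (shell s t) z *\<^sub>R (z ^ k * cnj z ^ m)" for z :: complex
  have [measurable]: "F \<in> borel_measurable borel"
    unfolding F_def using compact_shell
    by (intro borel_measurable_continuous_on_indicator) (auto intro!: continuous_intros)
  have cc: "c ^ k * cnj c ^ m = cis 1"
  proof -
    have "c ^ k * cnj c ^ m = cis (real k * \<theta> - real m * \<theta>)"
      by (simp add: c_def Complex.DeMoivre cis_cnj cis_mult)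
    also have "real k * \<theta> - real m * \<theta> = (real k - real m) * \<theta>" by (simp add: algebra_simps)
    also have "... = 1" using km by (simp add: \<theta>_def)
    finally show ?thesis .
  qed
  have rot: "F (c * z) = cis 1 * F z" for z
  proof -
    have "c * z \<in> shell s t \<longleftrightarrow> z \<in> shell s t" by (simp add: shell_def norm_mult c)
    moreover have "(c * z) ^ k * cnj (c * z) ^ m = (c ^ k * cnj c ^ m) * (z ^ k * cnj z ^ m)"
      by (simp add: power_mult_distrib)
    ultimately show ?thesis unfolding F_def cc by (auto simp: indicator_def)
  qed
  have "(\<integral>z. F z \<partial>lborel) = (\<integral>z. F z \<partial>distr lborel borel (\<lambda>z. c * z))"
    by (simp add: lborel_distr_rotation[OF c])
  also have "... = (\<integral>z. F (c * z) \<partial>lborel)" by (intro integral_distr) auto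
  also have "... = cis 1 * (\<integral>z. F z \<partial>lborel)" by (simp add: rot)
  finally have "(1 - cis 1) * (\<integral>z. F z \<partial>lborel) = 0" by (simp add: algebra_simps)
  moreover have "cis 1 \<noteq> 1"
  proof
    assume "cis 1 = 1"
    hence "sin (1::real) = 0" by (metis cis.sel(2) one_complex.sel(2))
    moreover have "sin (1::real) > 0" using pi_gt3 by (intro sin_gt_zero) auto
    ultimately show False by simp
  qed
  ultimately show ?thesis by (simp add: set_lebesgue_integral_def F_def)
qed

lemma set_integrable_compact:
  fixes f :: "'a::euclidean_space \<Rightarrow> 'b::{banach, second_countable_topology}"
  shows "compact S \<Longrightarrow> continuous_on S f \<Longrightarrow> set_integrable lborel S f"
  unfolding set_integrable_def by (rule borel_integrable_compact)

text \<open>Integrate the power series term by term; by \<open>shell_moment_zero\<close> only the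
  term with index \<open>m\<close> survives.\<close>

lemma shell_coefficient:
  assumes a: "\<And>z. z \<in> udisc \<Longrightarrow> (\<lambda>k. a k * z ^ k) sums g z" and st: "0 \<le> s" "s \<le> t" "t < 1"
  shows "(LINT z:shell s t|lborel. g z * cnj z ^ m) = a m * (LINT z:shell s t|lborel. z ^ m * cnj z ^ m)"
proof -
  define F where "F k z = indicator (shell s t) z *\<^sub>R (a k * z ^ k * cnj z ^ m)" for k z
  have sa: "summable (\<lambda>k. norm (a k) * t ^ k)"
  proof -
    \<comment> \<open>Convergence at a point strictly between \<open>t\<close> and 1 gives absolute
      convergence, uniform on the shell.\<close>
    have "summable (\<lambda>k. a k * of_real ((1 + t) / 2) ^ k)"
      using a[of "of_real ((1 + t) / 2)"] st by (intro sums_summable) (auto simp: norm_of_real simp del: of_real_add of_real_divide)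
    hence "summable (\<lambda>k. norm (a k * of_real t ^ k))"
      using st by (intro powser_insidea[where x = "of_real ((1 + t) / 2)"]) (auto simp: norm_of_real simp del: of_real_add of_real_divide)
    thus ?thesis using st by (simp add: norm_mult norm_power)
  qed
  have int: "integrable lborel (F k)" for k
    unfolding F_def by (intro borel_integrable_compact compact_shell continuous_intros)
  have nle: "norm (F k z) \<le> indicator (shell s t) z * (norm (a k) * t ^ k)" for k z
  proof (cases "z \<in> shell s t")
    case True
    hence z: "norm z \<le> t" by (simp add: shell_def)
    have "norm (F k z) = norm (a k) * norm z ^ k * norm z ^ m"
      using True by (simp add: F_def norm_mult norm_power)
    also have "... \<le> norm (a k) * t ^ k * 1"
      using z st by (intro mult_mono power_mono power_le_one) auto
    finally show ?thesis using True by simp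
  qed (simp add: F_def)
  have fin: "emeasure lborel (shell s t) < \<infinity>" using st by (simp add: emeasure_shell)
  have "(\<lambda>k. \<integral>z. F k z \<partial>lborel) sums (\<integral>z. (\<Sum>k. F k z) \<partial>lborel)"
  proof (rule sums_integral)
    show "AE z in lborel. summable (\<lambda>k. norm (F k z))"
    proof (rule AE_I2)
      fix z
      show "summable (\<lambda>k. norm (F k z))"
        using nle by (intro summable_comparison_test'[OF summable_mult[OF sa, of "indicator (shell s t) z"], of 0]) auto
    qed
    show "summable (\<lambda>k. \<integral>z. norm (F k z) \<partial>lborel)"
    proof (rule summable_comparison_test'[OF summable_mult[OF sa, of "measure lborel (shell s t)"], of 0])
      fix k :: nat
      have "(\<integral>z. norm (F k z) \<partial>lborel) \<le> (\<integral>z. indicator (shell s t) z * (norm (a k) * t ^ k) \<partial>lborel)"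
        using nle int[of k] fin by (intro integral_mono integrable_mult_left integrable_norm) (auto simp: integrable_indicator_iff)
      thus "norm (\<integral>z. norm (F k z) \<partial>lborel) \<le> measure lborel (shell s t) * (norm (a k) * t ^ k)"
        using fin by simp
    qed
  qed (rule int)
  also have "(\<lambda>k. \<integral>z. F k z \<partial>lborel) = (\<lambda>k. if k = m then a m * (LINT z:shell s t|lborel. z ^ m * cnj z ^ m) else 0)"
  proof
    fix k
    have "(\<integral>z. F k z \<partial>lborel) = (\<integral>z. a k * (indicator (shell s t) z *\<^sub>R (z ^ k * cnj z ^ m)) \<partial>lborel)"
      by (intro Bochner_Integration.integral_cong) (auto simp: F_def)
    also have "... = a k * (LINT z:shell s t|lborel. z ^ k * cnj z ^ m)"
      unfolding set_lebesgue_integral_def by (rule integral_mult_right_zero)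
    finally show "(\<integral>z. F k z \<partial>lborel) = (if k = m then a m * (LINT z:shell s t|lborel. z ^ m * cnj z ^ m) else 0)"
      using shell_moment_zero[of k m s t] by auto
  qed
  finally have "(\<lambda>k. if k = m then a m * (LINT z:shell s t|lborel. z ^ m * cnj z ^ m) else 0) sums (\<integral>z. (\<Sum>k. F k z) \<partial>lborel)" .
  hence "(\<integral>z. (\<Sum>k. F k z) \<partial>lborel) = a m * (LINT z:shell s t|lborel. z ^ m * cnj z ^ m)"
    using sums_unique2 sums_single[of m "\<lambda>_. a m * (LINT z:shell s t|lborel. z ^ m * cnj z ^ m)"] by blast
  moreover have "(\<Sum>k. F k z) = indicator (shell s t) z *\<^sub>R (g z * cnj z ^ m)" for z
  proof (cases "z \<in> shell s t")
    case True
    hence "z \<in> udisc" using st by (auto simp: shell_def)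
    from sums_mult2[OF a[OF this], of "cnj z ^ m"] have "(\<lambda>k. F k z) sums (g z * cnj z ^ m)"
      using True by (simp add: F_def)
    thus ?thesis using True by (simp add: sums_unique[symmetric])
  qed (simp add: F_def)
  ultimately show ?thesis by (simp add: set_lebesgue_integral_def)
qed

text \<open>Pair \<open>g\<close> with \<open>cnj z ^ m\<close> for a nonzero Taylor coefficient
  \<open>a m\<close>. The pairing equals \<open>a m\<close> times the integral of
  \<open>norm z ^ (2 * m)\<close>, at least (1/4)^m times the area since \<open>s \<ge> 1/2\<close>.
  It is also at most the integral of \<open>norm (g z)\<close>, so one \<open>\<delta>\<close>
  serves all shells.\<close>

lemma shell_mean_lower_bound:
  assumes g: "g holomorphic_on udisc" and nz: "w \<in> udisc" "g w \<noteq> 0"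
  obtains \<delta> where "\<delta> > 0"
    "\<And>s t. 1/2 \<le> s \<Longrightarrow> s \<le> t \<Longrightarrow> t < 1 \<Longrightarrow> \<delta> * (t^2 - s^2) \<le> (LINT z:shell s t|lborel. norm (g z))"
proof -
  define a where "a k = (deriv ^^ k) g 0 / fact k" for k
  have a: "(\<lambda>k. a k * z ^ k) sums g z" if "z \<in> udisc" for z
    using holomorphic_power_series[OF g that] by (simp add: a_def)
  obtain m where m: "a m \<noteq> 0"
  proof (rule ccontr)
    assume "\<not> thesis"
    hence "a k = 0" for k using that by blast
    hence "g w = 0" using a[OF nz(1)] sums_unique2[OF _ sums_zero] by simp
    thus False using nz by simp
  qed
  show ?thesis
  proof (rule that)
    show "norm (a m) * (1/4) ^ m * pi > 0" using m by simp
    fix s t :: real assume st: "1/2 \<le> s" "s \<le> t" "t < 1"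
    have sub: "shell s t \<subseteq> udisc" using st by (auto simp: shell_def)
    have cg: "continuous_on (shell s t) g"
      by (rule continuous_on_subset[OF holomorphic_on_imp_continuous_on[OF g] sub])
    have fin: "emeasure lborel (shell s t) < \<infinity>" using st by (simp add: emeasure_shell)
    have "(1/4) ^ m * (pi * (t^2 - s^2)) = (LINT z:shell s t|lborel. (1/4) ^ m)"
    proof -
      have "s^2 \<le> t^2" using st by (intro power_mono) auto
      hence "measure lborel (shell s t) = pi * (t^2 - s^2)"
        using st by (simp add: measure_def emeasure_shell)
      thus ?thesis using fin by (simp add: set_lebesgue_integral_def)
    qed
    also have "... \<le> (LINT z:shell s t|lborel. norm z ^ (2 * m))"
    proof (intro set_integral_mono set_integrable_compact compact_shell)
      fix z assume "z \<in> shell s t"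
      hence "(1/2) ^ (2 * m) \<le> norm z ^ (2 * m)" using st by (intro power_mono) (auto simp: shell_def)
      thus "(1/4) ^ m \<le> norm z ^ (2 * m)" by (simp add: power_mult power2_eq_square)
    qed (intro continuous_intros)+
    also have "... = norm (LINT z:shell s t|lborel. z ^ m * cnj z ^ m)"
    proof -
      have e: "z ^ m * cnj z ^ m = of_real (norm z ^ (2 * m))" for z :: complex
      proof -
        have "complex_of_real (norm z ^ (2 * m)) = of_real ((norm z)^2) ^ m" by (simp add: power_mult)
        thus ?thesis by (simp only: complex_norm_square power_mult_distrib)
      qed
      have "(LINT z:shell s t|lborel. z ^ m * cnj z ^ m) = of_real (LINT z:shell s t|lborel. norm z ^ (2 * m))"
        unfolding e by (rule set_integral_complex_of_real)
      moreover have "(LINT z:shell s t|lborel. norm z ^ (2 * m)) \<ge> 0"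
        unfolding set_lebesgue_integral_def by (intro integral_nonneg_AE AE_I2) auto
      ultimately show ?thesis by simp
    qed
    finally have "norm (a m) * ((1/4) ^ m * (pi * (t^2 - s^2))) \<le> norm (a m) * norm (LINT z:shell s t|lborel. z ^ m * cnj z ^ m)"
      by (intro mult_left_mono) auto
    also have "... = norm (LINT z:shell s t|lborel. g z * cnj z ^ m)"
      using st by (subst shell_coefficient[OF a]) (auto simp: norm_mult)
    also have "... \<le> (LINT z:shell s t|lborel. norm (g z * cnj z ^ m))"
      by (intro set_integral_norm_bound set_integrable_compact compact_shell continuous_intros cg)
    also have "... \<le> (LINT z:shell s t|lborel. norm (g z))"
    proof (intro set_integral_mono set_integrable_compact compact_shell)
      fix z assume "z \<in> shell s t"
      hence "norm z ^ m \<le> 1" using st by (intro power_le_one) (auto simp: shell_def)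
      thus "norm (g z * cnj z ^ m) \<le> norm (g z)" by (simp add: norm_mult norm_power mult_right_le_one_le)
    qed (intro continuous_intros cg)+
    finally show "norm (a m) * (1/4) ^ m * pi * (t^2 - s^2) \<le> (LINT z:shell s t|lborel. norm (g z))"
      by (simp add: mult_ac)
  qed
qed

text \<open>On values in \<open>[0, M]\<close> one has \<open>x \<le> e + c * x powr q\<close>: for
  \<open>q \<ge> 1\<close> because values below \<open>e\<close> are covered by \<open>e\<close>,
  for \<open>q < 1\<close> because of the upper bound \<open>M\<close>. This carries the bound from
  the exponent 1 to \<open>q\<close>.\<close>

lemma shell_powr_mean_lower_bound:
  assumes g: "g \<in> Hinf" and nz: "w \<in> udisc" "g w \<noteq> 0" and q: "q > 0"
  obtains \<delta> where "\<delta> > 0"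
    "\<And>s t. 1/2 \<le> s \<Longrightarrow> s \<le> t \<Longrightarrow> t < 1 \<Longrightarrow>
      ennreal (\<delta> * (t^2 - s^2)) \<le> (\<integral>\<^sup>+z\<in>shell s t. ennreal (norm (g z) powr q) \<partial>lborel)"
proof -
  have hol: "g holomorphic_on udisc" using g by (simp add: Hinf_def)
  from HinfE[OF g] obtain M where M: "M > 0" "\<And>z. z \<in> udisc \<Longrightarrow> norm (g z) \<le> M" by metis
  from shell_mean_lower_bound[OF hol nz] obtain \<delta> where \<delta>: "\<delta> > 0"
    "\<And>s t. 1/2 \<le> s \<Longrightarrow> s \<le> t \<Longrightarrow> t < 1 \<Longrightarrow> \<delta> * (t^2 - s^2) \<le> (LINT z:shell s t|lborel. norm (g z))"
    by metis
  \<comment> \<open>The area of a shell is \<open>pi * (t^2 - s^2)\<close>, so the constant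
    \<open>e\<close> uses up exactly half of the lower bound for the mean.\<close>
  define e where "e = \<delta> / (2 * pi)"
  have e: "e > 0" using \<delta> by (simp add: e_def)
  obtain c where c: "c > 0" "\<And>x. 0 \<le> x \<Longrightarrow> x \<le> M \<Longrightarrow> x \<le> e + c * x powr q"
  proof (cases "q \<ge> 1")
    case True
    show ?thesis
    proof (rule that[of "e powr (1 - q)"])
      fix x assume x: "0 \<le> x" "x \<le> M"
      show "x \<le> e + e powr (1 - q) * x powr q"
      proof (cases "x \<le> e")
        case False
        hence "x = x powr (1 - q) * x powr q" using x e by (simp flip: powr_add)
        also have "... \<le> e powr (1 - q) * x powr q"
          using False e True by (intro mult_right_mono powr_mono2') auto
        finally show ?thesis using e by simp
      qed (simp add: add_increasing2)
    qed (use e in auto)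
  next
    case False
    show ?thesis
    proof (rule that[of "M powr (1 - q)"])
      fix x assume x: "0 \<le> x" "x \<le> M"
      have "x = x powr (1 - q) * x powr q" using x by (simp flip: powr_add)
      also have "... \<le> M powr (1 - q) * x powr q"
        using x False by (intro mult_right_mono powr_mono2) auto
      finally show "x \<le> e + M powr (1 - q) * x powr q" using e by simp
    qed (use M in auto)
  qed
  show ?thesis
  proof (rule that)
    show "\<delta> / (2 * c) > 0" using \<delta> c by simp
    fix s t :: real assume st: "1/2 \<le> s" "s \<le> t" "t < 1"
    have sub: "shell s t \<subseteq> udisc" using st by (auto simp: shell_def)
    have cg: "continuous_on (shell s t) g"
      by (rule continuous_on_subset[OF holomorphic_on_imp_continuous_on[OF hol] sub])
    have cgq: "continuous_on (shell s t) (\<lambda>z. norm (g z) powr q)"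
      using q cg by (intro continuous_on_powr' continuous_on_norm continuous_on_const) auto
    have ig: "set_integrable lborel (shell s t) (\<lambda>z. norm (g z))"
      and igq: "set_integrable lborel (shell s t) (\<lambda>z. norm (g z) powr q)"
      and ie: "set_integrable lborel (shell s t) (\<lambda>z. e)"
      by (intro set_integrable_compact compact_shell continuous_intros cg cgq)+
    have fin: "emeasure lborel (shell s t) < \<infinity>" using st by (simp add: emeasure_shell)
    have "s^2 \<le> t^2" using st by (intro power_mono) auto
    hence "measure lborel (shell s t) = pi * (t^2 - s^2)"
      using st by (simp add: measure_def emeasure_shell)
    hence e: "(LINT z:shell s t|lborel. e) = \<delta> / 2 * (t^2 - s^2)"
      using fin by (simp add: set_lebesgue_integral_def e_def)
    define I where "I = (LINT z:shell s t|lborel. norm (g z) powr q)"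
    have "\<delta> * (t^2 - s^2) \<le> (LINT z:shell s t|lborel. norm (g z))" using \<delta> st by simp
    also have "... \<le> (LINT z:shell s t|lborel. e + c * norm (g z) powr q)"
      using sub M c(2) ig ie igq
      by (intro set_integral_mono set_integral_add set_integrable_mult_right) auto
    also have "... = \<delta> / 2 * (t^2 - s^2) + c * I"
      unfolding e[symmetric] I_def using ie igq by (simp add: set_integral_add set_integrable_mult_right)
    finally have "\<delta> / (2 * c) * (t^2 - s^2) \<le> I" using c by (simp add: field_simps)
    hence "ennreal (\<delta> / (2 * c) * (t^2 - s^2)) \<le> ennreal I" by (rule ennreal_leI)
    also have "ennreal I = (\<integral>\<^sup>+z. ennreal (indicator (shell s t) z *\<^sub>R norm (g z) powr q) \<partial>lborel)"
      unfolding I_def set_lebesgue_integral_def using igq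
      by (intro nn_integral_eq_integral[symmetric]) (auto simp: set_integrable_def)
    also have "... = (\<integral>\<^sup>+z\<in>shell s t. ennreal (norm (g z) powr q) \<partial>lborel)"
      by (intro nn_integral_cong) (auto simp: indicator_def)
    finally show "ennreal (\<delta> / (2 * c) * (t^2 - s^2)) \<le> (\<integral>\<^sup>+z\<in>shell s t. ennreal (norm (g z) powr q) \<partial>lborel)" .
  qed
qed

section \<open>Lacunary series\<close>

lemma lacunary_sum_bound:
  fixes u :: "nat \<Rightarrow> real"
  assumes u0: "\<And>k. 0 \<le> u k" and u2: "\<And>k. 2 * u k \<le> u (Suc k)"
  shows "summable (\<lambda>k. u k / (1 + (u k)^2))" "(\<Sum>k. u k / (1 + (u k)^2)) \<le> 7 / 2"
proof -
  \<comment> \<open>\<open>u / (1 + u)\<close> is bounded and increases by a fixed fraction of the summand when \<open>u\<close> is doubled.\<close>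
  define F where "F x = x / (1 + x)" for x :: real
  have F_mono: "F x \<le> F y" if "0 \<le> x" "x \<le> y" for x y
    using that by (simp add: F_def field_simps)
  have step: "u k / (1 + (u k)^2) \<le> 7 / 2 * (F (u (Suc k)) - F (u k))" for k
  proof -
    define x where "x = u k"
    have x: "x \<ge> 0" using u0 by (simp add: x_def)
    \<comment> \<open>The difference of the two sides is 3/2 * (x - 1)^2 + 1.\<close>
    have "(1 + 2 * x) * (1 + x) \<le> 7 / 2 * (1 + x^2)"
      using zero_le_power2[of "x - 1"] by (simp add: power2_eq_square algebra_simps)
    hence "x / (7 / 2 * (1 + x^2)) \<le> x / ((1 + 2 * x) * (1 + x))"
      using x by (intro divide_left_mono mult_pos_pos) (auto simp: add_pos_nonneg)
    also have "... = F (2 * x) - F x" using x by (simp add: F_def field_simps)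
    also have "... \<le> F (u (Suc k)) - F x" using F_mono[of "2 * x" "u (Suc k)"] u2[of k] x by (simp add: x_def)
    also have "x / (7 / 2 * (1 + x^2)) = 2 / 7 * (x / (1 + x^2))" by simp
    finally have "2 / 7 * (x / (1 + x^2)) \<le> F (u (Suc k)) - F x" .
    moreover have "y \<le> 7 / 2 * w" if "2 / 7 * y \<le> w" for y w :: real using that by simp
    ultimately show ?thesis unfolding x_def by blast
  qed
  have part: "(\<Sum>k<n. u k / (1 + (u k)^2)) \<le> 7 / 2" for n
  proof -
    have "(\<Sum>k<n. u k / (1 + (u k)^2)) \<le> (\<Sum>k<n. 7 / 2 * (F (u (Suc k)) - F (u k)))"
      by (intro sum_mono step)
    also have "... = 7 / 2 * (F (u n) - F (u 0))"
      by (simp only: sum_distrib_left[symmetric] sum_lessThan_telescope[of "\<lambda>k. F (u k)"])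
    also have "... \<le> 7 / 2 * 1"
    proof (intro mult_left_mono)
      have "F (u n) \<le> 1" "F (u 0) \<ge> 0" using u0[of n] u0[of 0] by (auto simp: F_def field_simps)
      thus "F (u n) - F (u 0) \<le> 1" by simp
    qed simp
    finally show ?thesis by simp
  qed
  have nn: "0 \<le> u k / (1 + (u k)^2)" for k using u0 by simp
  show s: "summable (\<lambda>k. u k / (1 + (u k)^2))"
    using nn part by (intro summableI_nonneg_bounded[of _ "7 / 2"])
  show "(\<Sum>k. u k / (1 + (u k)^2)) \<le> 7 / 2"
    using s part by (intro suminf_le_const)
qed

text \<open>Profile of a lacunary term of the derivative in the scaled distance
  \<open>v = m * (1 - norm z)\<close>: of order \<open>v\<close> near 0 and \<open>1 / v\<close> at
  infinity.\<close>

abbreviation bump :: "real \<Rightarrow> real" where "bump v \<equiv> v / (1 + v)^2"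

text \<open>The bound is independent of \<open>m\<close> because \<open>dr / (1 - r)\<close> is
  invariant under scaling of \<open>1 - r\<close>. The integrand is compared with the derivative of
  \<open>v powr b / (1 + v powr b)\<close>, whose values lie in \<open>[0, 1]\<close>.\<close>

lemma nn_integral_bump_le:
  assumes m: "m > 0" and b: "b > 0"
  shows "disc_int (\<lambda>z. 1 / (1 - norm (z::complex)) * bump (m * (1 - norm z)) powr b)
    \<le> ennreal (8 * pi / b)"
proof -
  define F where "F v = v powr b / (1 + v powr b)" for v :: real
  define f where "f r = 8 * pi / b * (b / (1 - r) * (m * (1 - r)) powr b / (1 + (m * (1 - r)) powr b)^2)" for r
  have "disc_int (\<lambda>z. 1 / (1 - norm (z::complex)) * bump (m * (1 - norm z)) powr b)
     = (\<integral>\<^sup>+r\<in>{0<..<1}. ennreal (2 * pi * r) * ennreal (1 / (1 - r) * bump (m * (1 - r)) powr b) \<partial>lborel)"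
    by (intro nn_integral_radial[of "\<lambda>r. ennreal (1 / (1 - r) * bump (m * (1 - r)) powr b)"]) measurable
  also have "... \<le> (\<integral>\<^sup>+r\<in>{0<..<1}. ennreal (f r) \<partial>lborel)"
  proof (rule nn_integral_mono)
    fix r :: real
    show "ennreal (2 * pi * r) * ennreal (1 / (1 - r) * bump (m * (1 - r)) powr b) * indicator {0<..<1} r
      \<le> ennreal (f r) * indicator {0<..<1} r"
    proof (cases "0 < r \<and> r < 1")
      case True
      define v where "v = m * (1 - r)"
      have v: "v > 0" using True m by (simp add: v_def)
      \<comment> \<open>Both summands are at most \<open>(1 + v) powr b\<close>; squaring gives the
        4 that turns \<open>2 * pi\<close> into \<open>8 * pi\<close>.\<close>
      have "1 + v powr b \<le> (1 + v) powr b + (1 + v) powr b"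
        using v b by (intro add_mono ge_one_powr_ge_zero powr_mono2) auto
      hence "(1 + v powr b)^2 \<le> (2 * (1 + v) powr b)^2" by (intro power_mono) auto
      also have "... = 4 * ((1 + v) powr b)^2" by (simp add: power_mult_distrib)
      finally have le0: "(1 + v powr b)^2 \<le> 4 * ((1 + v) powr b)^2" .
      have le: "1 / ((1 + v) powr b)^2 \<le> 4 / (1 + v powr b)^2"
      proof -
        have "1 + v powr b > 0" by (smt (verit) powr_ge_zero)
        thus ?thesis using le0 v by (simp add: field_simps)
      qed
      have pw: "bump v powr b = v powr b * (1 / ((1 + v) powr b)^2)"
        using v by (simp add: powr_divide powr_mult power2_eq_square)
      have "2 * pi * r * (1 / (1 - r) * bump v powr b) \<le> 2 * pi * 1 * (1 / (1 - r) * bump v powr b)"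
        using True by (intro mult_right_mono mult_left_mono) auto
      also have "...
        \<le> 2 * pi * 1 * (1 / (1 - r) * (v powr b * (4 / (1 + v powr b)^2)))"
        unfolding pw using True le by (intro mult_left_mono) auto
      also have "... = f r" unfolding f_def v_def[symmetric] using b by simp
      finally have "ennreal (2 * pi * r * (1 / (1 - r) * bump v powr b)) \<le> ennreal (f r)" by (rule ennreal_leI)
      thus ?thesis using True by (simp add: v_def ennreal_mult'[symmetric])
    qed auto
  qed
  also have "... \<le> ennreal (8 * pi / b)"
  proof (rule nn_integral_Ioo_le[where F = "\<lambda>r. - (8 * pi / b) * F (m * (1 - r))"])
    show "f \<in> borel_measurable borel" unfolding f_def by measurable
  next
    fix r :: real assume r: "0 < r" "r < 1"
    define v where "v = m * (1 - r)"
    have v: "v > 0" using r m by (simp add: v_def)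
    have d1: "((\<lambda>v. v powr b) has_real_derivative b * v powr (b - 1)) (at v)"
      using v by (rule has_real_derivative_powr)
    have p: "1 + v powr b > 0" "1 + v powr b \<noteq> 0" by (smt (verit) powr_ge_zero)+
    have "(F has_real_derivative (b * v powr (b - 1) * (1 + v powr b) - v powr b * (b * v powr (b - 1))) / ((1 + v powr b) * (1 + v powr b))) (at v)"
      unfolding F_def using d1 p v by (auto intro!: derivative_eq_intros d1)
    also have "(b * v powr (b - 1) * (1 + v powr b) - v powr b * (b * v powr (b - 1))) / ((1 + v powr b) * (1 + v powr b))
      = b * v powr (b - 1) / (1 + v powr b)^2" by (simp add: power2_eq_square algebra_simps)
    finally have "(F has_real_derivative b * v powr (b - 1) / (1 + v powr b)^2) (at (m * (1 - r)))" by (simp add: v_def)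
    moreover have "((\<lambda>r. m * (1 - r)) has_real_derivative - m) (at r)" by (auto intro!: derivative_eq_intros)
    ultimately have "((\<lambda>r. F (m * (1 - r))) has_real_derivative b * v powr (b - 1) / (1 + v powr b)^2 * - m) (at r)"
      by (rule DERIV_chain2)
    hence "((\<lambda>r. - (8 * pi / b) * F (m * (1 - r))) has_real_derivative - (8 * pi / b) * (b * v powr (b - 1) / (1 + v powr b)^2 * - m)) (at r)"
      by (rule DERIV_cmult)
    moreover have "- (8 * pi / b) * (b * v powr (b - 1) / (1 + v powr b)^2 * - m) = f r"
    proof -
      have "v powr (b - 1) * m = v powr b / (1 - r)"
        using v r m by (simp add: powr_diff v_def)
      thus ?thesis unfolding f_def v_def[symmetric] using b p by (simp add: field_simps)
    qed
    ultimately show "((\<lambda>r. - (8 * pi / b) * F (m * (1 - r))) has_real_derivative f r) (at r)" by simp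
    show "0 \<le> f r" using r b by (simp add: f_def)
  next
    fix x y :: real
    have r: "0 \<le> F v" "F v \<le> 1" for v
    proof -
      have "0 < 1 + v powr b" using powr_ge_zero[of v b] by linarith
      thus "0 \<le> F v" "F v \<le> 1" by (auto simp: F_def divide_le_eq_1)
    qed
    have "8 * pi / b * (F (m * (1 - x)) - F (m * (1 - y))) \<le> 8 * pi / b * 1"
      using r(2)[of "m * (1 - x)"] r(1)[of "m * (1 - y)"] b by (intro mult_left_mono) auto
    thus "- (8 * pi / b) * F (m * (1 - y)) - - (8 * pi / b) * F (m * (1 - x)) \<le> 8 * pi / b"
      by (simp add: algebra_simps)
  qed auto
  finally show ?thesis .
qed

text \<open>Bernoulli's inequality for powers of \<open>1 / r\<close>, which is at least
  \<open>1 + (1 - r)\<close>.\<close>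

lemma power_le_inverse_linear:
  fixes r :: real
  assumes "0 \<le> r" "r < 1"
  shows "r ^ m \<le> 1 / (1 + real m * (1 - r))"
proof (cases "r = 0")
  case False
  hence r: "r > 0" using assms by simp
  have "r * (1 + (1 - r)) \<le> 1" using zero_le_power2[of "1 - r"] by (simp add: power2_eq_square algebra_simps)
  hence "1 + (1 - r) \<le> 1 / r" using r by (simp add: field_simps)
  hence "(1 + (1 - r)) ^ m \<le> (1 / r) ^ m" using assms by (intro power_mono) auto
  moreover have "1 + real m * (1 - r) \<le> (1 + (1 - r)) ^ m" using assms by (intro Bernoulli_inequality) auto
  ultimately have "1 + real m * (1 - r) \<le> 1 / r ^ m" by (simp add: power_one_over)
  moreover have "1 + real m * (1 - r) > 0" using assms by (intro add_pos_nonneg) auto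
  ultimately show ?thesis using r by (simp add: field_simps)
qed (cases m, auto)

section \<open>The lacunary test function\<close>

locale lacunary_series =
  fixes q :: real and m :: "nat \<Rightarrow> nat"
  assumes q: "q > 0" and m_pos: "\<And>k. 1 \<le> m k" and m_lacunary: "\<And>j k. j < k \<Longrightarrow> 4 * m j \<le> m k"
begin

text \<open>The derivative then has the even exponents \<open>2 * m k\<close>, so
  \<open>norm z ^ (2 * m k)\<close> is a square and is bounded by \<open>1 / (1 + v)^2\<close>, not
  only by \<open>1 / (1 + v)\<close>.\<close>

definition n :: "nat \<Rightarrow> nat" where "n k = 2 * m k + 1"

text \<open>The borderline choice: \<open>a k powr q\<close> is harmonic, while
  \<open>a k powr p\<close> is summable for every \<open>p > q\<close>.\<close>

definition a :: "nat \<Rightarrow> real" where "a k = (real k + 1) powr (- 1 / q)"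

definition f :: "complex \<Rightarrow> complex" where "f z = (\<Sum>k. of_real (a k) * z ^ n k)"

lemma a_pos: "0 < a k" by (simp add: a_def)

lemma a_antimono: "j \<le> k \<Longrightarrow> a k \<le> a j"
  unfolding a_def using q by (intro powr_mono2') auto

lemma a_le_1: "a k \<le> 1"
  using a_antimono[of 0 k] by (simp add: a_def)

lemma a_powr_q: "a k powr q = 1 / (real k + 1)"
  unfolding a_def powr_powr using q by (simp add: powr_minus_divide)

lemma k_le_n: "k \<le> n k"
proof (induction k)
  case (Suc k)
  thus ?case using m_lacunary[of k "Suc k"] m_pos[of k] by (simp add: n_def)
qed simp

lemma term_le: "norm (z :: complex) \<le> \<rho> \<Longrightarrow> \<rho> < 1 \<Longrightarrow> norm (of_real (a k) * z ^ n k) \<le> \<rho> ^ k"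
proof -
  assume z: "norm z \<le> \<rho>" "\<rho> < 1"
  have "norm (of_real (a k) * z ^ n k) \<le> 1 * norm z ^ n k"
    unfolding norm_mult norm_power using a_pos[of k] a_le_1[of k] by (intro mult_right_mono) auto
  also have "... \<le> norm z ^ k" using k_le_n[of k] z by (simp add: power_decreasing)
  also have "... \<le> \<rho> ^ k" using z by (intro power_mono) auto
  finally show ?thesis .
qed

lemma f_holomorphic: "f holomorphic_on udisc"
  and f_deriv_sums: "z \<in> udisc \<Longrightarrow> (\<lambda>k. of_real (a k * real (n k)) * z ^ (2 * m k)) sums deriv f z"
proof -
  have h1: "(\<lambda>z. of_real (a k) * z ^ n k) holomorphic_on udisc" for k by (intro holomorphic_intros)
  have h2: "\<exists>h. summable h \<and> (\<forall>k z. norm z \<le> \<rho> \<longrightarrow> norm (complex_of_real (a k) * z ^ n k) \<le> h k)"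
    if "0 \<le> \<rho>" "\<rho> < 1" for \<rho>
    using term_le that by (intro exI[of _ "\<lambda>k. \<rho> ^ k"]) (auto intro!: summable_geometric)
  have fe: "f = (\<lambda>z. \<Sum>k. of_real (a k) * z ^ n k)" by (simp add: f_def fun_eq_iff)
  note ser = holomorphic_series_disc[of "\<lambda>k z. of_real (a k) * z ^ n k", OF h1 h2, folded fe]
  show "f holomorphic_on udisc" by (rule ser(1))
  show "(\<lambda>k. of_real (a k * real (n k)) * z ^ (2 * m k)) sums deriv f z" if "z \<in> udisc"
  proof -
    have "deriv (\<lambda>z. of_real (a k) * z ^ n k) z = of_real (a k * real (n k)) * z ^ (2 * m k)" for k
      using DERIV_cmult[OF DERIV_power_Suc[OF DERIV_ident, of "2 * m k" z UNIV], of "of_real (a k)"]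
      by (intro DERIV_imp_deriv) (simp add: n_def mult_ac)
    thus ?thesis using ser(3)[OF _ _ that] by simp
  qed
qed

text \<open>The modulus of the k-th term of \<open>(1 - norm z) * deriv f z\<close>, without its
  coefficient \<open>a k\<close>.\<close>

definition x :: "nat \<Rightarrow> complex \<Rightarrow> real" where
  "x k z = real (n k) * norm z ^ (2 * m k) * (1 - norm z)"

lemma x_nonneg: "z \<in> udisc \<Longrightarrow> 0 \<le> x k z"
  by (simp add: x_def)

lemma x_le:
  assumes z: "z \<in> udisc"
  shows "x k z \<le> 3 * bump (real (m k) * (1 - norm z))" "x k z \<le> 1"
proof -
  define v where "v = real (m k) * (1 - norm z)"
  have v: "v \<ge> 0" using z by (simp add: v_def)
  have "norm z ^ (2 * m k) = (norm z ^ m k)^2" by (simp only: power_mult[symmetric] mult.commute)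
  also have "... \<le> (1 / (1 + v))^2"
    unfolding v_def using z by (intro power_mono power_le_inverse_linear) auto
  finally have 1: "norm z ^ (2 * m k) \<le> 1 / (1 + v)^2" by (simp add: power_divide)
  have "x k z = (real (n k) * (1 - norm z)) * norm z ^ (2 * m k)" by (simp add: x_def)
  also have "... \<le> (3 * v) * (1 / (1 + v)^2)"
  proof (rule mult_mono[OF _ 1])
    have "real (n k) \<le> 3 * real (m k)" using m_pos[of k] by (simp add: n_def)
    thus "real (n k) * (1 - norm z) \<le> 3 * v" unfolding v_def using z
      by (simp add: mult.assoc[symmetric] mult_right_mono)
  qed (use v in auto)
  finally have le: "x k z \<le> 3 * bump v" by simp
  thus "x k z \<le> 3 * bump (real (m k) * (1 - norm z))" by (simp add: v_def)
  have "3 * v \<le> (1 + v)^2" using zero_le_power2[of "v - 1"] v by (simp add: power2_eq_square algebra_simps)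
  hence "3 * bump v \<le> 1" using v by (simp add: field_simps)
  thus "x k z \<le> 1" using le by simp
qed

text \<open>The roots serve as weights in \<open>powr_suminf_le\<close>, so their total mass must be
  bounded uniformly in \<open>z\<close>. In terms of \<open>u = sqrt (m k * (1 - norm z))\<close>
  the root of \<open>bump\<close> is \<open>u / (1 + u^2)\<close>, the summand of
  \<open>lacunary_sum_bound\<close>.\<close>

lemma sqrt_x_summable:
  assumes z: "z \<in> udisc"
  shows "summable (\<lambda>k. sqrt (x k z))" "(\<Sum>k. sqrt (x k z)) \<le> 7"
proof -
  define u where "u k = sqrt (real (m k) * (1 - norm z))" for k
  \<comment> \<open>The factor 4 in \<open>m_lacunary\<close> is the square of the ratio 2 required
    by \<open>lacunary_sum_bound\<close>.\<close>
  have u2: "2 * u k \<le> u (Suc k)" for k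
  proof -
    have "2 * u k = sqrt (4 * (real (m k) * (1 - norm z)))" by (simp add: u_def real_sqrt_mult)
    also have "... \<le> u (Suc k)" unfolding u_def
    proof (rule real_sqrt_le_mono)
      have "4 * real (m k) \<le> real (m (Suc k))" using m_lacunary[of k "Suc k"] by simp
      hence "4 * real (m k) * (1 - norm z) \<le> real (m (Suc k)) * (1 - norm z)" using z by (intro mult_right_mono) auto
      thus "4 * (real (m k) * (1 - norm z)) \<le> real (m (Suc k)) * (1 - norm z)" by simp
    qed
    finally show ?thesis .
  qed
  have u0: "0 \<le> u k" for k using z by (simp add: u_def)
  note lac = lacunary_sum_bound[of u, OF u0 u2]
  have le: "sqrt (x k z) \<le> 2 * (u k / (1 + (u k)^2))" for k
  proof -
    have u: "(u k)^2 = real (m k) * (1 - norm z)" using z by (simp add: u_def)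
    have "x k z \<le> 3 * ((u k)^2 / (1 + (u k)^2)^2)" using x_le(1)[OF z, of k] unfolding u .
    also have "... \<le> 4 * ((u k)^2 / (1 + (u k)^2)^2)" by (intro mult_right_mono) auto
    also have "... = (2 * (u k / (1 + (u k)^2)))^2" by (simp add: power_mult_distrib power_divide)
    finally have "sqrt (x k z) \<le> sqrt ((2 * (u k / (1 + (u k)^2)))^2)" by (rule real_sqrt_le_mono)
    thus ?thesis using u0[of k] by simp
  qed
  show s: "summable (\<lambda>k. sqrt (x k z))"
    using le x_nonneg[OF z] by (intro summable_comparison_test'[OF summable_mult[OF lac(1), of 2], of 0]) auto
  have "(\<Sum>k. sqrt (x k z)) \<le> (\<Sum>k. 2 * (u k / (1 + (u k)^2)))"
    using le s lac(1) by (intro suminf_le summable_mult) auto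
  also have "... = 2 * (\<Sum>k. u k / (1 + (u k)^2))" using lac(1) by (rule suminf_mult)
  also have "... \<le> 7" using lac(2) by simp
  finally show "(\<Sum>k. sqrt (x k z)) \<le> 7" .
qed

text \<open>The split of \<open>a k * x k z\<close> into two roots fits
  \<open>powr_suminf_le\<close>: one root is the weight, the other is kept for the integration in
  \<open>f_Dspace\<close>.\<close>

lemma deriv_f_le:
  assumes z: "z \<in> udisc"
  shows "summable (\<lambda>k. sqrt (x k z) * (a k * sqrt (x k z)))"
    "(1 - norm z) * norm (deriv f z) \<le> (\<Sum>k. sqrt (x k z) * (a k * sqrt (x k z)))"
    "(1 - norm z) * norm (deriv f z) \<le> 7"
proof -
  have ax: "sqrt (x k z) * (a k * sqrt (x k z)) = a k * x k z" for k
    using x_nonneg[OF z, of k] by simp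
  have le: "a k * x k z \<le> sqrt (x k z)" for k
  proof -
    have "a k * x k z \<le> 1 * x k z"
      using a_le_1[of k] x_nonneg[OF z, of k] by (intro mult_right_mono) auto
    also have "x k z \<le> sqrt (x k z)"
      using x_le(2)[OF z, of k] x_nonneg[OF z, of k]
      by (intro real_le_rsqrt) (simp add: power2_eq_square mult_left_le)
    finally show ?thesis by simp
  qed
  show s: "summable (\<lambda>k. sqrt (x k z) * (a k * sqrt (x k z)))" unfolding ax
    using le x_nonneg[OF z] a_pos by (intro summable_comparison_test'[OF sqrt_x_summable(1)[OF z], of 0]) (auto simp: less_imp_le)
  have nt: "norm (of_real (a k * real (n k)) * z ^ (2 * m k)) = a k * (real (n k) * norm z ^ (2 * m k))" for k
    using a_pos[of k] by (simp add: norm_mult norm_power)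
  have "(1 - norm z) * norm (deriv f z) = norm (\<Sum>k. of_real (1 - norm z) * (of_real (a k * real (n k)) * z ^ (2 * m k)))"
  proof -
    have "(\<lambda>k. of_real (1 - norm z) * (of_real (a k * real (n k)) * z ^ (2 * m k))) sums (of_real (1 - norm z) * deriv f z)"
      by (intro sums_mult f_deriv_sums z)
    from sums_unique[OF this, symmetric] show ?thesis using z unfolding norm_mult norm_of_real by (simp add: norm_mult del: of_real_diff)
  qed
  also have "... \<le> (\<Sum>k. norm (of_real (1 - norm z) * (of_real (a k * real (n k)) * z ^ (2 * m k))))"
  proof (rule summable_norm)
    have "norm (of_real (1 - norm z) * (of_real (a k * real (n k)) * z ^ (2 * m k))) = sqrt (x k z) * (a k * sqrt (x k z))" for k
      unfolding norm_mult[of "of_real (1 - norm z)"] nt ax using z by (simp add: x_def norm_of_real del: of_real_diff)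
    thus "summable (\<lambda>k. norm (of_real (1 - norm z) * (of_real (a k * real (n k)) * z ^ (2 * m k))))" using s by simp
  qed
  also have "... = (\<Sum>k. sqrt (x k z) * (a k * sqrt (x k z)))"
    unfolding norm_mult[of "of_real (1 - norm z)"] nt ax using z by (simp add: x_def norm_of_real mult_ac del: of_real_diff)
  finally show le': "(1 - norm z) * norm (deriv f z) \<le> (\<Sum>k. sqrt (x k z) * (a k * sqrt (x k z)))" .
  also have "... \<le> (\<Sum>k. sqrt (x k z))"
    using s le sqrt_x_summable(1)[OF z] unfolding ax by (intro suminf_le)
  also have "... \<le> 7" by (rule sqrt_x_summable(2)[OF z])
  finally show "(1 - norm z) * norm (deriv f z) \<le> 7" .
qed

lemma f_Bloch: "f \<in> Bloch"
proof -
  have "bnorm z (deriv f z) \<le> 14" if z: "z \<in> udisc" for z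
  proof -
    have "bnorm z (deriv f z) = (1 + norm z) * ((1 - norm z) * norm (deriv f z))"
      by (simp add: power2_eq_square algebra_simps)
    also have "... \<le> 2 * 7" using z by (intro mult_mono deriv_f_le) auto
    finally show ?thesis by simp
  qed
  thus ?thesis using f_holomorphic unfolding Bloch_def by blast
qed

lemma a_powr_summable: "p > q \<Longrightarrow> summable (\<lambda>k. a k powr p)"
proof -
  assume p: "p > q"
  have "- (p / q) < -1" using p q by simp
  hence "summable (\<lambda>k. real k powr (- (p / q)))" by (simp add: summable_real_powr_iff)
  hence "summable (\<lambda>k. real (Suc k) powr (- (p / q)))" by (subst summable_Suc_iff)
  also have "(\<lambda>k. real (Suc k) powr (- (p / q))) = (\<lambda>k. a k powr p)"
    by (simp add: a_def powr_powr add.commute)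
  finally show ?thesis .
qed

text \<open>\<open>powr_suminf_le\<close> moves the p-th power onto the single terms for every
  \<open>p > 0\<close>. The integrals of the resulting bumps are bounded independently of
  \<open>k\<close>, so only the sum of \<open>a k powr p\<close> has to converge.\<close>

lemma f_Dspace:
  assumes p: "p > q"
  shows "f \<in> Dspace p"
proof -
  have p0: "p > 0" using p q by simp
  define b where "b = p / 2"
  have b: "b > 0" using p0 by (simp add: b_def)
  define y where "y k z = 1 / (1 - norm z) * bump (real (m k) * (1 - norm z)) powr b"
    for k and z :: complex
  have ym: "(\<lambda>z. ennreal (y k z) * indicator udisc z) \<in> borel_measurable lborel" for k
    unfolding y_def by (intro borel_measurable_times_ennreal borel_measurable_indicator) auto
  have pt: "ennreal (wnorm p z (deriv f z))
    \<le> ennreal (7 powr p * 3 powr b) * (\<Sum>k. ennreal (a k powr p) * ennreal (y k z))" if z: "z \<in> udisc" for z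
  proof -
    have s: "1 - norm z > 0" using z by simp
    have "wnorm p z (deriv f z) = 1 / (1 - norm z) * ((1 - norm z) * norm (deriv f z)) powr p"
      using s by (simp add: powr_diff powr_mult)
    also have "... \<le> 1 / (1 - norm z) * (\<Sum>k. sqrt (x k z) * (a k * sqrt (x k z))) powr p"
      using s p0 deriv_f_le(2)[OF z] by (intro mult_left_mono powr_mono2) auto
    finally have "ennreal (wnorm p z (deriv f z))
      \<le> ennreal (1 / (1 - norm z)) * ennreal ((\<Sum>k. sqrt (x k z) * (a k * sqrt (x k z))) powr p)"
      using s by (simp add: ennreal_mult'[symmetric] ennreal_leI)
    also have "... \<le> ennreal (1 / (1 - norm z)) * (ennreal (7 powr p) * (\<Sum>k. ennreal ((a k * sqrt (x k z)) powr p)))"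
      using z p0 a_pos x_nonneg[OF z] sqrt_x_summable[OF z] deriv_f_le(1)[OF z]
      by (intro mult_left_mono powr_suminf_le) (auto simp: less_imp_le)
    also have "... = ennreal (7 powr p) * (\<Sum>k. ennreal (1 / (1 - norm z)) * ennreal ((a k * sqrt (x k z)) powr p))"
      by (simp add: ac_simps)
    also have "... \<le> ennreal (7 powr p) * (\<Sum>k. ennreal (3 powr b) * (ennreal (a k powr p) * ennreal (y k z)))"
    proof (intro mult_left_mono suminf_le)
      fix k
      have "(a k * sqrt (x k z)) powr p = a k powr p * x k z powr b"
        using a_pos[of k] x_nonneg[OF z, of k] by (simp add: powr_mult powr_half_sqrt[symmetric] powr_powr b_def)
      also have "... \<le> a k powr p * (3 * bump (real (m k) * (1 - norm z))) powr b"
        using x_le(1)[OF z, of k] x_nonneg[OF z, of k] b by (intro mult_left_mono powr_mono2) auto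
      also have "(3 * bump (real (m k) * (1 - norm z))) powr b
         = 3 powr b * bump (real (m k) * (1 - norm z)) powr b" by (rule powr_mult)
      finally have "1 / (1 - norm z) * (a k * sqrt (x k z)) powr p \<le> 1 / (1 - norm z) *
        (a k powr p * (3 powr b * bump (real (m k) * (1 - norm z)) powr b))"
        using s by (intro mult_left_mono) auto
      also have "... = 3 powr b * (a k powr p * y k z)" by (simp add: y_def)
      finally show "ennreal (1 / (1 - norm z)) * ennreal ((a k * sqrt (x k z)) powr p)
        \<le> ennreal (3 powr b) * (ennreal (a k powr p) * ennreal (y k z))"
        using s by (simp add: ennreal_mult'[symmetric] ennreal_leI)
    qed auto
    finally show ?thesis by (simp add: ennreal_mult' mult.assoc)
  qed
  have "disc_int (\<lambda>z. wnorm p z (deriv f z))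
    \<le> (\<integral>\<^sup>+z. ennreal (7 powr p * 3 powr b) * (\<Sum>k. ennreal (a k powr p) * (ennreal (y k z) * indicator udisc z)) \<partial>lborel)"
    using pt by (intro nn_integral_mono) (auto simp: indicator_def)
  also have "... = ennreal (7 powr p * 3 powr b) * (\<Sum>k. ennreal (a k powr p) * disc_int (y k))"
    using ym by (simp add: nn_integral_cmult nn_integral_suminf)
  also have "... \<le> ennreal (7 powr p * 3 powr b) * (\<Sum>k. ennreal (a k powr p) * ennreal (8 * pi / b))"
    unfolding y_def using m_pos b
    by (intro mult_left_mono suminf_le nn_integral_bump_le) (auto simp: Suc_le_eq)
  also have "(\<Sum>k. ennreal (a k powr p) * ennreal (8 * pi / b)) = ennreal (\<Sum>k. a k powr p * (8 * pi / b))"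
  proof -
    have "(\<Sum>k. ennreal (a k powr p) * ennreal (8 * pi / b)) = (\<Sum>k. ennreal (a k powr p * (8 * pi / b)))"
      by (intro suminf_cong ennreal_mult'[symmetric]) simp
    also have "... = ennreal (\<Sum>k. a k powr p * (8 * pi / b))"
      using a_powr_summable[OF p] b by (intro suminf_ennreal2 summable_mult2) auto
    finally show ?thesis .
  qed
  also have "ennreal (7 powr p * 3 powr b) * ... < \<infinity>" by (simp add: ennreal_mult_less_top)
  finally have "set_integrable lborel udisc (\<lambda>z. wnorm p z (deriv f z))"
    using p0 by (subst set_integrable_disc_iff) (auto intro!: continuous_on_weighted continuous_on_deriv_disc f_holomorphic)
  thus ?thesis using Dspace_iff[OF p0] f_holomorphic by simp
qed

text \<open>On this shell the k-th term of the derivative has modulus at least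
  \<open>a k * n k / 2\<close>, while the sum of the earlier terms and the sum of the later terms
  are each at most \<open>a k * n k / 8\<close>.\<close>

lemma deriv_f_lower_bound:
  assumes early: "\<And>k. (\<Sum>j<k. real (n j)) \<le> a k * real (n k) / 8"
    and late: "\<And>i k. i < k \<Longrightarrow> real (n k) * (1 - 1 / (4 * real (n i))) ^ (2 * m k) \<le> (1/2) ^ k / 16"
    and z: "1 - 1 / (2 * real (n k)) \<le> norm z" "norm z \<le> 1 - 1 / (4 * real (n k))"
  shows "a k * real (n k) / 4 \<le> norm (deriv f z)"
proof -
  have n1: "real (n j) \<ge> 1" for j by (simp add: n_def)
  have "1 / (4 * real (n k)) > 0" using n1[of k] by simp
  hence "norm z < 1" using z(2) by linarith
  hence zd: "z \<in> udisc" by simp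
  define T where "T j = of_real (a j * real (n j)) * z ^ (2 * m j)" for j
  have nT: "norm (T j) = a j * real (n j) * norm z ^ (2 * m j)" for j
    using a_pos[of j] by (simp add: T_def norm_mult norm_power)
  have sums: "T sums deriv f z" unfolding T_def by (rule f_deriv_sums[OF zd])
  have late': "norm (T (j + Suc k)) \<le> a k / 16 * (1/2) ^ j" for j
  proof -
    have "norm (T (j + Suc k)) \<le> a k * (real (n (j + Suc k)) * (1 - 1 / (4 * real (n k))) ^ (2 * m (j + Suc k)))"
      unfolding nT mult.assoc using z a_antimono[of k "j + Suc k"] a_pos[of k]
      by (intro mult_mono mult_left_mono power_mono) auto
    also have "... \<le> a k * ((1/2) ^ (j + Suc k) / 16)"
      using a_pos[of k] by (intro mult_left_mono late) auto
    also have "... \<le> a k * ((1/2) ^ j / 16)"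
      using a_pos[of k] by (intro mult_left_mono divide_right_mono power_decreasing) auto
    finally show ?thesis by simp
  qed
  have sT: "summable (\<lambda>j. norm (T (j + Suc k)))"
    using late' by (intro summable_comparison_test'[OF summable_mult[OF summable_geometric[of "1/2::real"], of "a k / 16"], of 0]) auto
  have "(\<lambda>j. T (j + Suc k)) sums (deriv f z - (\<Sum>j<Suc k. T j))"
    using sums by (rule sums_split_initial_segment)
  hence tail: "deriv f z - (\<Sum>j<Suc k. T j) = (\<Sum>j. T (j + Suc k))" by (rule sums_unique)
  have "norm (\<Sum>j. T (j + Suc k)) \<le> (\<Sum>j. norm (T (j + Suc k)))" by (rule summable_norm[OF sT])
  also have "... \<le> (\<Sum>j. a k / 16 * (1/2) ^ j)"
    using late' sT by (intro suminf_le summable_mult summable_geometric) auto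
  also have "... = a k / 8" by (subst suminf_mult) (auto simp: suminf_geometric)
  also have "... \<le> a k * real (n k) / 8" using n1[of k] a_pos[of k] by (simp add: mult_le_cancel_left1)
  finally have t1: "norm (\<Sum>j. T (j + Suc k)) \<le> a k * real (n k) / 8" .
  have t2: "norm (\<Sum>j<k. T j) \<le> a k * real (n k) / 8"
  proof -
    have "norm (\<Sum>j<k. T j) \<le> (\<Sum>j<k. norm (T j))" by (rule norm_sum)
    also have "... \<le> (\<Sum>j<k. real (n j))"
    proof (rule sum_mono)
      fix j
      have "norm (T j) \<le> 1 * real (n j) * 1"
        unfolding nT using a_le_1[of j] a_pos[of j] zd by (intro mult_mono power_le_one) auto
      thus "norm (T j) \<le> real (n j)" by simp
    qed
    also have "... \<le> a k * real (n k) / 8" by (rule early)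
    finally show ?thesis .
  qed
  have t3: "a k * real (n k) / 2 \<le> norm (T k)"
  proof -
    \<comment> \<open>Bernoulli's inequality loses \<open>m k / n k\<close>, which is below 1/2
      because \<open>n k = 2 * m k + 1\<close>.\<close>
    have "1 / 2 \<le> 1 + real (2 * m k) * (- (1 / (2 * real (n k))))"
      by (simp add: n_def field_simps)
    also have "... \<le> (1 + (- (1 / (2 * real (n k))))) ^ (2 * m k)"
      using n1[of k] by (intro Bernoulli_inequality) (auto simp: field_simps)
    also have "... \<le> norm z ^ (2 * m k)" using z n1[of k] by (intro power_mono) (auto simp: field_simps)
    finally have "a k * real (n k) * (1 / 2) \<le> norm (T k)"
      unfolding nT using a_pos[of k] by (intro mult_left_mono) auto
    thus ?thesis by simp
  qed
  have "T k = deriv f z - (\<Sum>j. T (j + Suc k)) - (\<Sum>j<k. T j)" using tail by (simp add: algebra_simps)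
  hence "norm (T k) \<le> norm (deriv f z) + norm (\<Sum>j. T (j + Suc k)) + norm (\<Sum>j<k. T j)"
    using norm_triangle_ineq4[of "deriv f z - (\<Sum>j. T (j + Suc k))" "\<Sum>j<k. T j"]
      norm_triangle_ineq4[of "deriv f z" "\<Sum>j. T (j + Suc k)"] by simp
  thus ?thesis using t1 t2 t3 by linarith
qed

end

section \<open>Multipliers for \<open>q < p\<close>: exponents adapted to the multiplier\<close>

text \<open>Dominated convergence. With the \<open>Dspace q\<close> density of a multiplier as
  \<open>W\<close>, it allows the exponents of the lacunary series to be so large that the k-th term
  of \<open>f * deriv g\<close> has as small an integral as desired.\<close>

lemma power_weight_tail:
  fixes W :: "complex \<Rightarrow> real"
  assumes c: "continuous_on udisc W" and W: "\<And>z. z \<in> udisc \<Longrightarrow> 0 \<le> W z" and int: "set_integrable lborel udisc W"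
    and q: "q > 0" and e: "e > 0"
  shows "eventually (\<lambda>N. disc_int (\<lambda>z. W z * (norm z ^ N) powr q) \<le> ennreal e) sequentially"
proof -
  define w where "w z = ennreal (W z) * indicator udisc z" for z
  have [measurable]: "w \<in> borel_measurable lborel"
    using set_nn_integral_disc_measurable[OF c W] by (simp add: w_def[abs_def])
  have "(\<lambda>N. \<integral>\<^sup>+z. w z * ennreal ((norm z ^ N) powr q) \<partial>lborel) \<longlonglongrightarrow> (\<integral>\<^sup>+z. 0 \<partial>(lborel :: complex measure))"
  proof (rule nn_integral_dominated_convergence[where w = w])
    show "AE z in lborel. w z * ennreal ((norm z ^ N) powr q) \<le> w z" for N
    proof (rule AE_I2)
      fix z :: complex
      show "w z * ennreal ((norm z ^ N) powr q) \<le> w z"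
      proof (cases "z \<in> udisc")
        case True
        hence "norm z ^ N \<le> 1" by (intro power_le_one) auto
        hence "(norm z ^ N) powr q \<le> 1" using q by (intro powr_le1) auto
        hence "ennreal ((norm z ^ N) powr q) \<le> ennreal 1" by (rule ennreal_leI)
        hence "w z * ennreal ((norm z ^ N) powr q) \<le> w z * ennreal 1" by (intro mult_left_mono) auto
        thus ?thesis by simp
      qed (simp add: w_def)
    qed
    show "(\<integral>\<^sup>+z. w z \<partial>lborel) < \<infinity>" unfolding w_def using int set_integrable_disc_iff[OF c W] by simp
    show "AE z in lborel. (\<lambda>N. w z * ennreal ((norm z ^ N) powr q)) \<longlonglongrightarrow> 0"
    proof (rule AE_I2)
      fix z :: complex
      show "(\<lambda>N. w z * ennreal ((norm z ^ N) powr q)) \<longlonglongrightarrow> 0"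
      proof (cases "z \<in> udisc")
        case True
        have "(\<lambda>N. norm z ^ N) \<longlonglongrightarrow> 0" using True by (intro LIMSEQ_power_zero) auto
        hence "(\<lambda>N. (norm z ^ N) powr q) \<longlonglongrightarrow> 0 powr q"
          using q by (intro tendsto_powr') auto
        hence "(\<lambda>N. W z * (norm z ^ N) powr q) \<longlonglongrightarrow> W z * 0" using q by (intro tendsto_mult tendsto_const) auto
        hence "(\<lambda>N. ennreal (W z * (norm z ^ N) powr q)) \<longlonglongrightarrow> ennreal 0"
          by (intro tendsto_ennrealI) auto
        thus ?thesis using True W by (simp add: w_def ennreal_mult)
      qed (simp add: w_def)
    qed
  qed auto
  hence "(\<lambda>N. \<integral>\<^sup>+z. w z * ennreal ((norm z ^ N) powr q) \<partial>lborel) \<longlonglongrightarrow> 0" by simp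
  hence "eventually (\<lambda>N. (\<integral>\<^sup>+z. w z * ennreal ((norm z ^ N) powr q) \<partial>lborel) < ennreal e) sequentially"
    using e by (intro order_tendstoD(2)) auto
  thus ?thesis
  proof eventually_elim
    case (elim N)
    have "disc_int (\<lambda>z. W z * (norm z ^ N) powr q) = (\<integral>\<^sup>+z. w z * ennreal ((norm z ^ N) powr q) \<partial>lborel)"
      using W by (intro nn_integral_cong) (auto simp: w_def indicator_def ennreal_mult)
    thus ?case using elim by simp
  qed
qed

text \<open>Given the earlier values, each requirement holds for all large \<open>m k\<close>, so
  the sequence is chosen recursively. The predicate \<open>T\<close> carries the dependence on the
  multiplier; the last two requirements become \<open>early\<close> and \<open>late\<close> in
  \<open>deriv_f_lower_bound\<close>.\<close>

lemma exists_sparse_sequence: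
  fixes T :: "nat \<Rightarrow> nat \<Rightarrow> bool"
  assumes T: "\<And>k. eventually (T k) sequentially" and c: "\<And>k. c k > (0::real)"
  shows "\<exists>m :: nat \<Rightarrow> nat. \<forall>k. 1 \<le> m k \<and> (\<forall>j<k. 4 * m j \<le> m k) \<and> T k (m k) \<and>
    (\<Sum>j<k. real (2 * m j + 1)) \<le> c k * real (2 * m k + 1) / 8 \<and>
    (\<forall>i<k. real (2 * m k + 1) * (1 - 1 / (4 * real (2 * m i + 1))) ^ (2 * m k) \<le> (1/2) ^ k / 16)"
proof -
  define P where "P m k r \<longleftrightarrow> 1 \<le> r \<and> (\<forall>j<k. 4 * m j \<le> r) \<and> T k r \<and>
    (\<Sum>j<k. real (2 * m j + 1)) \<le> c k * real (2 * r + 1) / 8 \<and>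
    (\<forall>i<k. real (2 * r + 1) * (1 - 1 / (4 * real (2 * m i + 1))) ^ (2 * r) \<le> (1/2) ^ k / 16)" for m k r
  have "\<exists>m. \<forall>k. P m k (m k)"
  proof (rule dependent_wf_choice[OF wf_less])
    fix f g :: "nat \<Rightarrow> nat" and k r
    assume eq: "\<And>z. (z, k) \<in> {(x, y). x < y} \<Longrightarrow> f z = g z"
    hence "(\<Sum>j<k. real (2 * f j + 1)) = (\<Sum>j<k. real (2 * g j + 1))" by (intro sum.cong) auto
    thus "P f k r = P g k r" using eq by (simp add: P_def)
  next
    fix k and m :: "nat \<Rightarrow> nat"
    have e1: "eventually (\<lambda>r. 1 \<le> r) sequentially" by (rule eventually_ge_at_top)
    have e2: "eventually (\<lambda>r. \<forall>j\<in>{..<k}. 4 * m j \<le> r) sequentially"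
      by (intro eventually_ball_finite) (auto intro: eventually_ge_at_top)
    have e3: "eventually (\<lambda>r. (\<Sum>j<k. real (2 * m j + 1)) \<le> c k * real (2 * r + 1) / 8) sequentially"
    proof -
      have "filterlim (\<lambda>r::nat. c k * real (2 * r + 1) / 8) at_top sequentially"
        using c[of k] by real_asymp
      thus ?thesis by (simp add: filterlim_at_top)
    qed
    have e4: "eventually (\<lambda>r. real (2 * r + 1) * (1 - 1 / (4 * real (2 * m i + 1))) ^ (2 * r) \<le> (1/2) ^ k / 16) sequentially" for i
    proof -
      define \<rho> where "\<rho> = 1 - 1 / (4 * real (2 * m i + 1))"
      have \<rho>: "0 < \<rho>" "\<rho> < 1" by (auto simp: \<rho>_def field_simps)
      hence \<rho>2: "0 < \<rho>^2" "\<rho>^2 < 1" by (auto simp: power_less_one_iff)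
      have "(\<lambda>r. 2 * (real r * (\<rho>^2) ^ r) + (\<rho>^2) ^ r) \<longlonglongrightarrow> 2 * 0 + 0"
        using \<rho>2 powser_times_n_limit_0[of "\<rho>^2"] by (intro tendsto_intros LIMSEQ_power_zero) auto
      also have "(\<lambda>r. 2 * (real r * (\<rho>^2) ^ r) + (\<rho>^2) ^ r) = (\<lambda>r. real (2 * r + 1) * \<rho> ^ (2 * r))"
        unfolding power_mult by (simp add: algebra_simps)
      finally have lim: "(\<lambda>r. real (2 * r + 1) * \<rho> ^ (2 * r)) \<longlonglongrightarrow> 0" by simp
      have "eventually (\<lambda>r. real (2 * r + 1) * \<rho> ^ (2 * r) < (1/2) ^ k / 16) sequentially"
        by (rule order_tendstoD(2)[OF lim]) simp
      thus ?thesis unfolding \<rho>_def by eventually_elim simp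
    qed
    hence e4': "eventually (\<lambda>r. \<forall>i\<in>{..<k}. real (2 * r + 1) * (1 - 1 / (4 * real (2 * m i + 1))) ^ (2 * r) \<le> (1/2) ^ k / 16) sequentially"
      by (intro eventually_ball_finite) auto
    have "eventually (P m k) sequentially"
      using e1 e2 T[of k] e3 e4' by eventually_elim (simp add: P_def)
    thus "\<exists>r. P m k r" by (auto simp: eventually_sequentially)
  qed
  thus ?thesis unfolding P_def .
qed

lemma const_Dspace_Bloch: "(\<lambda>z. c) \<in> Bloch" "p > 0 \<Longrightarrow> (\<lambda>z. c) \<in> Dspace p"
  by (auto simp: Bloch_def Dspace_iff set_integrable_def)

text \<open>On the shell \<open>s * N\<close> stays in \<open>[1/4, 1]\<close>, so
  \<open>s powr (q - 1)\<close> is at least \<open>(1/4) powr q * N powr (1 - q)\<close> for either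
  sign of \<open>q - 1\<close>. A second \<open>(1/4) powr q\<close> comes from
  \<open>b * N / 4\<close>, and together they give 1/16.\<close>

lemma shell_weight_lower_bound:
  fixes s N q :: real
  assumes q: "q > 0" and N: "N \<ge> 1" and s: "1 / (4 * N) \<le> s" "s \<le> 1 / (2 * N)"
    and b: "b \<ge> 0" and d: "b * N / 4 \<le> d"
  shows "(1/16) powr q * (b powr q * N) \<le> s powr (q - 1) * d powr q"
proof -
  have sN: "1 / 4 \<le> s * N" "s * N \<le> 1" using s N by (auto simp: field_simps)
  have s0: "s > 0" using s N by (smt (verit) divide_pos_pos)
  have 1: "(1/4) powr q \<le> (s * N) powr (q - 1)"
  proof (cases "q \<ge> 1")
    case True
    have "(1/4) powr q \<le> (1/4::real) powr (q - 1)" by (intro powr_mono') auto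
    also have "... \<le> (s * N) powr (q - 1)" using sN True by (intro powr_mono2) auto
    finally show ?thesis .
  next
    case False
    have "(1/4::real) powr q \<le> 1" using q by (intro powr_le1) auto
    also have "1 = 1 powr (q - 1)" by simp
    also have "... \<le> (s * N) powr (q - 1)" using sN False by (intro powr_mono2') auto
    finally show ?thesis .
  qed
  have "(1/16) powr q * (b powr q * N) = ((1/4) powr q * N powr (1 - q)) * (b * N / 4) powr q"
  proof -
    have "(b * N / 4) powr q = b powr q * N powr q * (1/4) powr q"
      using b N by (simp add: powr_mult powr_divide)
    moreover have "(1/16::real) powr q = (1/4) powr q * (1/4) powr q" by (simp flip: powr_mult)
    moreover have "N = N powr (1 - q) * N powr q" using N by (simp flip: powr_add)
    ultimately show ?thesis by (simp add: mult_ac)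
  qed
  also have "... \<le> ((s * N) powr (q - 1) * N powr (1 - q)) * d powr q"
    using q d b N by (intro mult_mono[OF mult_right_mono[OF 1]] powr_mono2) auto
  also have "(s * N) powr (q - 1) * N powr (1 - q) = s powr (q - 1)"
  proof -
    have "(s * N) powr (q - 1) * N powr (1 - q) = s powr (q - 1) * (N powr (q - 1) * N powr (1 - q))"
      using s0 N by (simp add: powr_mult)
    also have "N powr (q - 1) * N powr (1 - q) = 1" using N by (simp flip: powr_add)
    finally show ?thesis by simp
  qed
  finally show ?thesis .
qed

text \<open>Two preliminary tests prepare the choice of \<open>f\<close>. The constant 1 puts
  \<open>g\<close> into \<open>Dspace q\<close>, so that its density can be the weight in
  \<open>power_weight_tail\<close>. The kernels, which lie in \<open>Dspace p\<close> for every
  \<open>p > 0\<close>, make \<open>g\<close> bounded, as \<open>shell_powr_mean_lower_bound\<close>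
  requires.\<close>

lemma multiplier_eq_zero:
  assumes q: "0 < q" and p: "q < p" and g: "g \<in> multipliers (Dspace p \<inter> Bloch) (Dspace q \<inter> Bloch)"
    and w: "w \<in> udisc"
  shows "g w = 0"
proof (rule ccontr)
  assume nz: "g w \<noteq> 0"
  have hol: "g holomorphic_on udisc" and mult: "\<And>f. f \<in> Dspace p \<Longrightarrow> f \<in> Bloch \<Longrightarrow> (\<lambda>z. f z * g z) \<in> Dspace q"
    using g by (auto simp: multipliers_def)
  have p0: "p > 0" using p q by simp
  have H: "g \<in> Hinf"
    using multiplier_Bloch_log_Hinf[OF hol] g p0 by (auto simp: multipliers_def)
  have gD: "g \<in> Dspace q" using mult[OF const_Dspace_Bloch(2)[OF p0] const_Dspace_Bloch(1), of 1] by simp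
  define W where "W z = wnorm q z (deriv g z)" for z
  have cW: "continuous_on udisc W" unfolding W_def
    by (intro continuous_on_weighted continuous_on_deriv_disc hol q)
  have W0: "0 \<le> W z" for z by (simp add: W_def)
  have Wi: "set_integrable lborel udisc W" using gD Dspace_iff[OF q] by (simp add: W_def[abs_def])
  \<comment> \<open>The threshold anticipates \<open>powr_suminf_le\<close> with weights (1/2)^k,
    which costs the factors \<open>(2 ^ k) powr q\<close>; after cancellation the geometric series
    remains.\<close>
  define T where "T k r \<longleftrightarrow> disc_int (\<lambda>z. W z * (norm z ^ (2 * r + 1)) powr q) \<le> ennreal ((1/2) ^ k / (2 ^ k) powr q)"
    for k r :: nat
  have T: "eventually (T k) sequentially" for k
  proof -
    have "eventually (\<lambda>N. disc_int (\<lambda>z. W z * (norm z ^ N) powr q) \<le> ennreal ((1/2) ^ k / (2 ^ k) powr q)) sequentially"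
      by (intro power_weight_tail cW W0 Wi q) simp
    moreover have "filterlim (\<lambda>r::nat. 2 * r + 1) sequentially sequentially"
      by (intro filterlim_subseq) (simp add: strict_mono_def)
    ultimately show ?thesis unfolding T_def by (rule eventually_compose_filterlim)
  qed
  obtain m where m: "\<forall>k. 1 \<le> m k \<and> (\<forall>j<k. 4 * m j \<le> m k) \<and> T k (m k) \<and>
    (\<Sum>j<k. real (2 * m j + 1)) \<le> (real k + 1) powr (- 1 / q) * real (2 * m k + 1) / 8 \<and>
    (\<forall>i<k. real (2 * m k + 1) * (1 - 1 / (4 * real (2 * m i + 1))) ^ (2 * m k) \<le> (1/2) ^ k / 16)"
    using exists_sparse_sequence[of T "\<lambda>k. (real k + 1) powr (- 1 / q)", OF T] by auto
  interpret L: lacunary_series q m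
    using q m by unfold_locales auto
  have mT: "disc_int (\<lambda>z. W z * (norm z ^ L.n k) powr q) \<le> ennreal ((1/2) ^ k / (2 ^ k) powr q)" for k
    using m unfolding T_def L.n_def by blast
  have early: "(\<Sum>j<k. real (L.n j)) \<le> L.a k * real (L.n k) / 8" for k
    using m unfolding L.n_def L.a_def by blast
  have late: "real (L.n k) * (1 - 1 / (4 * real (L.n i))) ^ (2 * m k) \<le> (1/2) ^ k / 16" if "i < k" for i k
    using m that unfolding L.n_def by blast
  note holf = L.f_holomorphic
  have fg: "(\<lambda>z. L.f z * g z) \<in> Dspace q" using mult L.f_Dspace[OF p] L.f_Bloch by blast
  have c1: "continuous_on udisc (\<lambda>z. wnorm q z (L.f z * deriv g z))"
    by (intro continuous_on_weighted continuous_on_mult continuous_on_deriv_disc hol holomorphic_on_imp_continuous_on holf q)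
  have c2: "continuous_on udisc (\<lambda>z. wnorm q z (deriv L.f z * g z))"
    by (intro continuous_on_weighted continuous_on_mult continuous_on_deriv_disc hol holomorphic_on_imp_continuous_on holf q)
  have int1: "set_integrable lborel udisc (\<lambda>z. wnorm q z (L.f z * deriv g z))"
  proof -
    define v where "v k z = W z * (norm z ^ L.n k) powr q" for k z
    have cv: "continuous_on udisc (v k)" for k
      unfolding v_def[abs_def] using q cW by (intro continuous_on_mult continuous_on_powr' continuous_intros) auto
    have vm: "(\<lambda>z. ennreal (v k z) * indicator udisc z) \<in> borel_measurable lborel" for k
      using set_nn_integral_disc_measurable[OF cv, of k] W0 by (simp add: v_def)
    have pt: "ennreal (wnorm q z (L.f z * deriv g z))
      \<le> ennreal (2 powr q) * (\<Sum>k. ennreal ((2 ^ k) powr q) * ennreal (v k z))" if z: "z \<in> udisc" for z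
    proof -
      have le: "norm (of_real (L.a k) * z ^ L.n k) \<le> norm z ^ L.n k" for k
        using L.a_pos[of k] L.a_le_1[of k] by (simp add: norm_mult norm_power mult_left_le_one_le)
      have e: "(1/2) ^ k * (2 ^ k * y) = y" for k and y :: real
        by (simp add: power_one_over)
      have s: "summable (\<lambda>k. norm z ^ L.n k)"
      proof (rule summable_comparison_test'[OF summable_geometric[of "norm z"], of 0])
        show "norm (norm z) < 1" using z by simp
        show "norm (norm z ^ L.n k) \<le> norm z ^ k" for k
          using L.k_le_n[of k] z by (simp add: power_decreasing)
      qed
      have s': "summable (\<lambda>k. norm (of_real (L.a k) * z ^ L.n k))"
        using le by (intro summable_comparison_test'[OF s, of 0]) auto
      have "norm (L.f z) \<le> (\<Sum>k. norm (of_real (L.a k) * z ^ L.n k))"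
        unfolding L.f_def by (rule summable_norm[OF s'])
      also have "... \<le> (\<Sum>k. norm z ^ L.n k)" using le s' s by (intro suminf_le) auto
      also have "... = (\<Sum>k. (1/2) ^ k * (2 ^ k * norm z ^ L.n k))" by (simp only: e)
      finally have "ennreal (norm (L.f z) powr q) \<le> ennreal ((\<Sum>k. (1/2) ^ k * (2 ^ k * norm z ^ L.n k)) powr q)"
        using q by (intro ennreal_leI powr_mono2) auto
      also have "... \<le> ennreal (2 powr q) * (\<Sum>k. ennreal ((2 ^ k * norm z ^ L.n k) powr q))"
        using s q by (intro powr_suminf_le) (auto simp: suminf_geometric e)
      finally have "ennreal (W z) * ennreal (norm (L.f z) powr q)
        \<le> ennreal (W z) * (ennreal (2 powr q) * (\<Sum>k. ennreal ((2 ^ k * norm z ^ L.n k) powr q)))"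
        by (intro mult_left_mono) auto
      also have "... = ennreal (2 powr q) * (\<Sum>k. ennreal (W z) * ennreal ((2 ^ k * norm z ^ L.n k) powr q))"
        by (simp add: ac_simps)
      also have "(\<lambda>k. ennreal (W z) * ennreal ((2 ^ k * norm z ^ L.n k) powr q)) = (\<lambda>k. ennreal ((2 ^ k) powr q) * ennreal (v k z))"
        using W0[of z] by (simp add: fun_eq_iff v_def powr_mult ennreal_mult'[symmetric] mult_ac)
      also have "ennreal (W z) * ennreal (norm (L.f z) powr q) = ennreal (wnorm q z (L.f z * deriv g z))"
        using W0[of z] by (simp add: ennreal_mult'[symmetric] W_def norm_mult powr_mult mult_ac)
      finally show ?thesis .
    qed
    have "disc_int (\<lambda>z. wnorm q z (L.f z * deriv g z))
      \<le> (\<integral>\<^sup>+z. ennreal (2 powr q) * (\<Sum>k. ennreal ((2 ^ k) powr q) * (ennreal (v k z) * indicator udisc z)) \<partial>lborel)"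
      using pt by (intro nn_integral_mono) (auto simp: indicator_def)
    also have "... = ennreal (2 powr q) * (\<Sum>k. ennreal ((2 ^ k) powr q) * disc_int (v k))"
      using vm by (simp add: nn_integral_cmult nn_integral_suminf)
    also have "... \<le> ennreal (2 powr q) * (\<Sum>k. ennreal ((2 ^ k) powr q) * ennreal ((1/2) ^ k / (2 ^ k) powr q))"
      using mT by (intro mult_left_mono suminf_le) (auto simp: v_def intro!: mult_left_mono)
    also have "(\<Sum>k. ennreal ((2 ^ k) powr q) * ennreal ((1/2) ^ k / (2 ^ k) powr q)) = (\<Sum>k. ennreal ((1/2) ^ k))"
      by (intro suminf_cong) (simp add: ennreal_mult'[symmetric])
    also have "... = ennreal (\<Sum>k. (1/2) ^ k)" by (intro suminf_ennreal2 summable_geometric) auto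
    also have "ennreal (2 powr q) * ... < \<infinity>" by (simp add: ennreal_mult_less_top)
    finally show ?thesis using set_integrable_disc_iff[OF c1] by simp
  qed
  have int2: "set_integrable lborel udisc (\<lambda>z. wnorm q z (deriv L.f z * g z))"
  proof (rule set_integrable_disc_dominated[OF _ c2])
    show "set_integrable lborel udisc (\<lambda>z. 2 powr q * (wnorm q z (deriv (\<lambda>z. L.f z * g z) z)
       + wnorm q z (L.f z * deriv g z)))"
      using int1 fg Dspace_iff[OF q] by (intro set_integrable_mult_right set_integral_add) auto
    fix z :: complex assume z: "z \<in> udisc"
    have "norm (deriv L.f z * g z) \<le> norm (deriv (\<lambda>z. L.f z * g z) z) + norm (L.f z * deriv g z)"
      using norm_triangle_ineq4[of "deriv (\<lambda>z. L.f z * g z) z" "L.f z * deriv g z"]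
      by (simp add: deriv_mult_disc[OF holf hol z])
    hence "norm (deriv L.f z * g z) powr q \<le> (norm (deriv (\<lambda>z. L.f z * g z) z) + norm (L.f z * deriv g z)) powr q"
      using q by (intro powr_mono2) auto
    also have "... \<le> 2 powr q * (norm (deriv (\<lambda>z. L.f z * g z) z) powr q + norm (L.f z * deriv g z) powr q)"
      using q by (intro powr_add_le_two_powr) auto
    finally have "wnorm q z (deriv L.f z * g z)
      \<le> (1 - norm z) powr (q - 1) * (2 powr q * (norm (deriv (\<lambda>z. L.f z * g z) z) powr q + norm (L.f z * deriv g z) powr q))"
      by (intro mult_left_mono) auto
    thus "wnorm q z (deriv L.f z * g z) \<le>
      2 powr q * (wnorm q z (deriv (\<lambda>z. L.f z * g z) z) + wnorm q z (L.f z * deriv g z))"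
      by (simp add: algebra_simps)
  qed simp
  define h where "h z = ennreal (wnorm q z (deriv L.f z * g z)) * indicator udisc z" for z
  have hm: "h \<in> borel_measurable lborel"
    using set_nn_integral_disc_measurable[OF c2] by (simp add: h_def[abs_def])
  have hfin: "(\<integral>\<^sup>+z. h z \<partial>lborel) < \<infinity>"
    using int2 set_integrable_disc_iff[OF c2] by (simp add: h_def)
  obtain \<delta> where \<delta>: "\<delta> > 0" "\<And>s t. 1/2 \<le> s \<Longrightarrow> s \<le> t \<Longrightarrow> t < 1 \<Longrightarrow>
      ennreal (\<delta> * (t^2 - s^2)) \<le> (\<integral>\<^sup>+z\<in>shell s t. ennreal (norm (g z) powr q) \<partial>lborel)"
    by (rule shell_powr_mean_lower_bound[OF H w nz q]) blast
  define S where "S k = shell (1 - 1 / (2 * real (L.n k))) (1 - 1 / (4 * real (L.n k)))" for k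
  \<comment> \<open>1/16 comes from \<open>shell_weight_lower_bound\<close>, \<open>\<delta>\<close>
    from the shell means, 1/4 from the area of the shell.\<close>
  define c where "c = (1/16) powr q * \<delta> / 4"
  have c: "c > 0" using \<delta> by (simp add: c_def)
  have n1: "real (L.n k) \<ge> 1" for k by (simp add: L.n_def)
  have lower: "ennreal (c / (real k + 1)) \<le> (\<integral>\<^sup>+z\<in>S k. h z \<partial>lborel)" for k
  proof -
    define N where "N = real (L.n k)"
    have N: "N \<ge> 1" using n1 by (simp add: N_def)
    define s t where "s = 1 - 1 / (2 * N)" and "t = 1 - 1 / (4 * N)"
    have st: "1/2 \<le> s" "s \<le> t" "t < 1" using N by (auto simp: s_def t_def field_simps)
    define B where "B = (1/16) powr q * (1 / (real k + 1) * N)"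
    have B: "B \<ge> 0" using N by (simp add: B_def)
    have Sk: "S k = shell s t" by (simp add: S_def s_def t_def N_def)
    have pt: "ennreal B * (ennreal (norm (g z) powr q) * indicator (S k) z) \<le> h z * indicator (S k) z" for z
    proof (cases "z \<in> S k")
      case True
      hence z: "s \<le> norm z" "norm z \<le> t" by (auto simp: Sk shell_def)
      hence zd: "z \<in> udisc" using st by auto
      have "L.a k * N / 4 \<le> norm (deriv L.f z)"
        unfolding N_def using z by (intro L.deriv_f_lower_bound early late) (auto simp: s_def t_def N_def)
      hence "(1/16) powr q * (L.a k powr q * N) \<le> wnorm q z (deriv L.f z)"
        using z N L.a_pos[of k] by (intro shell_weight_lower_bound q) (auto simp: s_def t_def)
      hence "B \<le> wnorm q z (deriv L.f z)" by (simp add: B_def L.a_powr_q)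
      hence "B * norm (g z) powr q \<le> wnorm q z (deriv L.f z) * norm (g z) powr q"
        by (intro mult_right_mono) auto
      also have "... = wnorm q z (deriv L.f z * g z)" by (simp add: norm_mult powr_mult)
      finally have "ennreal (B * norm (g z) powr q) \<le> ennreal (wnorm q z (deriv L.f z * g z))"
        by (rule ennreal_leI)
      thus ?thesis using True zd B by (simp add: h_def ennreal_mult')
    qed simp
    \<comment> \<open>The width is \<open>1 / (4 * N)\<close> and \<open>t + s \<ge> 1\<close>. This
      \<open>1 / N\<close> cancels the \<open>N\<close> in \<open>B\<close> and leaves a multiple of
      \<open>a k powr q\<close>.\<close>
    have "1 / (4 * N) \<le> t^2 - s^2"
    proof -
      have "1 / (4 * N) * 1 \<le> (t - s) * (t + s)"
        using st N by (intro mult_mono) (auto simp: s_def t_def field_simps)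
      thus ?thesis by (simp add: power2_eq_square algebra_simps)
    qed
    hence "B * (\<delta> * (1 / (4 * N))) \<le> B * (\<delta> * (t^2 - s^2))" using B \<delta> by (intro mult_left_mono) auto
    moreover have "B * (\<delta> * (1 / (4 * N))) = c / (real k + 1)" using N by (simp add: B_def c_def)
    ultimately have "ennreal (c / (real k + 1)) \<le> ennreal (B * (\<delta> * (t^2 - s^2)))" by (intro ennreal_leI) simp
    also have "... = ennreal B * ennreal (\<delta> * (t^2 - s^2))" using B by (rule ennreal_mult')
    also have "... \<le> ennreal B * (\<integral>\<^sup>+z\<in>S k. ennreal (norm (g z) powr q) \<partial>lborel)"
      unfolding Sk using st by (intro mult_left_mono \<delta>) auto
    also have "... = (\<integral>\<^sup>+z. ennreal B * (ennreal (norm (g z) powr q) * indicator (S k) z) \<partial>lborel)"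
    proof (rule nn_integral_cmult[symmetric])
      have sub: "shell s t \<subseteq> udisc" using st by (auto simp: shell_def)
      have "continuous_on (shell s t) (\<lambda>z. norm (g z) powr q)"
        using q by (intro continuous_on_powr' continuous_on_norm continuous_on_const
          continuous_on_subset[OF holomorphic_on_imp_continuous_on[OF hol] sub]) auto
      hence "(\<lambda>z. indicator (shell s t) z *\<^sub>R norm (g z) powr q) \<in> borel_measurable borel"
        by (intro borel_measurable_continuous_on_indicator) auto
      hence "(\<lambda>z. ennreal (indicator (shell s t) z *\<^sub>R norm (g z) powr q)) \<in> borel_measurable lborel" by simp
      also have "(\<lambda>z. ennreal (indicator (shell s t) z *\<^sub>R norm (g z) powr q)) = (\<lambda>z. ennreal (norm (g z) powr q) * indicator (S k) z)"
        by (auto simp: indicator_def Sk)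
      finally show "(\<lambda>z. ennreal (norm (g z) powr q) * indicator (S k) z) \<in> borel_measurable lborel" .
    qed
    also have "... \<le> (\<integral>\<^sup>+z\<in>S k. h z \<partial>lborel)" by (intro nn_integral_mono pt)
    finally show ?thesis .
  qed
  have disj: "disjoint_family S"
  proof -
    have "S j \<inter> S k = {}" if jk: "j < k" for j k
    proof -
      \<comment> \<open>More than doubling separates the shells: the outer radius
        \<open>1 - 1 / (4 * n j)\<close> stays below the inner radius
        \<open>1 - 1 / (2 * n k)\<close>.\<close>
      have "2 * L.n j < L.n k" using L.m_lacunary[OF jk] L.m_pos[of j] by (simp add: L.n_def)
      hence "2 * real (L.n j) < real (L.n k)" by linarith
      hence "1 / (2 * real (L.n k)) < 1 / (4 * real (L.n j))" using n1[of j] n1[of k] by (simp add: field_simps)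
      thus ?thesis unfolding S_def shell_def by auto
    qed
    thus ?thesis unfolding disjoint_family_on_def by (metis Int_commute linorder_neqE_nat)
  qed
  have "(\<Sum>k. ennreal (c / (real k + 1))) \<le> (\<Sum>k. \<integral>\<^sup>+z\<in>S k. h z \<partial>lborel)"
    by (intro suminf_le lower) auto
  also have "... = (\<integral>\<^sup>+z\<in>(\<Union>k. S k). h z \<partial>lborel)"
  proof (rule nn_integral_disjoint_family[symmetric])
    show "S k \<in> sets lborel" for k by (simp add: S_def)
  qed (use hm disj in simp_all)
  also have "... \<le> (\<integral>\<^sup>+z. h z \<partial>lborel)" by (intro nn_integral_mono) (auto simp: indicator_def)
  also have "... < \<infinity>" by (rule hfin)
  finally have "summable (\<lambda>k. c / (real k + 1))" using c by (intro summable_suminf_not_top) auto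
  hence "summable (\<lambda>k. inverse c * (c / (real k + 1)))" by (rule summable_mult)
  also have "(\<lambda>k. inverse c * (c / (real k + 1))) = (\<lambda>k. real (Suc k) powr (-1))"
    using c by (simp add: powr_minus_divide add.commute)
  finally have "summable (\<lambda>k. real k powr (-1))" by (subst (asm) summable_Suc_iff)
  thus False unfolding summable_real_powr_iff by simp
qed

lemma multipliers_eq_zero_space:
  assumes "0 < q" "q < p"
  shows "multipliers (Dspace p \<inter> Bloch) (Dspace q \<inter> Bloch) = zero_space"
proof (intro equalityI subsetI)
  fix g assume "g \<in> multipliers (Dspace p \<inter> Bloch) (Dspace q \<inter> Bloch)"
  thus "g \<in> zero_space" using multiplier_eq_zero[OF assms] by (auto simp: zero_space_def multipliers_def)
next
  fix g assume g: "g \<in> zero_space"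
  have "(\<lambda>z. f z * g z) \<in> Dspace q \<inter> Bloch" if f: "f \<in> Bloch" for f
  proof -
    have d: "deriv (\<lambda>z. f z * g z) z = 0" if z: "z \<in> udisc" for z
    proof -
      \<comment> \<open>Nothing is known of \<open>g\<close> outside the disc, so the product is
        replaced by 0 only near \<open>z\<close>.\<close>
      have "deriv (\<lambda>z. f z * g z) z = deriv (\<lambda>z. 0) z"
        using g z by (intro deriv_cong_ev refl eventually_mono[OF eventually_nhds_in_open[of udisc]])
          (auto simp: zero_space_def)
      thus ?thesis by simp
    qed
    have hol: "(\<lambda>z. f z * g z) holomorphic_on udisc"
      using f g by (auto simp: zero_space_def Bloch_def intro!: holomorphic_intros)
    have "set_integrable lborel udisc (\<lambda>z. wnorm q z (deriv (\<lambda>z. f z * g z) z))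
      \<longleftrightarrow> set_integrable lborel udisc (\<lambda>z. 0 :: real)"
      using d by (intro set_integrable_cong) auto
    thus ?thesis using d hol assms by (auto simp: Bloch_def Dspace_iff set_integrable_def)
  qed
  thus "g \<in> multipliers (Dspace p \<inter> Bloch) (Dspace q \<inter> Bloch)"
    using g by (auto simp: multipliers_def zero_space_def)
qed

theorem theorem1:
  shows "(\<forall>p q :: real. 1 < q \<and> 0 < p \<and> p \<le> q \<longrightarrow>
            multipliers (Dspace p \<inter> Bloch) (Dspace q \<inter> Bloch) = multipliers Bloch Bloch \<and>
            multipliers Bloch Bloch = Bloch_log \<inter> Hinf) \<and>
         (\<forall>p q :: real. 0 < q \<and> q < p \<longrightarrow>
            multipliers (Dspace p \<inter> Bloch) (Dspace q \<inter> Bloch) = zero_space)"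
  by (simp add: multipliers_eq multipliers_Bloch_eq multipliers_eq_zero_space)

end
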